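(* Let $p$ be a prime, let $G=\mathbb{Z}/p$, and let $X$ be a finite $G$-CW-complex with $\tilde{H}_\bullet(X;\mathbb{Z})=0$. Then $\tilde{H}_\bullet(X/G;\mathbb{Z})=0$.
   Context: A $G$-CW-complex ($G$ a finite group) is a CW-complex $X$ with a cellular $G$-action such that if $g\in G$ fixes a cell $\sigma$ (i.e. $g\sigma=\sigma$), then $g$ fixes $\sigma$ pointwise; it is finite if it has finitely many cells. The quotient $X/G$ is then a CW-complex. $\tilde{H}_\bullet$ denotes reduced homology. *)

theory Defs
  imports
    "HOL-Homology.Homology"
    "HOL-Algebra.Group_Action"
    "HOL-Algebra.Elementary_Groups"
    "HOL-Computational_Algebra.Primes"
begin

definition closed_disc :: "nat \<Rightarrow> (nat \<Rightarrow> real) topology" where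
  "closed_disc n = subtopology (Euclidean_space n) {x. (\<Sum>i<n. x i ^ 2) \<le> 1}"

definition open_disc :: "nat \<Rightarrow> (nat \<Rightarrow> real) topology" where
  "open_disc n = subtopology (Euclidean_space n) {x. (\<Sum>i<n. x i ^ 2) < 1}"

definition disc_boundary :: "nat \<Rightarrow> (nat \<Rightarrow> real) set" where
  "disc_boundary n = topspace (closed_disc n) - topspace (open_disc n)"

text \<open>
  A cell structure is given by the function \<open>E\<close> sending \<open>n\<close> to the set of open \<open>n\<close>-cells.
\<close>

definition skeleton :: "(nat \<Rightarrow> 'a set set) \<Rightarrow> nat \<Rightarrow> 'a set" where
  "skeleton E n = (\<Union>m\<in>{..n}. \<Union>(E m))"

definition characteristic_map ::
  "'a topology \<Rightarrow> (nat \<Rightarrow> 'a set set) \<Rightarrow> nat \<Rightarrow> 'a set \<Rightarrow> ((nat \<Rightarrow> real) \<Rightarrow> 'a) \<Rightarrow> bool" where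
  "characteristic_map X E n e \<Phi> \<longleftrightarrow>
     continuous_map (closed_disc n) X \<Phi> \<and>
     homeomorphic_map (open_disc n) (subtopology X e) \<Phi> \<and>
     \<Phi> ` disc_boundary n \<subseteq> (\<Union>m\<in>{..<n}. \<Union>(E m))"

text \<open>
  The last two conjuncts are closure-finiteness and the weak topology with respect to the
  closed cells.
\<close>

definition CW_complex :: "'a topology \<Rightarrow> (nat \<Rightarrow> 'a set set) \<Rightarrow> bool" where
  "CW_complex X E \<longleftrightarrow>
     Hausdorff_space X \<and>
     (\<Union>n. \<Union>(E n)) = topspace X \<and>
     (\<forall>m n. \<forall>e\<in>E m. \<forall>f\<in>E n. e \<inter> f \<noteq> {} \<longrightarrow> m = n \<and> e = f) \<and>
     (\<forall>n. \<forall>e\<in>E n. \<exists>\<Phi>. characteristic_map X E n e \<Phi>) \<and>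
     (\<forall>n. \<forall>e\<in>E n. finite {f \<in> (\<Union>m. E m). f \<inter> X closure_of e \<noteq> {}}) \<and>
     (\<forall>C \<subseteq> topspace X.
        closedin X C \<longleftrightarrow> (\<forall>n. \<forall>e\<in>E n. closedin X (C \<inter> X closure_of e)))"

definition cellular_map ::
  "'a topology \<Rightarrow> (nat \<Rightarrow> 'a set set) \<Rightarrow> 'b topology \<Rightarrow> (nat \<Rightarrow> 'b set set) \<Rightarrow> ('a \<Rightarrow> 'b) \<Rightarrow> bool" where
  "cellular_map X E Y F f \<longleftrightarrow>
     continuous_map X Y f \<and> (\<forall>n. f ` skeleton E n \<subseteq> skeleton F n)"

text \<open>
  As each \<open>\<phi> g\<close> has the cellular inverse \<open>\<phi> (inv g)\<close>, it preserves every \<open>skeleton E n\<close>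
  exactly, and so permutes the open \<open>n\<close>-cells, which are the connected components of
  \<open>skeleton E n\<close> minus the lower cells.
\<close>

definition G_CW_complex ::
  "('g, 'b) monoid_scheme \<Rightarrow> 'a topology \<Rightarrow> (nat \<Rightarrow> 'a set set) \<Rightarrow> ('g \<Rightarrow> 'a \<Rightarrow> 'a) \<Rightarrow> bool" where
  "G_CW_complex G X E \<phi> \<longleftrightarrow>
     finite (carrier G) \<and>
     CW_complex X E \<and>
     group_action G (topspace X) \<phi> \<and>
     (\<forall>g\<in>carrier G. cellular_map X E X E (\<phi> g)) \<and>
     (\<forall>g\<in>carrier G. \<forall>n. \<forall>e\<in>E n. \<phi> g ` e = e \<longrightarrow> (\<forall>x\<in>e. \<phi> g x = x))"

definition finite_G_CW_complex ::
  "('g, 'b) monoid_scheme \<Rightarrow> 'a topology \<Rightarrow> (nat \<Rightarrow> 'a set set) \<Rightarrow> ('g \<Rightarrow> 'a \<Rightarrow> 'a) \<Rightarrow> bool" where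
  "finite_G_CW_complex G X E \<phi> \<longleftrightarrow> G_CW_complex G X E \<phi> \<and> finite (\<Union>n. E n)"

definition orbit_space ::
  "('g, 'b) monoid_scheme \<Rightarrow> 'a topology \<Rightarrow> ('g \<Rightarrow> 'a \<Rightarrow> 'a) \<Rightarrow> 'a set topology" where
  "orbit_space G X \<phi> = topology (\<lambda>U. U \<subseteq> orbits G (topspace X) \<phi> \<and>
     openin X {x \<in> topspace X. orbit G \<phi> x \<in> U})"

lemma openin_orbit_space:
  "openin (orbit_space G X \<phi>) U \<longleftrightarrow>
     U \<subseteq> orbits G (topspace X) \<phi> \<and> openin X {x \<in> topspace X. orbit G \<phi> x \<in> U}"
proof -
  have "istopology (\<lambda>U. U \<subseteq> orbits G (topspace X) \<phi> \<and>
     openin X {x \<in> topspace X. orbit G \<phi> x \<in> U})"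
    unfolding istopology_def
  proof (intro conjI allI impI)
    fix S T
    assume "S \<subseteq> orbits G (topspace X) \<phi> \<and> openin X {x \<in> topspace X. orbit G \<phi> x \<in> S}"
      and "T \<subseteq> orbits G (topspace X) \<phi> \<and> openin X {x \<in> topspace X. orbit G \<phi> x \<in> T}"
    moreover have "{x \<in> topspace X. orbit G \<phi> x \<in> S \<inter> T} =
        {x \<in> topspace X. orbit G \<phi> x \<in> S} \<inter> {x \<in> topspace X. orbit G \<phi> x \<in> T}"
      by auto
    ultimately show "S \<inter> T \<subseteq> orbits G (topspace X) \<phi>"
      and "openin X {x \<in> topspace X. orbit G \<phi> x \<in> S \<inter> T}"
      by auto
  next
    fix K
    assume *: "\<forall>U\<in>K. U \<subseteq> orbits G (topspace X) \<phi> \<and>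
        openin X {x \<in> topspace X. orbit G \<phi> x \<in> U}"
    then show "\<Union>K \<subseteq> orbits G (topspace X) \<phi>"
      by auto
    have "{x \<in> topspace X. orbit G \<phi> x \<in> \<Union>K} =
        (\<Union>U\<in>K. {x \<in> topspace X. orbit G \<phi> x \<in> U})"
      by auto
    with * show "openin X {x \<in> topspace X. orbit G \<phi> x \<in> \<Union>K}"
      by auto
  qed
  then show ?thesis
    by (simp add: orbit_space_def topology_inverse')
qed

lemma topspace_orbit_space: "topspace (orbit_space G X \<phi>) = orbits G (topspace X) \<phi>"
proof -
  have "{x \<in> topspace X. orbit G \<phi> x \<in> orbits G (topspace X) \<phi>} = topspace X"
    by (auto simp: orbits_def)
  then have "openin (orbit_space G X \<phi>) (orbits G (topspace X) \<phi>)"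
    by (simp add: openin_orbit_space)
  then show ?thesis
    by (metis openin_orbit_space openin_subset openin_topspace subset_antisym)
qed

lemma quotient_map_orbit_space: "quotient_map X (orbit_space G X \<phi>) (orbit G \<phi>)"
  unfolding quotient_map_def topspace_orbit_space
  by (auto simp: openin_orbit_space orbits_def)

end

theory Submission
  imports Defs "HOL-Analysis.Urysohn"
begin

text \<open>
  Let \<open>S\<close> be the augmented singular chain complex of \<open>X\<close>, let \<open>g\<close> generate \<open>G\<close>, put
  \<open>N = 1 + g + \<dots> + g\<^sup>p\<^sup>-\<^sup>1\<close>, and let \<open>M\<close> be the chains of the fixed point set.
  The modules \<open>S / M\<close> are induced, and both \<open>N\<close> and \<open>1 - g\<close> map \<open>R = M + pS\<close> into \<open>pS\<close>. As
  \<open>S / pS\<close> is acyclic and \<open>S / M\<close> has bounded homology, a downward induction on the degree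
  shows that \<open>S / R\<close> and its coinvariants are acyclic. Since \<open>R / pS\<close> is then acyclic as well,
  the homology of \<open>S / ker N\<close> vanishes modulo \<open>p\<close>. It is also killed by \<open>p\<close>, because \<open>N\<close> factors
  multiplication by \<open>p\<close> through \<open>S\<close>; hence \<open>S / ker N\<close> is acyclic.

  It remains to compare \<open>S / ker N\<close> with the chains of the quotient. On the fixed point
  set they agree. Relative to it, the comparison is a quasi-isomorphism by attaching one free
  orbit of cells at a time: after excision only neighbourhoods of the open cells matter, and
  there the quotient map is a trivial covering.
\<close>

section \<open>Relative acyclicity and mapping cones\<close>

text \<open>The obstacle is that a singular simplex of the quotient need not lift to
  \<open>X\<close>, so the chains of \<open>X/G\<close> are not the coinvariants of
  \<open>S\<close>. The two can be compared only up to quasi-isomorphism, and this is where the cell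
  structure enters. Primality enters through stabilisers: whatever is fixed by a nontrivial power of
  \<open>g\<close> is fixed by \<open>g\<close>, so simplices and cells outside the fixed point set
  have free orbits. Finiteness supplies the degree from which the downward induction starts. No
  quotient module is ever formed. A statement on the homology of \<open>A / B\<close> is phrased
  with a pair of subgroups of one type, and a quasi-isomorphism is expressed as relative acyclicity
  of a pair of mapping cones, so that one transitivity argument for triples serves both. Excision
  and the deformation of punctured cells are not set up equivariantly. They reach the coinvariants
  by algebra alone, because the quotient complexes concerned are induced.\<close>

definition subgrp :: "'m::ab_group_add set \<Rightarrow> bool" where
  "subgrp A \<longleftrightarrow> 0 \<in> A \<and> (\<forall>x\<in>A. \<forall>y\<in>A. x - y \<in> A)"

lemma subgrp_0: "subgrp A \<Longrightarrow> 0 \<in> A"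
  and subgrp_diff: "subgrp A \<Longrightarrow> x \<in> A \<Longrightarrow> y \<in> A \<Longrightarrow> x - y \<in> A"
  by (auto simp: subgrp_def)

lemma subgrp_minus: "subgrp A \<Longrightarrow> x \<in> A \<Longrightarrow> - x \<in> A"
  by (metis diff_0 subgrp_def)

lemma subgrp_add: "subgrp A \<Longrightarrow> x \<in> A \<Longrightarrow> y \<in> A \<Longrightarrow> x + y \<in> A"
  by (metis diff_minus_eq_add subgrp_diff subgrp_minus)

lemma subgrp_cancel_right: "subgrp A \<Longrightarrow> y \<in> A \<Longrightarrow> x - y \<in> A \<longleftrightarrow> x \<in> A"
  by (metis diff_add_cancel subgrp_add subgrp_diff)

lemma subgrp_sum: "subgrp A \<Longrightarrow> (\<And>i. i \<in> I \<Longrightarrow> f i \<in> A) \<Longrightarrow> sum f I \<in> A"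
  by (induction I rule: infinite_finite_induct) (auto simp: subgrp_0 subgrp_add)

text \<open>Degree 0 has zero boundary, so the truncated \<open>n - 1\<close> imposes no condition
  there. That boundaries compose to zero is left to \<open>subcomplex\<close>, as singular
  boundaries do so on singular chains.\<close>

locale differential =
  fixes d :: "nat \<Rightarrow> 'm::ab_group_add \<Rightarrow> 'm"
  assumes d_diff: "d n (x - y) = d n x - d n y"
    and d_zero: "d 0 x = 0"
begin

lemma d_0 [simp]: "d n 0 = 0"
  using d_diff[of n 0 0] by simp

lemma d_minus: "d n (- x) = - d n x"
  using d_diff[of n 0 x] by simp

lemma d_add: "d n (x + y) = d n x + d n y"
  using d_diff[of n x "- y"] by (simp add: d_minus)

definition subcomplex :: "(nat \<Rightarrow> 'm set) \<Rightarrow> bool" where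
  "subcomplex A \<longleftrightarrow> (\<forall>n. subgrp (A n)) \<and> (\<forall>n. \<forall>x\<in>A n. d n x \<in> A (n - 1)) \<and>
     (\<forall>n. \<forall>x\<in>A n. d (n - 1) (d n x) = 0)"

text \<open>
  Vanishing of the homology of \<open>A / B\<close> in degree \<open>n\<close>.
\<close>

definition acyc :: "(nat \<Rightarrow> 'm set) \<Rightarrow> (nat \<Rightarrow> 'm set) \<Rightarrow> nat \<Rightarrow> bool" where
  "acyc A B n \<longleftrightarrow> (\<forall>x\<in>A n. d n x \<in> B (n - 1) \<longrightarrow> (\<exists>y\<in>A (Suc n). x - d (Suc n) y \<in> B n))"

lemma acycD:
  assumes "acyc A B n" "x \<in> A n" "d n x \<in> B (n - 1)"
  obtains y where "y \<in> A (Suc n)" "x - d (Suc n) y \<in> B n"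
  using assms by (auto simp: acyc_def)

lemma subcomplexD:
  assumes "subcomplex A"
  shows "subgrp (A n)" "x \<in> A n \<Longrightarrow> d n x \<in> A (n - 1)" "x \<in> A n \<Longrightarrow> d (n - 1) (d n x) = 0"
    "x \<in> A (Suc n) \<Longrightarrow> d (Suc n) x \<in> A n" "x \<in> A (Suc n) \<Longrightarrow> d n (d (Suc n) x) = 0"
  using assms unfolding subcomplex_def by (auto, (metis diff_Suc_1)+)

text \<open>Exactness of H(B/C) -> H(A/C) -> H(A/B) at the middle term.\<close>

lemma acyc_trans:
  assumes A: "subcomplex A" and B: "subcomplex B" and C: "subcomplex C"
    and sub: "\<And>n. B n \<subseteq> A n" "\<And>n. C n \<subseteq> B n"
    and AB: "acyc A B n" and BC: "acyc B C n"
  shows "acyc A C n"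
  unfolding acyc_def
proof (intro ballI impI)
  fix x assume x: "x \<in> A n" "d n x \<in> C (n - 1)"
  then obtain y where y: "y \<in> A (Suc n)" "x - d (Suc n) y \<in> B n"
    using acycD[OF AB] sub(2) by blast
  have "d n (x - d (Suc n) y) = d n x"
    using subcomplexD[OF A] y(1) by (simp add: d_diff)
  then obtain z where z: "z \<in> B (Suc n)" "x - d (Suc n) y - d (Suc n) z \<in> C n"
    using acycD[OF BC y(2)] x(2) by metis
  moreover have "x - d (Suc n) (y + z) = x - d (Suc n) y - d (Suc n) z"
    by (simp add: d_add)
  ultimately show "\<exists>y\<in>A (Suc n). x - d (Suc n) y \<in> C n"
    using subgrp_add[OF subcomplexD(1)[OF A] y(1)] sub(1) by (metis subsetD)
qed

text \<open>Exactness of H_{n+1}(A/B) -> H_n(B/C) -> H_n(A/C) at the middle term.\<close>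

lemma acyc_third:
  assumes A: "subcomplex A" and sub: "\<And>n. B n \<subseteq> A n" "\<And>n. C n \<subseteq> B n"
    and B: "subcomplex B" and AC: "acyc A C n" and AB: "acyc A B (Suc n)"
  shows "acyc B C n"
  unfolding acyc_def
proof (intro ballI impI)
  fix x assume x: "x \<in> B n" "d n x \<in> C (n - 1)"
  then obtain y where y: "y \<in> A (Suc n)" "x - d (Suc n) y \<in> C n"
    using acycD[OF AC] sub(1) by blast
  have "x - (x - d (Suc n) y) \<in> B n"
    using sub(2) x y subcomplexD(1)[OF B] subgrp_diff by blast
  then have "d (Suc n) y \<in> B (Suc n - 1)"
    by simp
  then obtain z where z: "z \<in> A (Suc (Suc n))" "y - d (Suc (Suc n)) z \<in> B (Suc n)"
    using acycD[OF AB y(1)] by blast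
  have "d (Suc n) (y - d (Suc (Suc n)) z) = d (Suc n) y"
    using subcomplexD[OF A] z(1) by (simp add: d_diff)
  then show "\<exists>y\<in>B (Suc n). x - d (Suc n) y \<in> C n"
    using z(2) y(2) by metis
qed

lemma acyc_refl: "subcomplex A \<Longrightarrow> acyc A A n"
  unfolding acyc_def by (metis d_0 diff_zero subcomplexD(1) subgrp_0)

end

section \<open>Mapping cones of chain maps\<close>

locale chain_morphism = C: differential d + C': differential d'
  for d :: "nat \<Rightarrow> 'm::ab_group_add \<Rightarrow> 'm" and d' :: "nat \<Rightarrow> 'k::ab_group_add \<Rightarrow> 'k" +
  fixes f :: "nat \<Rightarrow> 'm \<Rightarrow> 'k"
  assumes f_diff: "f n (x - y) = f n x - f n y"
begin

lemma f_0 [simp]: "f n 0 = 0"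
  using f_diff[of n 0 0] by simp

lemma f_minus: "f n (- x) = - f n x"
  using f_diff[of n 0 x] by simp

lemma f_add: "f n (x + y) = f n x + f n y"
  using f_diff[of n x "- y"] by (simp add: f_minus)

text \<open>The algebraic mapping cone, with the source of \<open>f\<close> shifted up by one
  degree. Only additivity of \<open>f\<close> is assumed globally; commutation with the boundaries
  is a hypothesis of the lemmas because for singular chains it holds on genuine chains.\<close>

fun cone_d :: "nat \<Rightarrow> 'm \<times> 'k \<Rightarrow> 'm \<times> 'k" where
  "cone_d 0 _ = 0"
| "cone_d (Suc n) (a, b) = (- d n a, d' (Suc n) b - f n a)"

definition cone :: "(nat \<Rightarrow> 'm set) \<Rightarrow> (nat \<Rightarrow> 'k set) \<Rightarrow> nat \<Rightarrow> ('m \<times> 'k) set" where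
  "cone A A' n = (case n of 0 \<Rightarrow> {0} | Suc m \<Rightarrow> A m) \<times> A' n"

sublocale cone: differential cone_d
proof
  show "cone_d n (x - y) = cone_d n x - cone_d n y" for n x y
    by (cases n; cases x; cases y) (auto simp: C.d_diff C'.d_diff f_diff)
qed simp

lemma cone_subcomplex:
  assumes A: "C.subcomplex A" and A': "C'.subcomplex A'"
    and fA: "\<And>n x. x \<in> A n \<Longrightarrow> f n x \<in> A' n"
    and fd: "\<And>n x. x \<in> A n \<Longrightarrow> d' n (f n x) = f (n - 1) (d n x)"
  shows "cone.subcomplex (cone A A')"
  unfolding cone.subcomplex_def
proof (intro conjI allI ballI)
  fix n
  show "subgrp (cone A A' n)"
    unfolding cone_def using C.subcomplexD(1)[OF A] C'.subcomplexD(1)[OF A']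
    by (auto split: nat.split simp: subgrp_def zero_prod_def)
  fix u assume u: "u \<in> cone A A' n"
  obtain a b where [simp]: "u = (a, b)" by force
  show "cone_d n u \<in> cone A A' (n - 1)"
  proof (cases n)
    case 0
    then show ?thesis
      using C'.subcomplexD(1)[OF A', of 0] by (simp add: cone_def zero_prod_def subgrp_0)
  next
    case (Suc m)
    then have ab: "a \<in> A m" "b \<in> A' (Suc m)"
      using u by (auto simp: cone_def)
    have "d' (Suc m) b - f m a \<in> A' m"
      using ab fA C'.subcomplexD[OF A'] by (blast intro: subgrp_diff)
    moreover have "- d m a \<in> (case m of 0 \<Rightarrow> {0} | Suc m \<Rightarrow> A m)"
      using C.subcomplexD(2)[OF A, of _ m] C.subcomplexD(1)[OF A] ab
      by (auto split: nat.split simp: C.d_zero intro: subgrp_minus)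
    ultimately show ?thesis
      using Suc by (simp add: cone_def)
  qed
  show "cone_d (n - 1) (cone_d n u) = 0"
  proof (cases n)
    case (Suc m)
    then have ab: "a \<in> A m" "b \<in> A' (Suc m)"
      using u by (auto simp: cone_def)
    show ?thesis
    proof (cases m)
      case (Suc k)
      have "d k (d m a) = 0" "d' (Suc k) (d' (Suc m) b) = 0" "d' (Suc k) (f m a) = f k (d m a)"
        using ab Suc C.subcomplexD[OF A] C'.subcomplexD[OF A'] fd[of a m] by auto
      then show ?thesis
        using \<open>n = Suc m\<close> Suc by (simp add: C.d_minus C'.d_diff f_minus zero_prod_def)
    qed (simp add: Suc)
  qed simp
qed

text \<open>\<open>surj\<close> and \<open>inj\<close> make the map from \<open>A n / B n\<close> to
  \<open>A' n / B' n\<close> bijective. A lift \<open>c\<close> of the second component of a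
  relative cycle yields the chain \<open>(- c, 0)\<close>. Subtracting its boundary moves that
  component into \<open>B'\<close>, and the cycle condition with injectivity then puts the first
  component into \<open>B\<close>.\<close>

lemma acyc_cone_iff_iso:
  assumes A: "C.subcomplex A" and B: "C.subcomplex B"
    and surj: "\<And>n y. y \<in> A' n \<Longrightarrow> \<exists>c\<in>A n. y - f n c \<in> B' n"
    and inj: "\<And>n c. c \<in> A n \<Longrightarrow> f n c \<in> B' n \<Longrightarrow> c \<in> B n"
    and A': "C'.subcomplex A'" and B': "C'.subcomplex B'"
    and fd: "\<And>n x. x \<in> A n \<Longrightarrow> d' n (f n x) = f (n - 1) (d n x)"
  shows "cone.acyc (cone A A') (cone B B') n"
  unfolding cone.acyc_def
proof (intro ballI impI)
  fix u assume u: "u \<in> cone A A' n" "cone_d n u \<in> cone B B' (n - 1)"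
  obtain a y where [simp]: "u = (a, y)" by force
  have y: "y \<in> A' n"
    using u(1) by (auto simp: cone_def)
  obtain c where c: "c \<in> A n" "y - f n c \<in> B' n"
    using surj[OF y] by blast
  have c': "y + f n (- c) \<in> B' n" "- c \<in> A n"
    using c C.subcomplexD(1)[OF A] by (auto simp: f_minus subgrp_minus)
  have "a + d n (- c) \<in> (case n of 0 \<Rightarrow> {0} | Suc m \<Rightarrow> B m)"
  proof (cases n)
    case 0
    then show ?thesis
      using u(1) by (simp add: cone_def C.d_zero)
  next
    case (Suc m)
    then have a: "a \<in> A m" and "d' n y - f m a \<in> B' m"
      using u by (auto simp: cone_def split: nat.splits)
    moreover have "d' n (y + f n (- c)) \<in> B' m"
      using C'.subcomplexD(4)[OF B'] c'(1) Suc by auto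
    moreover have "d' n (y + f n (- c)) = d' n y + f m (d n (- c))"
      using fd[OF c'(2)] Suc by (simp add: C'.d_add)
    ultimately have "(d' n y + f m (d n (- c))) - (d' n y - f m a) \<in> B' m"
      using C'.subcomplexD(1)[OF B'] subgrp_diff by metis
    moreover have "f m (a + d n (- c)) = (d' n y + f m (d n (- c))) - (d' n y - f m a)"
      by (simp add: f_add)
    ultimately have "f m (a + d n (- c)) \<in> B' m"
      by simp
    moreover have "a + d n (- c) \<in> A m"
      using a c' C.subcomplexD[OF A] Suc by (auto intro: subgrp_add)
    ultimately show ?thesis
      using inj Suc by simp
  qed
  then have "u - cone_d (Suc n) (- c, 0) \<in> cone B B' n"
    using c' by (simp add: cone_def)
  moreover have "(- c, 0) \<in> cone A A' (Suc n)"
    using c' C'.subcomplexD(1)[OF A'] by (simp add: cone_def subgrp_0)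
  ultimately show "\<exists>v\<in>cone A A' (Suc n). u - cone_d (Suc n) v \<in> cone B B' n"
    by blast
qed

text \<open>The quotient of the two cones is \<open>A / B\<close>, shifted by one degree.\<close>

lemma acyc_cone_left:
  assumes A: "C.subcomplex A" and B: "C.subcomplex B"  and A': "C'.subcomplex A'"
    and AB: "\<And>n. C.acyc A B n" and sub: "\<And>n. B n \<subseteq> A n"
    and fA: "\<And>n x. x \<in> A n \<Longrightarrow> f n x \<in> A' n"
  shows "cone.acyc (cone A A') (cone B A') n"
  unfolding cone.acyc_def
proof (intro ballI impI)
  fix u assume u: "u \<in> cone A A' n" "cone_d n u \<in> cone B A' (n - 1)"
  obtain a y where [simp]: "u = (a, y)" by force
  show "\<exists>v\<in>cone A A' (Suc n). u - cone_d (Suc n) v \<in> cone B A' n"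
  proof (cases n)
    case 0
    have "(0, 0) \<in> cone A A' (Suc n)"
      using C.subcomplexD(1)[OF A] C'.subcomplexD(1)[OF A'] by (simp add: cone_def subgrp_0)
    then show ?thesis
      using u 0 by (force simp: cone_def C.d_zero zero_prod_def)
  next
    case (Suc m)
    then have a: "a \<in> A m" "y \<in> A' n"
      using u by (auto simp: cone_def)
    have "d m a \<in> B (m - 1)"
    proof (cases m)
      case 0
      then show ?thesis
        using C.subcomplexD(1)[OF B] by (simp add: C.d_zero subgrp_0)
    next
      case (Suc k)
      then have "- d m a \<in> B k"
        using u \<open>n = Suc m\<close> by (simp add: cone_def)
      then have "d m a \<in> B k"
        using C.subcomplexD(1)[OF B] by (metis minus_minus subgrp_minus)
      then show ?thesis
        using Suc by simp
    qed
    then obtain c where c: "c \<in> A n" "a - d n c \<in> B m"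
      using C.acycD[OF AB a(1)] Suc by blast
    have c': "- c \<in> A n"
      using c C.subcomplexD(1)[OF A] subgrp_minus by blast
    have *: "y + f n (- c) \<in> A' n"
      using a fA[OF c'] C'.subcomplexD(1)[OF A'] subgrp_add by blast
    have "u - cone_d (Suc n) (- c, 0) \<in> cone B A' n"
      using c(2) * Suc by (simp add: cone_def C.d_minus)
    moreover have "(- c, 0) \<in> cone A A' (Suc n)"
      using c' C'.subcomplexD(1)[OF A'] by (simp add: cone_def subgrp_0)
    ultimately show ?thesis
      by blast
  qed
qed

text \<open>Here the quotient of the two cones is \<open>A' / B'\<close>.\<close>

lemma acyc_cone_right:
  assumes A': "C'.subcomplex A'" and B': "C'.subcomplex B'" and B: "C.subcomplex B"
    and AB: "\<And>n. C'.acyc A' B' n"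
    and fB: "\<And>n x. x \<in> B n \<Longrightarrow> f n x \<in> B' n"
  shows "cone.acyc (cone B A') (cone B B') n"
  unfolding cone.acyc_def
proof (intro ballI impI)
  fix u assume u: "u \<in> cone B A' n" "cone_d n u \<in> cone B B' (n - 1)"
  obtain a y where [simp]: "u = (a, y)" by force
  have y: "y \<in> A' n" and a: "a \<in> (case n of 0 \<Rightarrow> {0} | Suc m \<Rightarrow> B m)"
    using u by (auto simp: cone_def)
  have "d' n y \<in> B' (n - 1)"
  proof (cases n)
    case 0
    then show ?thesis
      using C'.subcomplexD(1)[OF B'] by (simp add: C'.d_zero subgrp_0)
  next
    case (Suc m)
    then have "a \<in> B m" "d' n y - f m a \<in> B' m"
      using u by (auto simp: cone_def split: nat.splits)
    then have "d' n y \<in> B' m"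
      using fB C'.subcomplexD(1)[OF B'] subgrp_cancel_right by blast
    then show ?thesis
      using Suc by simp
  qed
  then obtain z where z: "z \<in> A' (Suc n)" "y - d' (Suc n) z \<in> B' n"
    using C'.acycD[OF AB y] by blast
  have "u - cone_d (Suc n) (0, z) \<in> cone B B' n"
    using z a by (simp add: cone_def)
  moreover have "(0, z) \<in> cone B A' (Suc n)"
    using z C.subcomplexD(1)[OF B] by (simp add: cone_def subgrp_0)
  ultimately show "\<exists>v\<in>cone B A' (Suc n). u - cone_d (Suc n) v \<in> cone B B' n"
    by blast
qed

text \<open>\<open>cone\<close> expresses that \<open>f\<close> induces a quasi-isomorphism from
  \<open>S / K\<close> to \<open>S'\<close>. A cycle of \<open>S'\<close> is therefore a boundary
  plus the image of a cycle of \<open>S / K\<close>, and by \<open>SK\<close> the latter is a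
  boundary too.\<close>

lemma acyc_from_cone:
  assumes S: "C.subcomplex S" and S': "C'.subcomplex S'" and K: "C.subcomplex K"
    and cone: "\<And>n. cone.acyc (cone S S') (cone K (\<lambda>_. {0})) n"
    and SK: "\<And>n. C.acyc S K n" and fK: "\<And>n x. x \<in> K n \<Longrightarrow> f n x = 0"
    and fS: "\<And>n x. x \<in> S n \<Longrightarrow> f n x \<in> S' n"
    and fd: "\<And>n x. x \<in> S n \<Longrightarrow> d' n (f n x) = f (n - 1) (d n x)"
  shows "C'.acyc S' (\<lambda>_. {0}) n"
  unfolding C'.acyc_def
proof (intro ballI impI)
  fix y assume y: "y \<in> S' n" "d' n y \<in> {0}"
  have "(0, y) \<in> cone S S' n"
    using y C.subcomplexD(1)[OF S] by (auto simp: cone_def subgrp_0 split: nat.split)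
  moreover have "cone_d n (0, y) \<in> cone K (\<lambda>_. {0}) (n - 1)"
    using y C.subcomplexD(1)[OF K] by (cases n) (auto simp: cone_def subgrp_0 zero_prod_def split: nat.split)
  ultimately obtain v where v: "v \<in> cone S S' (Suc n)" "(0, y) - cone_d (Suc n) v \<in> cone K (\<lambda>_. {0}) n"
    using cone.acycD[OF cone] by blast
  obtain c b where [simp]: "v = (c, b)" by force
  have cb: "c \<in> S n" "b \<in> S' (Suc n)" and yb: "y = d' (Suc n) b - f n c"
    and *: "d n c \<in> (case n of 0 \<Rightarrow> {0} | Suc m \<Rightarrow> K m)"
    using v by (auto simp: cone_def)
  have "d n c \<in> K (n - 1)"
    using * C.subcomplexD(1)[OF K] by (auto simp: subgrp_0 split: nat.splits)
  then obtain z where z: "z \<in> S (Suc n)" "c - d (Suc n) z \<in> K n"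
    using C.acycD[OF SK cb(1)] by blast
  have "f n c = d' (Suc n) (f (Suc n) z)"
    using fK[OF z(2)] fd[OF z(1)] by (simp add: f_diff)
  then have "y - d' (Suc n) (b - f (Suc n) z) = 0"
    using yb by (simp add: C'.d_diff)
  moreover have "b - f (Suc n) z \<in> S' (Suc n)"
    using cb fS[OF z(1)] C'.subcomplexD(1)[OF S'] subgrp_diff by blast
  ultimately show "\<exists>z\<in>S' (Suc n). y - d' (Suc n) z \<in> {0}"
    by blast
qed

end

section \<open>Smith theory\<close>

locale smith_complex = differential d for d :: "nat \<Rightarrow> 'm::ab_group_add \<Rightarrow> 'm" +
  fixes \<sigma> \<tau> :: "nat \<Rightarrow> 'm \<Rightarrow> 'm" and S :: "nat \<Rightarrow> 'm set"
  assumes S: "subcomplex S"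
    and \<sigma>_diff: "\<sigma> n (x - y) = \<sigma> n x - \<sigma> n y"
    and \<tau>_diff: "\<tau> n (x - y) = \<tau> n x - \<tau> n y"
    and \<sigma>_d: "x \<in> S n \<Longrightarrow> d n (\<sigma> n x) = \<sigma> (n - 1) (d n x)"
    and \<tau>_d: "x \<in> S n \<Longrightarrow> d n (\<tau> n x) = \<tau> (n - 1) (d n x)"
    and \<sigma>_S: "x \<in> S n \<Longrightarrow> \<sigma> n x \<in> S n"
    and \<tau>_S: "x \<in> S n \<Longrightarrow> \<tau> n x \<in> S n"
    and \<sigma>_\<tau>: "x \<in> S n \<Longrightarrow> \<sigma> n (\<tau> n x) = 0"
    and \<tau>_\<sigma>: "x \<in> S n \<Longrightarrow> \<tau> n (\<sigma> n x) = 0"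
begin

lemma \<sigma>_0 [simp]: "\<sigma> n 0 = 0" and \<tau>_0 [simp]: "\<tau> n 0 = 0"
  using \<sigma>_diff[of n 0 0] \<tau>_diff[of n 0 0] by simp_all

lemma \<sigma>_minus: "\<sigma> n (- x) = - \<sigma> n x" and \<tau>_minus: "\<tau> n (- x) = - \<tau> n x"
  using \<sigma>_diff[of n 0 x] \<tau>_diff[of n 0 x] by simp_all

lemma \<sigma>_add: "\<sigma> n (x + y) = \<sigma> n x + \<sigma> n y" and \<tau>_add: "\<tau> n (x + y) = \<tau> n x + \<tau> n y"
  using \<sigma>_diff[of n x "- y"] \<tau>_diff[of n x "- y"] by (simp_all add: \<sigma>_minus \<tau>_minus)

lemmas S_subgrp = subcomplexD(1)[OF S]

definition stable :: "(nat \<Rightarrow> 'm set) \<Rightarrow> bool" where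
  "stable R \<longleftrightarrow> subcomplex R \<and> (\<forall>n. R n \<subseteq> S n) \<and> (\<forall>n. \<sigma> n ` R n \<subseteq> R n) \<and> (\<forall>n. \<tau> n ` R n \<subseteq> R n)"

lemma stableD:
  assumes "stable R"
  shows "subcomplex R" "x \<in> R n \<Longrightarrow> x \<in> S n" "x \<in> R n \<Longrightarrow> \<sigma> n x \<in> R n" "x \<in> R n \<Longrightarrow> \<tau> n x \<in> R n"
    "subgrp (R n)"
  using assms subcomplexD(1) by (auto simp: stable_def image_subset_iff)

lemma stable_S: "stable S"
  using S \<sigma>_S \<tau>_S by (auto simp: stable_def)

text \<open>
  The two conditions below hold when the quotient \<open>R / Q\<close> is induced, i.e. is a direct sum of
  copies of the group ring of a cyclic group, \<open>\<sigma>\<close> being the norm element and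
  \<open>\<tau>\<close> being \<open>1 - g\<close> for a generator \<open>g\<close>.
\<close>

definition induced_quotient :: "(nat \<Rightarrow> 'm set) \<Rightarrow> (nat \<Rightarrow> 'm set) \<Rightarrow> bool" where
  "induced_quotient R Q \<longleftrightarrow>
     stable R \<and> stable Q \<and> (\<forall>n. Q n \<subseteq> R n) \<and>
     (\<forall>n. \<forall>x\<in>R n. \<sigma> n x \<in> Q n \<longrightarrow> (\<exists>y\<in>R n. x - \<tau> n y \<in> Q n)) \<and>
     (\<forall>n. \<forall>x\<in>R n. \<tau> n x \<in> Q n \<longrightarrow> (\<exists>y\<in>R n. x - \<sigma> n y \<in> Q n))"

lemma induced_quotientD:
  assumes "induced_quotient R Q"
  shows "stable R" "stable Q" "x \<in> Q n \<Longrightarrow> x \<in> R n"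
    "x \<in> R n \<Longrightarrow> \<sigma> n x \<in> Q n \<Longrightarrow> \<exists>y\<in>R n. x - \<tau> n y \<in> Q n"
    "x \<in> R n \<Longrightarrow> \<tau> n x \<in> Q n \<Longrightarrow> \<exists>y\<in>R n. x - \<sigma> n y \<in> Q n"
  using assms by (auto simp: induced_quotient_def)

text \<open>
  \<open>S / coinv R\<close> is the complex of coinvariants of \<open>S / R\<close>, because the kernel of the norm
  on an induced module is the image of \<open>\<tau>\<close>.
\<close>

definition coinv :: "(nat \<Rightarrow> 'm set) \<Rightarrow> nat \<Rightarrow> 'm set" where
  "coinv R n = {x \<in> S n. \<sigma> n x \<in> R n}"

lemma coinv_subcomplex:
  assumes "subcomplex R"
  shows "subcomplex (coinv R)"
  unfolding subcomplex_def
proof (intro conjI allI ballI)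
  show "subgrp (coinv R n)" for n
    using subcomplexD(1)[OF assms] S_subgrp by (auto simp: coinv_def subgrp_def \<sigma>_diff)
  fix n x assume "x \<in> coinv R n"
  then have x: "x \<in> S n" "\<sigma> n x \<in> R n"
    by (auto simp: coinv_def)
  then show "d n x \<in> coinv R (n - 1)"
    using subcomplexD(2)[OF assms x(2)] subcomplexD(2)[OF S] by (simp add: coinv_def \<sigma>_d)
  show "d (n - 1) (d n x) = 0"
    using x subcomplexD[OF S] by auto
qed

lemma coinv_mono: "(\<And>n. Q n \<subseteq> R n) \<Longrightarrow> coinv Q n \<subseteq> coinv R n"
  by (auto simp: coinv_def)

lemma coinv_subset: "coinv R n \<subseteq> S n"
  by (auto simp: coinv_def)

lemma stable_subset_coinv: "stable R \<Longrightarrow> R n \<subseteq> coinv R n"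
  using stableD by (auto simp: coinv_def)

text \<open>
  Since \<open>\<sigma>\<close> embeds the coinvariants \<open>C\<close> of \<open>F = R / Q\<close> into \<open>F\<close>, there are exact sequences
  \<open>0 \<rightarrow> \<tau>F \<rightarrow> F \<rightarrow> C \<rightarrow> 0\<close> and \<open>0 \<rightarrow> C \<rightarrow> F \<rightarrow> \<tau>F \<rightarrow> 0\<close>, which shift the degree by two.
\<close>

lemma acyc_coinv_aux:
  assumes RQ: "induced_quotient R Q" and ac: "\<And>n. acyc R Q n"
    and "x \<in> R n" "\<sigma> (n - 1) (d n x) \<in> Q (n - 1)"
  shows "\<exists>z\<in>R (Suc n). \<sigma> n (x - d (Suc n) z) \<in> Q n"
  using assms(3-4)
proof (induction n arbitrary: x rule: less_induct)
  case (less n)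
  note R = stableD[OF induced_quotientD(1)[OF RQ]] and Q = stableD[OF induced_quotientD(2)[OF RQ]]
  note Rc = subcomplexD[OF R(1)] and Qc = subcomplexD[OF Q(1)]
  \<comment> \<open>\<open>\<sigma>\<close> kills \<open>\<tau> n v\<close>, so this replaces
    \<open>x\<close> by a chain of the same class in the coinvariants that is a cycle of
    \<open>R / Q\<close> itself.\<close>
  have "\<exists>v\<in>R n. d n (x - \<tau> n v) \<in> Q (n - 1)"
  proof (cases n)
    case 0
    then show ?thesis
      using less.prems(1) by (auto simp: d_zero Q(5) subgrp_0)
  next
    case (Suc m)
    have dx: "d n x \<in> R m"
      using less.prems(1) Rc(4) Suc by blast
    then obtain y where y: "y \<in> R m" "d n x - \<tau> m y \<in> Q m"
      using induced_quotientD(4)[OF RQ, of "d n x" m] less.prems Suc by auto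
    have "d m (d n x - \<tau> m y) \<in> Q (m - 1)"
      using Qc(2)[OF y(2)] .
    moreover have "d m (d n x) = 0"
      using Rc(5) less.prems(1) Suc by blast
    ultimately have \<tau>dy: "\<tau> (m - 1) (d m y) \<in> Q (m - 1)"
      using \<tau>_d[OF R(2)[OF y(1)]] Q(5) by (metis d_diff diff_0 minus_minus subgrp_minus)
    \<comment> \<open>\<open>y\<close> matters only up to norms, since \<open>\<tau>\<close> kills
      them. Turning it into a cycle modulo \<open>Q\<close> leads to the coinvariants two degrees
      below \<open>n\<close>, where the induction hypothesis applies.\<close>
    have "\<exists>w\<in>R m. d m (y - \<sigma> m w) \<in> Q (m - 1)"
    proof (cases m)
      case 0
      then show ?thesis
        using y(1) by (auto simp: d_zero Q(5) subgrp_0)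
    next
      case (Suc k)
      have dy: "d m y \<in> R k"
        using y(1) Rc(4) Suc by blast
      then obtain z where z: "z \<in> R k" "d m y - \<sigma> k z \<in> Q k"
        using induced_quotientD(5)[OF RQ, of "d m y" k] \<tau>dy Suc by auto
      have "d k (d m y - \<sigma> k z) \<in> Q (k - 1)"
        using Qc(2)[OF z(2)] .
      moreover have "d k (d m y) = 0"
        using Rc(5) y(1) Suc by blast
      ultimately have "\<sigma> (k - 1) (d k z) \<in> Q (k - 1)"
        using \<sigma>_d[OF R(2)[OF z(1)]] Q(5) by (metis d_diff diff_0 minus_minus subgrp_minus)
      then obtain w where w: "w \<in> R m" "\<sigma> k (z - d m w) \<in> Q k"
        using less.IH[of k z] z(1) Suc \<open>n = Suc m\<close> by auto
      have "d m (\<sigma> m w) = \<sigma> k (d m w)"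
        using \<sigma>_d[OF R(2)[OF w(1)]] Suc by simp
      then have "d m (y - \<sigma> m w) = (d m y - \<sigma> k z) + \<sigma> k (z - d m w)"
        by (simp add: d_diff \<sigma>_diff)
      then show ?thesis
        using w z(2) Q(5) subgrp_add Suc by (metis diff_Suc_1)
    qed
    then obtain w where w: "w \<in> R m" "d m (y - \<sigma> m w) \<in> Q (m - 1)"
      by blast
    then have "y - \<sigma> m w \<in> R m"
      using R y(1) subgrp_diff by metis
    then obtain v where v: "v \<in> R n" "y - \<sigma> m w - d n v \<in> Q m"
      using acycD[OF ac _ w(2)] Suc by blast
    have "\<tau> m (y - \<sigma> m w - d n v) = \<tau> m (y - d n v)"
      using \<tau>_\<sigma>[OF R(2)[OF w(1)]] by (simp add: \<tau>_diff)
    then have "\<tau> m (y - d n v) \<in> Q m"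
      using Q(4)[OF v(2)] by simp
    moreover have "d n (\<tau> n v) = \<tau> m (d n v)"
      using \<tau>_d[OF R(2)[OF v(1)]] Suc by simp
    then have "d n (x - \<tau> n v) = (d n x - \<tau> m y) + \<tau> m (y - d n v)"
      by (simp add: d_diff \<tau>_diff)
    ultimately show ?thesis
      using y(2) v(1) Q(5) subgrp_add Suc by (metis diff_Suc_1)
  qed
  then obtain v where v: "v \<in> R n" "d n (x - \<tau> n v) \<in> Q (n - 1)"
    by blast
  then have "x - \<tau> n v \<in> R n"
    using R less.prems(1) subgrp_diff by metis
  then obtain u where u: "u \<in> R (Suc n)" "x - \<tau> n v - d (Suc n) u \<in> Q n"
    using acycD[OF ac _ v(2)] by blast
  have "\<sigma> n (x - \<tau> n v - d (Suc n) u) = \<sigma> n (x - d (Suc n) u)"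
    using \<sigma>_\<tau>[OF R(2)[OF v(1)]] by (simp add: \<sigma>_diff)
  then show ?case
    using Q(3)[OF u(2)] u(1) by auto
qed

text \<open>As \<open>S / R\<close> is induced, an element of \<open>coinv R\<close> is an element
  of \<open>R\<close> plus some \<open>\<tau> n y\<close>. The norm kills the second term, so the
  boundary problem has to be solved for elements of \<open>R\<close>, which is the hypothesis
  \<open>ex\<close>.\<close>

lemma acyc_coinv_gen:
  assumes SR: "induced_quotient S R" and Q: "stable Q" "\<And>n. Q n \<subseteq> R n"
    and ex: "\<And>x. x \<in> R n \<Longrightarrow> \<sigma> (n - 1) (d n x) \<in> Q (n - 1) \<Longrightarrow>
        \<exists>z\<in>R (Suc n). \<sigma> n (x - d (Suc n) z) \<in> Q n"
  shows "acyc (coinv R) (coinv Q) n"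
  unfolding acyc_def
proof (intro ballI impI)
  fix x assume x: "x \<in> coinv R n" "d n x \<in> coinv Q (n - 1)"
  note R = stableD[OF induced_quotientD(2)[OF SR]]
  have xS: "x \<in> S n" and "\<sigma> n x \<in> R n" and \<sigma>dx: "\<sigma> (n - 1) (d n x) \<in> Q (n - 1)"
    using x by (auto simp: coinv_def)
  then obtain y where y: "y \<in> S n" "x - \<tau> n y \<in> R n"
    using induced_quotientD(4)[OF SR] by blast
  have "\<sigma> (n - 1) (d n (x - \<tau> n y)) = \<sigma> (n - 1) (d n x)"
    using \<tau>_d[OF y(1)] \<sigma>_\<tau>[OF subcomplexD(2)[OF S y(1)]] by (simp add: d_diff \<sigma>_diff)
  then obtain z where z: "z \<in> R (Suc n)" "\<sigma> n (x - \<tau> n y - d (Suc n) z) \<in> Q n"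
    using ex[OF y(2)] \<sigma>dx by auto
  have "\<sigma> n (x - \<tau> n y - d (Suc n) z) = \<sigma> n (x - d (Suc n) z)"
    using \<sigma>_\<tau>[OF y(1)] by (simp add: \<sigma>_diff)
  moreover have "x - d (Suc n) z \<in> S n"
    using xS R(2)[OF z(1)] subcomplexD(4)[OF S] S_subgrp subgrp_diff by blast
  ultimately show "\<exists>z\<in>coinv R (Suc n). x - d (Suc n) z \<in> coinv Q n"
    using z stable_subset_coinv[OF induced_quotientD(2)[OF SR]] by (auto simp: coinv_def)
qed

lemma acyc_coinv:
  assumes "induced_quotient S R" "induced_quotient R Q" "\<And>n. acyc R Q n"
  shows "acyc (coinv R) (coinv Q) n"
  using assms by (intro acyc_coinv_gen acyc_coinv_aux induced_quotientD(2)) (auto dest: induced_quotientD(3))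

text \<open>
  Downward induction on the degree. Write \<open>F = S / R\<close> and \<open>C\<close> for its coinvariants. The norm
  induces \<open>C \<rightarrow> F\<close>, which factors through the acyclic complex \<open>S / P\<close>; vanishing in degrees
  above \<open>n\<close> makes it injective on homology in degree \<open>n\<close>.
\<close>

lemma smith_acyc:
  assumes SR: "induced_quotient S R" and P: "stable P" "\<And>n. P n \<subseteq> R n"
    and \<sigma>R: "\<And>n x. x \<in> R n \<Longrightarrow> \<sigma> n x \<in> P n" and \<tau>R: "\<And>n x. x \<in> R n \<Longrightarrow> \<tau> n x \<in> P n"
    and SP: "\<And>n. acyc S P n"
    and N: "\<And>n. n \<ge> N \<Longrightarrow> acyc S R n" "\<And>n. n \<ge> N \<Longrightarrow> acyc S (coinv R) n"
  shows "acyc S R n \<and> acyc S (coinv R) n"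
proof -
  note R = stableD[OF induced_quotientD(2)[OF SR]] and P' = stableD[OF P(1)]
  note Rc = subcomplexD[OF R(1)] and Sc = subcomplexD[OF S]
  have ind: "acyc S R n \<and> acyc S (coinv R) n"
    if 1: "acyc S R (Suc n)" "acyc S (coinv R) (Suc n)" "acyc S (coinv R) (Suc (Suc n))" for n
  proof
    \<comment> \<open>Acyclic coinvariants in usable form: a chain whose boundary has norm in
      \<open>R\<close> is, modulo \<open>R\<close>, a boundary plus a value of
      \<open>\<tau>\<close>.\<close>
    have split: "\<exists>v\<in>S (Suc n). \<exists>u\<in>S n. y - d (Suc n) v - \<tau> n u \<in> R n"
      if y: "acyc S (coinv R) n" "y \<in> S n" "\<sigma> (n - 1) (d n y) \<in> R (n - 1)" for y n
    proof -
      have "d n y \<in> coinv R (n - 1)"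
        using y Sc by (auto simp: coinv_def)
      then obtain v where v: "v \<in> S (Suc n)" "y - d (Suc n) v \<in> coinv R n"
        using acycD[OF y(1,2)] by blast
      then have "y - d (Suc n) v \<in> S n" "\<sigma> n (y - d (Suc n) v) \<in> R n"
        by (simp_all add: coinv_def)
      from induced_quotientD(4)[OF SR this] v(1) show ?thesis
        by blast
    qed
    show C: "acyc S (coinv R) n"
      unfolding acyc_def
    proof (intro ballI impI)
      fix x assume x: "x \<in> S n" "d n x \<in> coinv R (n - 1)"
      then have "d n x \<in> S (n - 1)" "\<sigma> (n - 1) (d n x) \<in> R (n - 1)"
        by (auto simp: coinv_def)
      then obtain r where r: "r \<in> S (n - 1)" "d n x - \<tau> (n - 1) r \<in> R (n - 1)"
        using induced_quotientD(4)[OF SR] by blast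
      have "\<sigma> (n - 1) (d n x - \<tau> (n - 1) r) \<in> P (n - 1)"
        using \<sigma>R r(2) by blast
      then have "d n (\<sigma> n x) \<in> P (n - 1)"
        using \<sigma>_\<tau>[OF r(1)] \<sigma>_d[OF x(1)] by (simp add: \<sigma>_diff)
      \<comment> \<open>The norm of \<open>x\<close> is the boundary of some \<open>y\<close>, as
        \<open>S / P\<close> is acyclic. The rest adjusts \<open>y\<close> by a boundary until it is
        invariant modulo \<open>R\<close>, hence a norm of some \<open>u\<close>; then
        \<open>x - d (Suc n) u\<close> has norm in \<open>R\<close>. The adjustment uses the
        vanishing in degrees \<open>n + 1\<close> and \<open>n + 2\<close>.\<close>
      then obtain y where y: "y \<in> S (Suc n)" "\<sigma> n x - d (Suc n) y \<in> P n"
        using acycD[OF SP \<sigma>_S[OF x(1)]] by blast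
      have "\<tau> n (\<sigma> n x - d (Suc n) y) \<in> R n"
        using y(2) P'(4) P(2) by blast
      then have "d (Suc n) (\<tau> (Suc n) y) \<in> R n"
        using \<tau>_\<sigma>[OF x(1)] \<tau>_d[OF y(1)] subgrp_minus[OF R(5)] by (fastforce simp: \<tau>_diff)
      then obtain z where z: "z \<in> S (Suc (Suc n))" "\<tau> (Suc n) y - d (Suc (Suc n)) z \<in> R (Suc n)"
        using acycD[OF 1(1) \<tau>_S[OF y(1)]] by auto
      have "\<sigma> (Suc n) (\<tau> (Suc n) y - d (Suc (Suc n)) z) \<in> R (Suc n)"
        using z(2) R(3) by blast
      then have "\<sigma> (Suc n) (d (Suc (Suc n)) z) \<in> R (Suc n)"
        using \<sigma>_\<tau>[OF y(1)] subgrp_minus[OF R(5)] by (fastforce simp: \<sigma>_diff)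
      then obtain w v where wv: "w \<in> S (Suc (Suc (Suc n)))" "v \<in> S (Suc (Suc n))"
        "z - d (Suc (Suc (Suc n))) w - \<tau> (Suc (Suc n)) v \<in> R (Suc (Suc n))"
        using split[OF 1(3) z(1)] by auto
      have "d (Suc (Suc n)) (z - d (Suc (Suc (Suc n))) w - \<tau> (Suc (Suc n)) v) \<in> R (Suc n)"
        using Rc(4)[OF wv(3)] .
      then have "d (Suc (Suc n)) z - \<tau> (Suc n) (d (Suc (Suc n)) v) \<in> R (Suc n)"
        using Sc(5)[OF wv(1)] \<tau>_d[OF wv(2)] by (simp add: d_diff)
      with z(2) have "(\<tau> (Suc n) y - d (Suc (Suc n)) z) + (d (Suc (Suc n)) z - \<tau> (Suc n) (d (Suc (Suc n)) v)) \<in> R (Suc n)"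
        using R(5) subgrp_add by blast
      then have "\<tau> (Suc n) (y - d (Suc (Suc n)) v) \<in> R (Suc n)"
        by (simp add: \<tau>_diff)
      moreover have "y - d (Suc (Suc n)) v \<in> S (Suc n)"
        using y(1) wv(2) Sc(4) S_subgrp subgrp_diff by blast
      ultimately obtain u where u: "u \<in> S (Suc n)" "y - d (Suc (Suc n)) v - \<sigma> (Suc n) u \<in> R (Suc n)"
        using induced_quotientD(5)[OF SR] by blast
      have "d (Suc n) (y - d (Suc (Suc n)) v - \<sigma> (Suc n) u) \<in> R n"
        using Rc(4)[OF u(2)] .
      then have "d (Suc n) y - \<sigma> n (d (Suc n) u) \<in> R n"
        using Sc(5)[OF wv(2)] \<sigma>_d[OF u(1)] by (simp add: d_diff)
      with y(2) have "(\<sigma> n x - d (Suc n) y) + (d (Suc n) y - \<sigma> n (d (Suc n) u)) \<in> R n"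
        using R(5) subgrp_add P(2) by blast
      then have "\<sigma> n (x - d (Suc n) u) \<in> R n"
        by (simp add: \<sigma>_diff)
      moreover have "x - d (Suc n) u \<in> S n"
        using x(1) u(1) Sc(4) S_subgrp subgrp_diff by blast
      ultimately show "\<exists>y\<in>S (Suc n). x - d (Suc n) y \<in> coinv R n"
        using u(1) by (auto simp: coinv_def)
    qed
    show "acyc S R n"
      unfolding acyc_def
    proof (intro ballI impI)
      fix x assume x: "x \<in> S n" "d n x \<in> R (n - 1)"
      \<comment> \<open>The same argument with \<open>\<tau>\<close> in place of the norm: up to a
        boundary, \<open>x\<close> becomes the norm of some \<open>u\<close>, and the class of
        \<open>u\<close> dies in the coinvariants of degree \<open>n\<close>, which have just been
        shown to be acyclic.\<close>
      have "d n (\<tau> n x) \<in> P (n - 1)"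
        using \<tau>_d[OF x(1)] \<tau>R[OF x(2)] by simp
      then obtain y where y: "y \<in> S (Suc n)" "\<tau> n x - d (Suc n) y \<in> P n"
        using acycD[OF SP \<tau>_S[OF x(1)]] by blast
      have "\<sigma> n (\<tau> n x - d (Suc n) y) \<in> R n"
        using y(2) P(2) R(3) by blast
      then have "\<sigma> n (d (Suc n) y) \<in> R n"
        using \<sigma>_\<tau>[OF x(1)] subgrp_minus[OF R(5)] by (fastforce simp: \<sigma>_diff)
      then obtain w v where wv: "w \<in> S (Suc (Suc n))" "v \<in> S (Suc n)"
        "y - d (Suc (Suc n)) w - \<tau> (Suc n) v \<in> R (Suc n)"
        using split[OF 1(2) y(1)] by auto
      have "d (Suc n) (y - d (Suc (Suc n)) w - \<tau> (Suc n) v) \<in> R n"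
        using Rc(4)[OF wv(3)] .
      then have "d (Suc n) y - \<tau> n (d (Suc n) v) \<in> R n"
        using Sc(5)[OF wv(1)] \<tau>_d[OF wv(2)] by (simp add: d_diff)
      with y(2) have "(\<tau> n x - d (Suc n) y) + (d (Suc n) y - \<tau> n (d (Suc n) v)) \<in> R n"
        using R(5) subgrp_add P(2) by blast
      then have "\<tau> n (x - d (Suc n) v) \<in> R n"
        by (simp add: \<tau>_diff)
      moreover have "x - d (Suc n) v \<in> S n"
        using x(1) wv(2) Sc(4) S_subgrp subgrp_diff by blast
      ultimately obtain u where u: "u \<in> S n" "x - d (Suc n) v - \<sigma> n u \<in> R n"
        using induced_quotientD(5)[OF SR] by blast
      have "d n (x - d (Suc n) v - \<sigma> n u) \<in> R (n - 1)"
        using Rc(2)[OF u(2)] .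
      then have "d n x - \<sigma> (n - 1) (d n u) \<in> R (n - 1)"
        using Sc(5)[OF wv(2)] \<sigma>_d[OF u(1)] by (simp add: d_diff)
      then have "d n x - (d n x - \<sigma> (n - 1) (d n u)) \<in> R (n - 1)"
        using x(2) R(5) subgrp_diff by blast
      then have "\<sigma> (n - 1) (d n u) \<in> R (n - 1)"
        by simp
      then obtain w' v' where wv': "w' \<in> S (Suc n)" "v' \<in> S n" "u - d (Suc n) w' - \<tau> n v' \<in> R n"
        using split[OF C u(1)] by blast
      have "\<sigma> n (u - d (Suc n) w' - \<tau> n v') \<in> R n"
        using wv'(3) R(3) by blast
      then have "\<sigma> n u - d (Suc n) (\<sigma> (Suc n) w') \<in> R n"
        using \<sigma>_\<tau>[OF wv'(2)] \<sigma>_d[OF wv'(1)] by (simp add: \<sigma>_diff)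
      with u(2) have "(x - d (Suc n) v - \<sigma> n u) + (\<sigma> n u - d (Suc n) (\<sigma> (Suc n) w')) \<in> R n"
        using R(5) subgrp_add by blast
      then have "x - d (Suc n) (v + \<sigma> (Suc n) w') \<in> R n"
        by (simp add: d_add algebra_simps)
      then show "\<exists>y\<in>S (Suc n). x - d (Suc n) y \<in> R n"
        using wv(2) \<sigma>_S[OF wv'(1)] S_subgrp subgrp_add by blast
    qed
  qed
  have "\<forall>k\<ge>N - i. acyc S R k \<and> acyc S (coinv R) k" for i
  proof (induction i)
    case 0
    then show ?case
      using N by simp
  next
    case (Suc i)
    show ?case
    proof (intro allI impI)
      fix k assume k: "k \<ge> N - Suc i"
      show "acyc S R k \<and> acyc S (coinv R) k"
      proof (cases "k \<ge> N - i")
        case False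
        then have "Suc k \<ge> N - i" "Suc (Suc k) \<ge> N - i"
          using k by auto
        then show ?thesis
          using Suc ind by blast
      qed (use Suc in blast)
    qed
  qed
  from this[of N] show ?thesis
    by simp
qed

end

text \<open>\<open>\<mu>\<close> stands for multiplication by \<open>p\<close> and \<open>M\<close>
  for the chains of the fixed point set, on which the norm is multiplication by \<open>p\<close>.
  \<open>M_sat\<close> expresses that \<open>S / M\<close> has no \<open>p\<close>-torsion.\<close>

locale smith_complex_mult = smith_complex +
  fixes \<mu> :: "'a \<Rightarrow> 'a" and M :: "nat \<Rightarrow> 'a set"
  assumes \<mu>_diff: "\<mu> (x - y) = \<mu> x - \<mu> y"
    and d_\<mu>: "d n (\<mu> x) = \<mu> (d n x)"
    and \<sigma>_\<mu>: "\<sigma> n (\<mu> x) = \<mu> (\<sigma> n x)"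
    and \<tau>_\<mu>: "\<tau> n (\<mu> x) = \<mu> (\<tau> n x)"
    and \<mu>_closed: "subgrp A \<Longrightarrow> x \<in> A \<Longrightarrow> \<mu> x \<in> A"
    and \<mu>_inj: "\<mu> x = 0 \<Longrightarrow> x = 0"
    and \<sigma>_\<sigma>: "x \<in> S n \<Longrightarrow> \<sigma> n (\<sigma> n x) = \<mu> (\<sigma> n x)"
    and M: "stable M"
    and \<sigma>_M: "x \<in> M n \<Longrightarrow> \<sigma> n x = \<mu> x"
    and \<tau>_M: "x \<in> M n \<Longrightarrow> \<tau> n x = 0"
    and M_sat: "x \<in> S n \<Longrightarrow> \<mu> x \<in> M n \<Longrightarrow> x \<in> M n"
begin

lemma \<mu>_0 [simp]: "\<mu> 0 = 0"
  using \<mu>_diff[of 0 0] by simp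

lemma \<mu>_minus: "\<mu> (- x) = - \<mu> x"
  using \<mu>_diff[of 0 x] by simp

lemma \<mu>_add: "\<mu> (x + y) = \<mu> x + \<mu> y"
  using \<mu>_diff[of x "- y"] by (simp add: \<mu>_minus)

text \<open>For \<open>B\<close> inside \<open>S\<close> this is \<open>B + pS\<close>, so
  \<open>S / pext B\<close> is the reduction of \<open>S / B\<close> modulo
  \<open>p\<close>.\<close>

definition pext :: "(nat \<Rightarrow> 'a set) \<Rightarrow> nat \<Rightarrow> 'a set" where
  "pext B n = {x \<in> S n. \<exists>y\<in>S n. x - \<mu> y \<in> B n}"

lemma \<mu>_S: "x \<in> S n \<Longrightarrow> \<mu> x \<in> S n"
  using \<mu>_closed S_subgrp by blast

lemma \<mu>_pext: "subgrp (B n) \<Longrightarrow> x \<in> S n \<Longrightarrow> \<mu> x \<in> pext B n"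
  using \<mu>_S[of x n] subgrp_0[of "B n"] by (auto simp: pext_def intro!: bexI[of _ x])

lemma subgrp_pext:
  assumes "subgrp (B n)"
  shows "subgrp (pext B n)"
  unfolding subgrp_def
proof (intro conjI ballI)
  show "0 \<in> pext B n"
    using \<mu>_pext[of B n 0] assms S_subgrp[of n] by (simp add: subgrp_0)
  fix x y assume "x \<in> pext B n" "y \<in> pext B n"
  then obtain u v where *: "x \<in> S n" "y \<in> S n" "u \<in> S n" "v \<in> S n" "x - \<mu> u \<in> B n" "y - \<mu> v \<in> B n"
    by (auto simp: pext_def)
  then have "(x - \<mu> u) - (y - \<mu> v) \<in> B n"
    using assms subgrp_diff by blast
  moreover have "(x - \<mu> u) - (y - \<mu> v) = (x - y) - \<mu> (u - v)"
    by (simp add: \<mu>_diff)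
  ultimately have "(x - y) - \<mu> (u - v) \<in> B n"
    by simp
  moreover have "x - y \<in> S n" "u - v \<in> S n"
    using * S_subgrp subgrp_diff by blast+
  ultimately show "x - y \<in> pext B n"
    by (auto simp: pext_def)
qed

lemma subset_pext: "B n \<subseteq> S n \<Longrightarrow> B n \<subseteq> pext B n"
  using subgrp_0[OF S_subgrp, of n] by (auto simp: pext_def intro!: bexI[of _ 0])

lemma stable_pext:
  assumes "stable B"
  shows "stable (pext B)"
  unfolding stable_def subcomplex_def
proof (intro conjI allI ballI)
  note B = stableD[OF assms]
  note Sc = subcomplexD[OF S] and Bc = subcomplexD[OF B(1)]
  fix n
  show "subgrp (pext B n)"
    using B(5) by (rule subgrp_pext)
  show "pext B n \<subseteq> S n"
    by (auto simp: pext_def)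
  have *: "d n x \<in> pext B (n - 1)" "\<sigma> n x \<in> pext B n" "\<tau> n x \<in> pext B n" "d (n - 1) (d n x) = 0"
    if "x \<in> pext B n" for x
  proof -
    obtain y where x: "x \<in> S n" and y: "y \<in> S n" "x - \<mu> y \<in> B n"
      using \<open>x \<in> pext B n\<close> by (auto simp: pext_def)
    have "d n x - \<mu> (d n y) \<in> B (n - 1)"
      using Bc(2)[OF y(2)] by (simp add: d_diff d_\<mu>)
    then show "d n x \<in> pext B (n - 1)"
      using Sc(2) x y(1) by (auto simp: pext_def)
    have "\<sigma> n x - \<mu> (\<sigma> n y) \<in> B n"
      using B(3)[OF y(2)] by (simp add: \<sigma>_diff \<sigma>_\<mu>)
    then show "\<sigma> n x \<in> pext B n"
      using \<sigma>_S x y(1) by (auto simp: pext_def)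
    have "\<tau> n x - \<mu> (\<tau> n y) \<in> B n"
      using B(4)[OF y(2)] by (simp add: \<tau>_diff \<tau>_\<mu>)
    then show "\<tau> n x \<in> pext B n"
      using \<tau>_S x y(1) by (auto simp: pext_def)
    show "d (n - 1) (d n x) = 0"
      using Sc(3)[OF x] .
  qed
  show "\<sigma> n ` pext B n \<subseteq> pext B n" "\<tau> n ` pext B n \<subseteq> pext B n"
    using * by auto
  fix x assume "x \<in> pext B n"
  then show "d n x \<in> pext B (n - 1)" "d (n - 1) (d n x) = 0"
    using * by auto
qed

text \<open>Universal coefficients: \<open>sat\<close> makes multiplication by \<open>p\<close>
  injective on \<open>S / B\<close>, so the homology of the reduction in degree \<open>n\<close> is
  squeezed between that of \<open>S / B\<close> in degrees \<open>n\<close> and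
  \<open>n - 1\<close>.\<close>

lemma acyc_pext:
  assumes B: "subcomplex B" and sub: "\<And>n. B n \<subseteq> S n"
    and sat: "\<And>n x. x \<in> S n \<Longrightarrow> \<mu> x \<in> B n \<Longrightarrow> x \<in> B n"
    and ac: "acyc S B n" "acyc S B (n - 1)"
  shows "acyc S (pext B) n"
  unfolding acyc_def
proof (intro ballI impI)
  note Sc = subcomplexD[OF S] and Bc = subcomplexD[OF B]
  fix x assume x: "x \<in> S n" "d n x \<in> pext B (n - 1)"
  have "\<exists>z\<in>S n. d n (x - \<mu> z) \<in> B (n - 1)"
  proof (cases n)
    case 0
    then show ?thesis
      using x by (auto simp: d_zero Bc(1) subgrp_0)
  next
    case (Suc m)
    then obtain y where y: "y \<in> S m" "d n x - \<mu> y \<in> B m"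
      using x by (auto simp: pext_def)
    have "d m (d n x - \<mu> y) \<in> B (m - 1)"
      using Bc(2)[OF y(2)] .
    moreover have "d m (d n x - \<mu> y) = - \<mu> (d m y)"
      using Sc(5)[of x m] x(1) Suc by (simp add: d_diff d_\<mu>)
    ultimately have "\<mu> (d m y) \<in> B (m - 1)"
      using subgrp_minus[OF Bc(1)] by (metis minus_minus)
    then have "d m y \<in> B (m - 1)"
      using sat Sc(2) y(1) by blast
    then obtain z where z: "z \<in> S n" "y - d n z \<in> B m"
      using acycD[OF ac(2)] y(1) Suc by (metis diff_Suc_1)
    have "\<mu> (y - d n z) \<in> B m"
      using z(2) Bc(1) \<mu>_closed by blast
    with y(2) have "(d n x - \<mu> y) + \<mu> (y - d n z) \<in> B m"
      using Bc(1) subgrp_add by blast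
    then show ?thesis
      using z(1) Suc by (auto simp: d_diff d_\<mu> \<mu>_diff)
  qed
  then obtain z where z: "z \<in> S n" "d n (x - \<mu> z) \<in> B (n - 1)"
    by blast
  then have xz: "x - \<mu> z \<in> S n"
    using x \<mu>_S S_subgrp subgrp_diff by blast
  then obtain w where w: "w \<in> S (Suc n)" "x - \<mu> z - d (Suc n) w \<in> B n"
    using acycD[OF ac(1) _ z(2)] by blast
  have "x - d (Suc n) w - \<mu> z \<in> B n"
    using w(2) by (simp add: algebra_simps)
  moreover have "x - d (Suc n) w \<in> S n"
    using x w(1) Sc(4) S_subgrp subgrp_diff by blast
  ultimately show "\<exists>y\<in>S (Suc n). x - d (Suc n) y \<in> pext B n"
    using w(1) z(1) by (auto simp: pext_def)
qed

text \<open>Coinvariants commute with reduction modulo \<open>p\<close>: an element with norm in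
  \<open>pext B\<close> is \<open>\<tau> n z + \<mu> w\<close> up to \<open>B\<close>, and the first
  term has norm zero.\<close>

lemma coinv_pext:
  assumes B: "stable B" and "induced_quotient S (pext B)"
  shows "coinv (pext B) n = pext (coinv B) n"
proof (intro equalityI subsetI)
  fix x assume "x \<in> coinv (pext B) n"
  then have x: "x \<in> S n" "\<sigma> n x \<in> pext B n"
    by (auto simp: coinv_def)
  then obtain z where z: "z \<in> S n" "x - \<tau> n z \<in> pext B n"
    using induced_quotientD(4)[OF assms(2)] by blast
  then obtain w where w: "w \<in> S n" "x - \<tau> n z - \<mu> w \<in> B n"
    by (auto simp: pext_def)
  have "\<sigma> n (x - \<mu> w) \<in> B n"
    using stableD(3)[OF B w(2)] \<sigma>_\<tau>[OF z(1)] by (simp add: \<sigma>_diff)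
  moreover have "x - \<mu> w \<in> S n"
    using x w(1) \<mu>_S S_subgrp subgrp_diff by blast
  ultimately show "x \<in> pext (coinv B) n"
    using x(1) w(1) by (auto simp: pext_def coinv_def)
next
  fix x assume "x \<in> pext (coinv B) n"
  then obtain y where "x \<in> S n" "y \<in> S n" "\<sigma> n (x - \<mu> y) \<in> B n"
    by (auto simp: pext_def coinv_def)
  then show "x \<in> coinv (pext B) n"
    using \<sigma>_S by (auto simp: pext_def coinv_def \<sigma>_diff \<sigma>_\<mu>)
qed

abbreviation "zero_complex \<equiv> \<lambda>_::nat. {0::'a}"

lemma stable_zero: "stable zero_complex"
  by (auto simp: stable_def subcomplex_def subgrp_def subgrp_0[OF S_subgrp])

theorem acyc_coinv_zero:
  assumes M_ind: "induced_quotient S M" and pM_ind: "induced_quotient S (pext M)"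
    and S_ac: "\<And>n. acyc S zero_complex n"
    and N: "\<And>n. n \<ge> N \<Longrightarrow> acyc S M n" "\<And>n. n \<ge> N \<Longrightarrow> acyc S (coinv M) n"
  shows "acyc S (coinv zero_complex) n"
proof -
  note Sc = subcomplexD[OF S] and Mc = stableD[OF M]
  define P where "P = pext zero_complex"
  define R where "R = pext M"
  have stP: "stable P" and stR: "stable R"
    unfolding P_def R_def using stable_pext stable_zero M by blast+
  note Pc = stableD[OF stP] and Rc = stableD[OF stR]
  have \<mu>P: "\<mu> x \<in> P n" if "x \<in> S n" for x n
    using \<mu>_pext[of zero_complex n x] that by (simp add: P_def subgrp_def)
  have PD: "\<exists>y\<in>S n. x = \<mu> y" if "x \<in> P n" for x n
    using that by (auto simp: P_def pext_def)
  have RD: "\<exists>y\<in>S n. x - \<mu> y \<in> M n" if "x \<in> R n" for x n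
    using that by (auto simp: R_def pext_def)
  have PR: "P n \<subseteq> R n" for n
    using \<mu>_pext[OF Mc(5)] PD by (fastforce simp: R_def)
  have SP: "acyc S P n" for n
    unfolding P_def
  proof (rule acyc_pext)
    show "zero_complex n \<subseteq> S n" for n
      using stable_zero by (simp add: stable_def)
  qed (use stable_zero S_ac \<mu>_inj in \<open>auto simp: stable_def\<close>)
  \<comment> \<open>On \<open>M\<close> the norm is \<open>\<mu>\<close> and \<open>\<tau>\<close>
    vanishes; on multiples of \<open>p\<close> both maps commute with \<open>\<mu>\<close>.\<close>
  have \<sigma>R: "\<sigma> n x \<in> P n" and \<tau>R: "\<tau> n x \<in> P n" if x: "x \<in> R n" for n x
  proof -
    obtain y where y: "y \<in> S n" "x - \<mu> y \<in> M n"
      using RD x by blast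
    have "\<sigma> n x = \<mu> (x - \<mu> y + \<sigma> n y)" "\<tau> n x = \<mu> (\<tau> n y)"
      using \<sigma>_M[OF y(2)] \<tau>_M[OF y(2)] by (simp_all add: \<sigma>_diff \<sigma>_\<mu> \<mu>_add \<mu>_diff \<tau>_diff \<tau>_\<mu> algebra_simps)
    moreover have "x - \<mu> y + \<sigma> n y \<in> S n"
      using y Mc(2) \<sigma>_S S_subgrp subgrp_add by blast
    ultimately show "\<sigma> n x \<in> P n" "\<tau> n x \<in> P n"
      using \<mu>P \<tau>_S y(1) by auto
  qed
  \<comment> \<open>\<open>Suc N\<close> instead of \<open>N\<close>, because
    \<open>acyc_pext\<close> also consumes the degree below.\<close>
  have big: "acyc S R n" "acyc S (coinv R) n" if "n \<ge> Suc N" for n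
  proof -
    have "n \<ge> N" "n - 1 \<ge> N"
      using that by auto
    then show "acyc S R n"
      unfolding R_def using Mc M_sat N by (intro acyc_pext) auto
    have "acyc S (pext (coinv M)) n"
    proof (rule acyc_pext)
      show "x \<in> coinv M n" if "x \<in> S n" "\<mu> x \<in> coinv M n" for x n
        using that M_sat[OF \<sigma>_S] by (auto simp: coinv_def \<sigma>_\<mu>)
    qed (use \<open>n \<ge> N\<close> \<open>n - 1 \<ge> N\<close> N coinv_subcomplex Mc coinv_subset in auto)
    moreover have "pext (coinv M) = coinv R"
      using coinv_pext[OF M pM_ind] by (auto simp: R_def)
    ultimately show "acyc S (coinv R) n"
      by simp
  qed
  have smith: "acyc S R n" "acyc S (coinv R) n" for n
    using smith_acyc[OF pM_ind[folded R_def] stP PR \<sigma>R \<tau>R SP big] by auto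
  have RP: "acyc R P n" for n
    using acyc_third[of S R P n] S Rc PR SP smith by blast
  define K where "K = coinv zero_complex"
  have subK: "subcomplex K"
    unfolding K_def using coinv_subcomplex stable_zero stableD(1) by blast
  note Kc = subcomplexD[OF subK]
  have KI: "x \<in> K n" if "x \<in> S n" "\<sigma> n x = 0" for x n
    using that by (simp add: K_def coinv_def)
  have KD: "x \<in> S n" "\<sigma> n x = 0" if "x \<in> K n" for x n
    using that by (simp_all add: K_def coinv_def)
  \<comment> \<open>The homology of \<open>S / K\<close> vanishes modulo \<open>p\<close>.
    Acyclicity of the coinvariants of \<open>S / R\<close> reduces a cycle to an element
    \<open>m\<close> of \<open>M\<close>, up to a boundary, a multiple of \<open>p\<close> and an
    element of \<open>K\<close>. It then remains to see that \<open>m\<close> is a cycle of the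
    acyclic quotient \<open>R / P\<close>.\<close>
  have mod_p: "\<exists>y\<in>S (Suc n). \<exists>z\<in>S n. x - d (Suc n) y - \<mu> z \<in> K n"
    if x: "x \<in> S n" "\<sigma> (n - 1) (d n x) = 0" for x n
  proof -
    have "d n x \<in> coinv R (n - 1)"
      using x Sc Rc(5) by (auto simp: coinv_def subgrp_0)
    then obtain z where z: "z \<in> S (Suc n)" "x - d (Suc n) z \<in> coinv R n"
      using acycD[OF smith(2) x(1)] by blast
    then have "x - d (Suc n) z \<in> S n" "\<sigma> n (x - d (Suc n) z) \<in> R n"
      by (auto simp: coinv_def)
    then obtain w where w: "w \<in> S n" "x - d (Suc n) z - \<tau> n w \<in> R n"
      using induced_quotientD(4)[OF pM_ind] by (auto simp: R_def)
    then obtain s where s: "s \<in> S n" "x - d (Suc n) z - \<tau> n w - \<mu> s \<in> M n"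
      using RD by blast
    define m where "m = x - d (Suc n) z - \<tau> n w - \<mu> s"
    have m: "m \<in> M n"
      using s(2) by (simp add: m_def)
    define s' where "s' = d n s"
    have s': "s' \<in> S (n - 1)"
      using s(1) Sc by (simp add: s'_def)
    have dm: "d n m \<in> M (n - 1)"
      using subcomplexD(2)[OF Mc(1) m] .
    have "\<sigma> (n - 1) (d n m) = - \<mu> (\<sigma> (n - 1) s')"
      using x(2) Sc(5)[OF z(1)] \<tau>_d[OF w(1)] \<sigma>_\<tau>[OF Sc(2)[OF w(1)]]
      by (simp add: m_def s'_def d_diff \<sigma>_diff d_\<mu> \<sigma>_\<mu>)
    moreover have "\<sigma> (n - 1) (d n m) = \<mu> (d n m)"
      using \<sigma>_M[OF dm] .
    ultimately have "\<mu> (d n m) = - \<mu> (\<sigma> (n - 1) s')"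
      by metis
    then have "\<mu> (d n m + \<sigma> (n - 1) s') = 0"
      by (simp add: \<mu>_add)
    then have dm_eq: "d n m = - \<sigma> (n - 1) s'"
      using \<mu>_inj by (simp add: eq_neg_iff_add_eq_0)
    then have "\<sigma> (n - 1) s' \<in> M (n - 1)"
      using dm Mc(5) by (metis minus_minus subgrp_minus)
    \<comment> \<open>Up to sign, \<open>d n m\<close> is the norm of \<open>s'\<close>, and it lies
      in \<open>M\<close>. As \<open>S / M\<close> is induced, it is also the norm of an element of
      \<open>M\<close>, hence a multiple of \<open>p\<close>.\<close>
    then obtain t where t: "t \<in> S (n - 1)" "s' - \<tau> (n - 1) t \<in> M (n - 1)"
      using induced_quotientD(4)[OF M_ind s'] by blast
    have "\<sigma> (n - 1) s' = \<mu> (s' - \<tau> (n - 1) t)"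
      using \<sigma>_M[OF t(2)] \<sigma>_\<tau>[OF t(1)] by (simp add: \<sigma>_diff)
    then have "d n m \<in> P (n - 1)"
      using dm_eq \<mu>P[OF Mc(2)[OF t(2)]] Pc(5) subgrp_minus by metis
    moreover have "m \<in> R n"
      using m subset_pext[of M n] Mc(2) by (auto simp: R_def)
    ultimately obtain r where r: "r \<in> R (Suc n)" "m - d (Suc n) r \<in> P n"
      using acycD[OF RP] by blast
    then obtain q where q: "q \<in> S n" "m - d (Suc n) r = \<mu> q"
      using PD by blast
    have "x - d (Suc n) (z + r) - \<mu> (s + q) = \<tau> n w"
      using q(2) by (simp add: m_def d_add \<mu>_add algebra_simps)
    moreover have "\<tau> n w \<in> K n"
      using KI \<tau>_S w(1) \<sigma>_\<tau> by blast
    moreover have "z + r \<in> S (Suc n)" "s + q \<in> S n"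
      using z(1) r(1) Rc(2) s(1) q(1) S_subgrp subgrp_add by blast+
    ultimately show ?thesis
      by metis
  qed
  show ?thesis
    unfolding acyc_def K_def[symmetric]
  proof (intro ballI impI)
    fix x assume x: "x \<in> S n" "d n x \<in> K (n - 1)"
    then obtain y z where y: "y \<in> S (Suc n)" and z: "z \<in> S n" and *: "x - d (Suc n) y - \<mu> z \<in> K n"
      using mod_p KD by blast
    define k where "k = x - d (Suc n) y - \<mu> z"
    have k: "k \<in> K n"
      using * by (simp add: k_def)
    have "\<mu> (\<sigma> (n - 1) (d n z)) = 0"
      using KD(2)[OF x(2)] KD(2)[OF Kc(2)[OF k]] Sc(5)[OF y]
      by (simp add: k_def d_diff \<sigma>_diff d_\<mu> \<sigma>_\<mu>)
    then have "d n (\<sigma> n z) \<in> zero_complex (n - 1)"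
      using \<mu>_inj \<sigma>_d[OF z] by simp
    then obtain v where v: "v \<in> S (Suc n)" "\<sigma> n z - d (Suc n) v \<in> {0}"
      by (rule acycD[OF S_ac \<sigma>_S[OF z]])
    \<comment> \<open>The norm kills this difference, because its square is \<open>p\<close> times
      the norm. So modulo \<open>K\<close> the multiple \<open>\<mu> z\<close> may be replaced by
      \<open>\<sigma> n z\<close>, which is a cycle of the acyclic complex \<open>S\<close> and thus
      a boundary.\<close>
    have "\<mu> z - \<sigma> n z \<in> K n"
    proof (rule KI)
      show "\<mu> z - \<sigma> n z \<in> S n"
        using z \<mu>_S \<sigma>_S S_subgrp subgrp_diff by blast
    qed (simp add: \<sigma>_diff \<sigma>_\<mu> \<sigma>_\<sigma>[OF z])
    with k have "k + (\<mu> z - \<sigma> n z) \<in> K n"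
      using Kc(1) subgrp_add by blast
    moreover have "k + (\<mu> z - \<sigma> n z) = x - d (Suc n) (y + v)"
      using v(2) by (simp add: k_def d_add)
    ultimately show "\<exists>y\<in>S (Suc n). x - d (Suc n) y \<in> K n"
      using y v(1) subgrp_add[OF S_subgrp] by metis
  qed
qed

end

section \<open>Permutation modules\<close>

definition norm_map :: "nat \<Rightarrow> ('m::ab_group_add \<Rightarrow> 'm) \<Rightarrow> 'm \<Rightarrow> 'm" where
  "norm_map p g x = (\<Sum>i<p. (g ^^ i) x)"

locale cyclic_action =
  fixes p :: nat and g :: "'m::ab_group_add \<Rightarrow> 'm" and S :: "'m set"
  assumes g_diff: "g (x - y) = g x - g y"
    and subgrp_S: "subgrp S"
    and g_S: "x \<in> S \<Longrightarrow> g x \<in> S"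
    and g_pow_p: "x \<in> S \<Longrightarrow> (g ^^ p) x = x"
    and p_pos: "p > 0"
begin

lemma gp_diff: "(g ^^ i) (x - y) = (g ^^ i) x - (g ^^ i) y"
  by (induction i) (simp_all add: g_diff)

lemma gp_0 [simp]: "(g ^^ i) 0 = 0"
  using gp_diff[of i 0 0] by simp

lemma gp_minus: "(g ^^ i) (- x) = - (g ^^ i) x"
  using gp_diff[of i 0 x] by simp

lemma gp_add: "(g ^^ i) (x + y) = (g ^^ i) x + (g ^^ i) y"
  using gp_diff[of i x "- y"] by (simp add: gp_minus)

lemma gp_sum: "(g ^^ i) (sum f I) = (\<Sum>j\<in>I. (g ^^ i) (f j))"
  by (induction I rule: infinite_finite_induct) (simp_all add: gp_add)

lemma g_add: "g (x + y) = g x + g y"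
  using gp_add[of 1] by simp

lemma g_minus: "g (- x) = - g x"
  using gp_minus[of 1] by simp

lemma g_0 [simp]: "g 0 = 0"
  using gp_0[of 1] by simp

lemma g_sum: "g (sum f I) = (\<Sum>j\<in>I. g (f j))"
  using gp_sum[of 1 f I] by simp

lemma gp_closed: "(\<And>x. x \<in> A \<Longrightarrow> g x \<in> A) \<Longrightarrow> x \<in> A \<Longrightarrow> (g ^^ i) x \<in> A"
  by (induction i) auto

lemma norm_map_diff: "norm_map p g (x - y) = norm_map p g x - norm_map p g y"
  by (simp add: norm_map_def gp_diff sum_subtractf)

lemma norm_map_add: "norm_map p g (x + y) = norm_map p g x + norm_map p g y"
  by (simp add: norm_map_def gp_add sum.distrib)

lemma norm_map_sum: "norm_map p g (sum f I) = (\<Sum>i\<in>I. norm_map p g (f i))"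
  unfolding norm_map_def gp_sum by (rule sum.swap)

lemma norm_map_closed:
  "subgrp A \<Longrightarrow> (\<And>x. x \<in> A \<Longrightarrow> g x \<in> A) \<Longrightarrow> x \<in> A \<Longrightarrow> norm_map p g x \<in> A"
  unfolding norm_map_def by (intro subgrp_sum gp_closed) auto

lemma norm_map_shift:
  assumes "x \<in> S"
  shows "norm_map p g (g x) = norm_map p g x" "g (norm_map p g x) = norm_map p g x"
proof -
  have "(\<Sum>i<p. (g ^^ Suc i) x) = norm_map p g x"
    using sum.lessThan_Suc_shift[of "\<lambda>i. (g ^^ i) x" p] g_pow_p[OF assms]
    by (simp add: norm_map_def)
  then show "norm_map p g (g x) = norm_map p g x" "g (norm_map p g x) = norm_map p g x"
    by (simp_all add: norm_map_def funpow_swap1 g_sum)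
qed

lemma norm_map_gp: "x \<in> S \<Longrightarrow> norm_map p g ((g ^^ i) x) = norm_map p g x"
  by (induction i) (auto simp: norm_map_shift gp_closed[of S] g_S)

lemma gp_telescope: "x - (g ^^ i) x = (\<Sum>k<i. (g ^^ k) x) - g (\<Sum>k<i. (g ^^ k) x)"
proof (induction i)
  case (Suc i)
  then show ?case
    by (simp add: g_add algebra_simps)
qed simp

text \<open>
  The hypotheses say that \<open>S / R\<close> is induced from \<open>T\<close>.
\<close>

lemma induced_kernels:
  assumes R: "subgrp R" "\<And>x. x \<in> R \<Longrightarrow> g x \<in> R" and T: "subgrp T" "T \<subseteq> S"
    and decomp: "\<And>x. x \<in> S \<Longrightarrow> \<exists>t. (\<forall>i. t i \<in> T) \<and> x - (\<Sum>i<p. (g ^^ i) (t i)) \<in> R"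
    and unique: "\<forall>t. (\<forall>i. t i \<in> T) \<longrightarrow> (\<Sum>i<p. (g ^^ i) (t i)) \<in> R \<longrightarrow> (\<forall>i<p. t i \<in> R)"
    and x: "x \<in> S"
  shows "norm_map p g x \<in> R \<Longrightarrow> \<exists>y\<in>S. x - (y - g y) \<in> R"
    and "x - g x \<in> R \<Longrightarrow> \<exists>y\<in>S. x - norm_map p g y \<in> R"
proof -
  obtain t where t: "\<And>i. t i \<in> T" and m: "x - (\<Sum>i<p. (g ^^ i) (t i)) \<in> R"
    using decomp[OF x] by blast
  define m where "m = x - (\<Sum>i<p. (g ^^ i) (t i))"
  have x_eq: "x = m + (\<Sum>i<p. (g ^^ i) (t i))" and mR: "m \<in> R"
    using m by (simp_all add: m_def)
  show "\<exists>y\<in>S. x - (y - g y) \<in> R" if *: "norm_map p g x \<in> R"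
  proof -
    \<comment> \<open>Collecting the components in \<open>T\<close> does not change the norm.
      Uniqueness of the decomposition, applied to the norm of \<open>u\<close>, puts
      \<open>u\<close> into \<open>R\<close>; by \<open>gp_telescope\<close>, \<open>x - u\<close>
      is a value of \<open>1 - g\<close> modulo \<open>R\<close>.\<close>
    define u where "u = (\<Sum>i<p. t i)"
    have uT: "u \<in> T"
      unfolding u_def using T(1) t by (intro subgrp_sum)
    have "norm_map p g x = norm_map p g m + norm_map p g u"
      using t T(2) by (simp add: x_eq norm_map_add norm_map_sum norm_map_gp subset_iff u_def)
    then have "norm_map p g u = norm_map p g x - norm_map p g m"
      by simp
    then have "norm_map p g u \<in> R"
      using * norm_map_closed[OF R mR] R(1) by (simp add: subgrp_diff)
    then have "(\<Sum>i<p. (g ^^ i) ((\<lambda>_. u) i)) \<in> R"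
      by (simp add: norm_map_def)
    then have "u \<in> R"
      using unique[rule_format, of "\<lambda>_. u" 0] uT p_pos by simp
    define y where "y = - (\<Sum>i<p. \<Sum>k<i. (g ^^ k) (t i))"
    have "u - (\<Sum>i<p. (g ^^ i) (t i)) = (\<Sum>i<p. t i - (g ^^ i) (t i))"
      by (simp add: u_def sum_subtractf)
    also have "\<dots> = (\<Sum>i<p. (\<Sum>k<i. (g ^^ k) (t i)) - g (\<Sum>k<i. (g ^^ k) (t i)))"
      by (simp only: gp_telescope)
    also have "\<dots> = - y - g (- y)"
      by (simp add: y_def sum_subtractf g_sum g_minus)
    finally have "x - (y - g y) = m + u"
      by (simp add: x_eq g_minus algebra_simps)
    moreover have "(g ^^ k) (t i) \<in> S" for k i
      using gp_closed[of S "t i" k] g_S t T(2) by blast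
    then have "y \<in> S"
      unfolding y_def by (intro subgrp_minus subgrp_sum subgrp_S)
    ultimately show ?thesis
      using subgrp_add[OF R(1) mR \<open>u \<in> R\<close>] by metis
  qed
  show "\<exists>y\<in>S. x - norm_map p g y \<in> R" if *: "x - g x \<in> R"
  proof -
    obtain q where q: "p = Suc q"
      using p_pos by (cases p) auto
    \<comment> \<open>The components of \<open>x - g x\<close> are the cyclic differences of those
      of \<open>x\<close>. Uniqueness puts them into \<open>R\<close>, so modulo \<open>R\<close>
      all components equal \<open>t 0\<close> and \<open>x\<close> is the norm of
      \<open>t 0\<close>.\<close>
    define s where "s i = t i - (if i = 0 then t q else t (i - 1))" for i
    have sT: "s i \<in> T" for i
      using t T(1) by (simp add: s_def subgrp_diff)
    have "g (\<Sum>i<p. (g ^^ i) (t i)) = (\<Sum>i<p. (g ^^ Suc i) (t i))"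
      by (simp add: g_sum)
    also have "\<dots> = (g ^^ p) (t q) + (\<Sum>i<q. (g ^^ Suc i) (t i))"
      by (simp add: q)
    also have "\<dots> = t q + (\<Sum>i<q. (g ^^ Suc i) (t i))"
      using g_pow_p t T(2) by auto
    also have "\<dots> = (\<Sum>i<p. (g ^^ i) (if i = 0 then t q else t (i - 1)))"
      unfolding q sum.lessThan_Suc_shift by simp
    finally have "(\<Sum>i<p. (g ^^ i) (t i)) - g (\<Sum>i<p. (g ^^ i) (t i)) = (\<Sum>i<p. (g ^^ i) (s i))"
      by (simp add: s_def gp_diff sum_subtractf)
    moreover have "x - g x = (m - g m) + ((\<Sum>i<p. (g ^^ i) (t i)) - g (\<Sum>i<p. (g ^^ i) (t i)))"
      by (simp add: x_eq g_add)
    ultimately have "(\<Sum>i<p. (g ^^ i) (s i)) = (x - g x) - (m - g m)"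
      by simp
    then have "(\<Sum>i<p. (g ^^ i) (s i)) \<in> R"
      using * mR R by (metis subgrp_diff)
    then have sR: "s i \<in> R" if "i < p" for i
      using unique[rule_format, of s, OF sT] that by blast
    have tR: "t i - t 0 \<in> R" if "i < p" for i
      using that
    proof (induction i)
      case 0
      then show ?case
        using R(1) by (simp add: subgrp_0)
    next
      case (Suc i)
      then have "s (Suc i) + (t i - t 0) \<in> R"
        using sR[of "Suc i"] R(1) by (simp add: subgrp_add)
      then show ?case
        by (simp add: s_def)
    qed
    have "x - norm_map p g (t 0) = m + (\<Sum>i<p. (g ^^ i) (t i - t 0))"
      by (simp add: x_eq norm_map_def gp_diff sum_subtractf)
    moreover have "(\<Sum>i<p. (g ^^ i) (t i - t 0)) \<in> R"
      using R tR by (intro subgrp_sum gp_closed[of R]) auto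
    ultimately have "x - norm_map p g (t 0) \<in> R"
      using subgrp_add[OF R(1) mR] by simp
    then show ?thesis
      using t T(2) by blast
  qed
qed

end

section \<open>Free abelian groups with a permuted basis\<close>

definition supp :: "'b set \<Rightarrow> ('b \<Rightarrow>\<^sub>0 int) set" where
  "supp B = {c. Poly_Mapping.keys c \<subseteq> B}"

lemma subgrp_supp: "subgrp (supp B)"
  unfolding subgrp_def supp_def using keys_diff by fastforce

lemma supp_mono: "A \<subseteq> B \<Longrightarrow> supp A \<subseteq> supp B"
  by (auto simp: supp_def)

lemma supp_cmul: "c \<in> supp B \<Longrightarrow> frag_cmul k c \<in> supp B"
  by (auto simp: supp_def)

lemma frag_of_supp [simp]: "frag_of b \<in> supp B \<longleftrightarrow> b \<in> B"
  by (simp add: supp_def)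

lemma supp_empty [simp]: "supp {} = {0}"
  by (auto simp: supp_def)

lemma lookup_supp: "c \<in> supp B \<Longrightarrow> b \<notin> B \<Longrightarrow> Poly_Mapping.lookup c b = 0"
  by (auto simp: supp_def in_keys_iff)

lemma suppI: "(\<And>b. b \<notin> B \<Longrightarrow> Poly_Mapping.lookup c b = 0) \<Longrightarrow> c \<in> supp B"
  by (auto simp: supp_def in_keys_iff)

definition basis_map :: "('b \<Rightarrow> 'c) \<Rightarrow> ('b \<Rightarrow>\<^sub>0 int) \<Rightarrow> ('c \<Rightarrow>\<^sub>0 int)" where
  "basis_map \<pi> = frag_extend (frag_of \<circ> \<pi>)"

lemma basis_map_of [simp]: "basis_map \<pi> (frag_of b) = frag_of (\<pi> b)"
  by (simp add: basis_map_def)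

lemma basis_map_0 [simp]: "basis_map \<pi> 0 = 0"
  by (simp add: basis_map_def)

lemma basis_map_diff: "basis_map \<pi> (x - y) = basis_map \<pi> x - basis_map \<pi> y"
  by (simp add: basis_map_def frag_extend_diff)

lemma basis_map_cmul: "basis_map \<pi> (frag_cmul k x) = frag_cmul k (basis_map \<pi> x)"
  by (simp add: basis_map_def frag_extend_cmul)

lemma basis_map_supp: "\<pi> ` A \<subseteq> B \<Longrightarrow> c \<in> supp A \<Longrightarrow> basis_map \<pi> c \<in> supp B"
  using keys_frag_extend[of "frag_of \<circ> \<pi>" c] by (fastforce simp: supp_def basis_map_def)

lemma basis_map_pow_diff:
  fixes \<pi> :: "'b \<Rightarrow> 'b"
  shows "(basis_map \<pi> ^^ i) (x - y) = (basis_map \<pi> ^^ i) x - (basis_map \<pi> ^^ i) y"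
  by (induction i) (simp_all add: basis_map_diff)

lemma basis_map_pow_of:
  fixes \<pi> :: "'b \<Rightarrow> 'b"
  shows "(basis_map \<pi> ^^ i) (frag_of b) = frag_of ((\<pi> ^^ i) b)"
  by (induction i) simp_all

lemma basis_map_pow_0 [simp]:
  fixes \<pi> :: "'b \<Rightarrow> 'b"
  shows "(basis_map \<pi> ^^ i) 0 = 0"
  by (induction i) simp_all

lemma basis_map_pow_id:
  assumes "\<And>b. b \<in> B \<Longrightarrow> (\<pi> ^^ p) b = b" "c \<in> supp B"
  shows "(basis_map \<pi> ^^ p) c = c"
  using assms(2) unfolding supp_def mem_Collect_eq
  by (induction c rule: frag_induction) (simp_all add: basis_map_pow_of basis_map_pow_diff assms(1))

lemma basis_map_pow_cmul:
  fixes \<pi> :: "'b \<Rightarrow> 'b"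
  shows "(basis_map \<pi> ^^ i) (frag_cmul k x) = frag_cmul k ((basis_map \<pi> ^^ i) x)"
  by (induction i) (simp_all add: basis_map_cmul)

text \<open>For \<open>A\<close> inside \<open>B\<close> this is \<open>supp A\<close> plus
  \<open>q\<close> times \<open>supp B\<close>. The values \<open>q = 0\<close> and
  \<open>q = p\<close> treat \<open>S / M\<close> and \<open>S / R\<close> in one argument.\<close>

definition supp_mod :: "'b set \<Rightarrow> 'b set \<Rightarrow> int \<Rightarrow> ('b \<Rightarrow>\<^sub>0 int) set" where
  "supp_mod B A q = {c \<in> supp B. \<forall>b\<in>B - A. q dvd Poly_Mapping.lookup c b}"

lemma supp_mod_0: "A \<subseteq> B \<Longrightarrow> supp_mod B A 0 = supp A"
  unfolding supp_mod_def using lookup_supp supp_mono by (fastforce intro: suppI)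

lemma supp_subset_supp_mod: "A \<subseteq> B \<Longrightarrow> supp A \<subseteq> supp_mod B A q"
  unfolding supp_mod_def using lookup_supp supp_mono by fastforce

lemma subgrp_supp_mod: "subgrp (supp_mod B A q)"
  using subgrp_supp[of B] by (auto simp: subgrp_def supp_mod_def lookup_minus)

lemma supp_mod_decomp:
  assumes "c \<in> supp_mod B A q" "A \<subseteq> B"
  shows "\<exists>y\<in>supp B. c - frag_cmul q y \<in> supp A"
proof -
  define y where "y = (\<Sum>b \<in> Poly_Mapping.keys c - A. frag_cmul (Poly_Mapping.lookup c b div q) (frag_of b))"
  have c: "c \<in> supp B" "\<And>b. b \<in> B - A \<Longrightarrow> q dvd Poly_Mapping.lookup c b"
    using assms by (auto simp: supp_mod_def)
  have "y \<in> supp B"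
    unfolding y_def using c(1) by (intro subgrp_sum subgrp_supp supp_cmul) (auto simp: supp_def)
  moreover have "c - frag_cmul q y \<in> supp A"
  proof (rule suppI)
    fix b assume "b \<notin> A"
    have "Poly_Mapping.lookup y b =
        (\<Sum>i \<in> Poly_Mapping.keys c - A. if b = i then Poly_Mapping.lookup c i div q else 0)"
      by (simp add: y_def lookup_sum if_distrib cong: if_cong)
    also have "\<dots> = (if b \<in> Poly_Mapping.keys c then Poly_Mapping.lookup c b div q else 0)"
      using \<open>b \<notin> A\<close> by (simp add: sum.delta)
    also have "\<dots> = Poly_Mapping.lookup c b div q"
      by (simp add: in_keys_iff)
    finally have "Poly_Mapping.lookup y b = Poly_Mapping.lookup c b div q" .
    moreover have "q dvd Poly_Mapping.lookup c b"
      using c \<open>b \<notin> A\<close> lookup_supp[OF c(1)] by (cases "b \<in> B") auto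
    ultimately show "Poly_Mapping.lookup (c - frag_cmul q y) b = 0"
      by (simp add: lookup_minus)
  qed
  ultimately show ?thesis
    by blast
qed

locale permutation_module =
  fixes p :: nat and \<pi> :: "'b \<Rightarrow> 'b" and B :: "'b set"
  assumes \<pi>_B: "b \<in> B \<Longrightarrow> \<pi> b \<in> B"
    and \<pi>_pow_p: "b \<in> B \<Longrightarrow> (\<pi> ^^ p) b = b"
    and p_pos: "p > 0"
begin

sublocale cyclic_action p "basis_map \<pi>" "supp B"
proof
  show "basis_map \<pi> x \<in> supp B" if "x \<in> supp B" for x
    using that \<pi>_B by (intro basis_map_supp[of \<pi> B B]) auto
  show "(basis_map \<pi> ^^ p) x = x" if "x \<in> supp B" for x
    using that \<pi>_pow_p by (intro basis_map_pow_id[of B]) auto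
qed (simp_all add: basis_map_diff subgrp_supp p_pos)

lemma \<pi>_pow_B: "b \<in> B \<Longrightarrow> (\<pi> ^^ i) b \<in> B"
  by (induction i) (auto simp: \<pi>_B)

lemma \<pi>_pow_mod: "b \<in> B \<Longrightarrow> (\<pi> ^^ i) b = (\<pi> ^^ (i mod p)) b"
proof (induction i rule: less_induct)
  case (less i)
  show ?case
  proof (cases "i < p")
    case False
    then have "(\<pi> ^^ i) b = (\<pi> ^^ (i - p)) ((\<pi> ^^ p) b)"
      by (metis comp_apply funpow_add le_add_diff_inverse2 not_less)
    then show ?thesis
      using less False p_pos by (simp add: \<pi>_pow_p le_mod_geq)
  qed simp
qed

lemma \<pi>_pow_inverse: "b \<in> B \<Longrightarrow> i \<le> p \<Longrightarrow> (\<pi> ^^ (p - i)) ((\<pi> ^^ i) b) = b"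
  using fun_cong[OF funpow_add[of "p - i" i \<pi>], of b] by (simp add: \<pi>_pow_p)

lemma transversal_decomp:
  assumes T: "T \<subseteq> B" and cover: "\<And>b. b \<in> B - A \<Longrightarrow> \<exists>i<p. \<exists>t\<in>T. b = (\<pi> ^^ i) t"
    and x: "x \<in> supp B"
  shows "\<exists>t. (\<forall>i. t i \<in> supp T) \<and> x - (\<Sum>i<p. (basis_map \<pi> ^^ i) (t i)) \<in> supp A"
  using x unfolding supp_def[of B] mem_Collect_eq
proof (induction x rule: frag_induction)
  case zero
  show ?case
    using subgrp_0[OF subgrp_supp] by (intro exI[of _ "\<lambda>_. 0"]) auto
next
  case (one b)
  show ?case
  proof (cases "b \<in> A")
    case True
    then show ?thesis
      using subgrp_0[OF subgrp_supp] by (intro exI[of _ "\<lambda>_. 0"]) auto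
  next
    case False
    then obtain i t where it: "i < p" "t \<in> T" "b = (\<pi> ^^ i) t"
      using cover one by blast
    have "(\<Sum>j<p. (basis_map \<pi> ^^ j) (if j = i then frag_of t else 0)) =
        (\<Sum>j<p. if j = i then frag_of b else 0)"
      by (rule sum.cong) (auto simp: basis_map_pow_of it)
    also have "\<dots> = frag_of b"
      using it(1) by simp
    finally show ?thesis
      using it subgrp_0[OF subgrp_supp] by (intro exI[of _ "\<lambda>j. if j = i then frag_of t else 0"]) auto
  qed
next
  case (diff a b)
  then obtain s t where s: "\<forall>i. s i \<in> supp T" "a - (\<Sum>i<p. (basis_map \<pi> ^^ i) (s i)) \<in> supp A"
    and t: "\<forall>i. t i \<in> supp T" "b - (\<Sum>i<p. (basis_map \<pi> ^^ i) (t i)) \<in> supp A"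
    by blast
  have "(a - (\<Sum>i<p. (basis_map \<pi> ^^ i) (s i))) - (b - (\<Sum>i<p. (basis_map \<pi> ^^ i) (t i))) \<in> supp A"
    using s t subgrp_diff[OF subgrp_supp] by blast
  then have "(a - b) - (\<Sum>i<p. (basis_map \<pi> ^^ i) (s i - t i)) \<in> supp A"
    by (simp add: basis_map_pow_diff sum_subtractf algebra_simps)
  moreover have "\<forall>i. s i - t i \<in> supp T"
    using s(1) t(1) subgrp_diff[OF subgrp_supp] by blast
  ultimately show ?case
    by (intro exI[of _ "\<lambda>i. s i - t i"]) auto
qed

lemma lookup_basis_map_pow:
  assumes inj: "\<And>i j s t. i < p \<Longrightarrow> j < p \<Longrightarrow> s \<in> T \<Longrightarrow> t \<in> T \<Longrightarrow> (\<pi> ^^ i) s = (\<pi> ^^ j) t \<Longrightarrow> i = j \<and> s = t"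
    and "c \<in> supp T" "i < p" "j < p" "t \<in> T"
  shows "Poly_Mapping.lookup ((basis_map \<pi> ^^ i) c) ((\<pi> ^^ j) t) = (if i = j then Poly_Mapping.lookup c t else 0)"
  using assms(2) unfolding supp_def mem_Collect_eq
proof (induction c rule: frag_induction)
  case (one b)
  then show ?case
    using inj[OF assms(3,4) one assms(5)] by (auto simp: basis_map_pow_of)
qed (auto simp: basis_map_pow_diff lookup_minus)

lemma lookup_sum_basis_map_pow:
  assumes inj: "\<And>i j s t. i < p \<Longrightarrow> j < p \<Longrightarrow> s \<in> T \<Longrightarrow> t \<in> T \<Longrightarrow> (\<pi> ^^ i) s = (\<pi> ^^ j) t \<Longrightarrow> i = j \<and> s = t"
    and c: "\<And>i. c i \<in> supp T" and "j < p" "t \<in> T"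
  shows "Poly_Mapping.lookup (\<Sum>i<p. (basis_map \<pi> ^^ i) (c i)) ((\<pi> ^^ j) t) = Poly_Mapping.lookup (c j) t"
proof -
  have "Poly_Mapping.lookup ((basis_map \<pi> ^^ i) (c i)) ((\<pi> ^^ j) t) =
      (if i = j then Poly_Mapping.lookup (c i) t else 0)" if "i < p" for i
    by (rule lookup_basis_map_pow[where T = T]) (fact inj c that assms(3) assms(4))+
  then show ?thesis
    using \<open>j < p\<close> by (simp add: lookup_sum)
qed

text \<open>
  Elements of the same orbit yield the same predicate, hence the same choice.
\<close>

definition transversal :: "'b set \<Rightarrow> 'b set" where
  "transversal A = (\<lambda>b. SOME c. \<exists>i. c = (\<pi> ^^ i) b) ` (B - A)"

lemma transversal:
  assumes A: "A \<subseteq> B" "\<And>b. b \<in> A \<Longrightarrow> \<pi> b \<in> A"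
    and free: "\<And>b i. b \<in> B - A \<Longrightarrow> 0 < i \<Longrightarrow> i < p \<Longrightarrow> (\<pi> ^^ i) b \<noteq> b"
  shows "transversal A \<subseteq> B - A"
    and "\<And>b. b \<in> B - A \<Longrightarrow> \<exists>i<p. \<exists>t\<in>transversal A. b = (\<pi> ^^ i) t"
    and "\<And>i j s t. i < p \<Longrightarrow> j < p \<Longrightarrow> s \<in> transversal A \<Longrightarrow> t \<in> transversal A \<Longrightarrow>
        (\<pi> ^^ i) s = (\<pi> ^^ j) t \<Longrightarrow> i = j \<and> s = t"
proof -
  define rep where "rep b = (SOME c. \<exists>i. c = (\<pi> ^^ i) b)" for b
  have T: "transversal A = rep ` (B - A)"
    by (simp add: transversal_def rep_def)
  have rep: "\<exists>i. rep b = (\<pi> ^^ i) b" for b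
    unfolding rep_def by (rule someI_ex) auto
  have A_pow: "(\<pi> ^^ i) b \<in> A" if "b \<in> A" for b i
    using that A(2) by (induction i) auto
  \<comment> \<open>As \<open>\<pi>\<close> has period \<open>p\<close>, the power
    \<open>p - i mod p\<close> undoes \<open>\<pi> ^^ i\<close>; this makes lying in one orbit a
    symmetric relation.\<close>
  have return: "\<exists>j<p. b = (\<pi> ^^ j) c" if "b \<in> B" "c = (\<pi> ^^ i) b" for b c i
  proof (cases "i mod p = 0")
    case True
    then have "c = b"
      using that \<pi>_pow_mod[of b i] by simp
    then show ?thesis
      using p_pos by (metis funpow_0)
  next
    case False
    then have "(\<pi> ^^ (p - i mod p)) c = b"
      using that \<pi>_pow_mod[of b i] \<pi>_pow_inverse[of b "i mod p"] p_pos by simp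
    then show ?thesis
      using False p_pos by (intro exI[of _ "p - i mod p"]) auto
  qed
  have nA: "(\<pi> ^^ i) b \<in> B - A" if b: "b \<in> B - A" for b i
    using return[of b "(\<pi> ^^ i) b" i] A_pow \<pi>_pow_B b by (metis Diff_iff)
  have rep_in: "rep b \<in> B - A" if "b \<in> B - A" for b
    using rep[of b] nA[OF that] by auto
  then show TBA: "transversal A \<subseteq> B - A"
    unfolding T by blast
  show "\<exists>i<p. \<exists>t\<in>transversal A. b = (\<pi> ^^ i) t" if "b \<in> B - A" for b
    using rep[of b] return[of b "rep b"] that unfolding T by blast
  have rep_pow: "rep ((\<pi> ^^ i) b) = rep b" if b: "b \<in> B" for b i
  proof -
    obtain j where j: "b = (\<pi> ^^ j) ((\<pi> ^^ i) b)"
      using return[OF b refl] by blast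
    have "(\<exists>k. c = (\<pi> ^^ k) ((\<pi> ^^ i) b)) \<longleftrightarrow> (\<exists>k. c = (\<pi> ^^ k) b)" for c
    proof
      assume "\<exists>k. c = (\<pi> ^^ k) ((\<pi> ^^ i) b)"
      then obtain k where "c = (\<pi> ^^ k) ((\<pi> ^^ i) b)" by blast
      then have "c = (\<pi> ^^ (k + i)) b"
        by (simp add: funpow_add)
      then show "\<exists>k. c = (\<pi> ^^ k) b" by blast
    next
      assume "\<exists>k. c = (\<pi> ^^ k) b"
      then obtain k where "c = (\<pi> ^^ k) b" by blast
      then have "c = (\<pi> ^^ (k + j)) ((\<pi> ^^ i) b)"
        using j by (metis comp_apply funpow_add)
      then show "\<exists>k. c = (\<pi> ^^ k) ((\<pi> ^^ i) b)" by blast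
    qed
    then show ?thesis
      by (simp add: rep_def)
  qed
  fix i j s t
  assume ij: "i < p" "j < p" and st: "s \<in> transversal A" "t \<in> transversal A" and eq: "(\<pi> ^^ i) s = (\<pi> ^^ j) t"
  have inB: "s \<in> B - A" "t \<in> B - A"
    using st TBA by auto
  have rep_T: "rep c = c" if c: "c \<in> transversal A" for c
  proof -
    obtain b where b: "b \<in> B" "c = rep b"
      using c unfolding T by blast
    obtain k where "rep b = (\<pi> ^^ k) b"
      using rep by blast
    then show ?thesis
      using rep_pow[OF b(1), of k] b(2) by simp
  qed
  have "rep s = rep t"
    using rep_pow[of s i] rep_pow[of t j] inB eq by simp
  then have "s = t"
    using rep_T[OF st(1)] rep_T[OF st(2)] by simp
  have *: "False" if "k < l" "l < p" "(\<pi> ^^ k) s = (\<pi> ^^ l) s" for k l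
  proof -
    have "(\<pi> ^^ (l - k)) ((\<pi> ^^ k) s) = (\<pi> ^^ (l - k + k)) s"
      by (simp only: funpow_add comp_apply)
    then have "(\<pi> ^^ (l - k)) ((\<pi> ^^ k) s) = (\<pi> ^^ k) s"
      using that by simp
    then show False
      using free[OF nA[OF inB(1)], of "l - k" k] that by (simp add: less_imp_diff_less)
  qed
  have "i = j"
  proof (rule ccontr)
    assume "i \<noteq> j"
    then consider "i < j" | "j < i"
      by linarith
    then show False
      using *[of i j] *[of j i] ij eq \<open>s = t\<close> by cases auto
  qed
  then show "i = j \<and> s = t"
    using \<open>s = t\<close> by simp
qed

lemma supp_mod_induced:
  assumes A: "A \<subseteq> B" "\<And>b. b \<in> A \<Longrightarrow> \<pi> b \<in> A"
    and free: "\<And>b i. b \<in> B - A \<Longrightarrow> 0 < i \<Longrightarrow> i < p \<Longrightarrow> (\<pi> ^^ i) b \<noteq> b"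
    and x: "x \<in> supp B"
  shows "norm_map p (basis_map \<pi>) x \<in> supp_mod B A q \<Longrightarrow>
      \<exists>y\<in>supp B. x - (y - basis_map \<pi> y) \<in> supp_mod B A q"
    and "x - basis_map \<pi> x \<in> supp_mod B A q \<Longrightarrow>
      \<exists>y\<in>supp B. x - norm_map p (basis_map \<pi>) y \<in> supp_mod B A q"
proof -
  note T = transversal[OF A free]
  have TB: "transversal A \<subseteq> B"
    using T(1) by blast
  have R: "basis_map \<pi> x \<in> supp_mod B A q" if x: "x \<in> supp_mod B A q" for x
  proof -
    obtain y where y: "y \<in> supp B" "x - frag_cmul q y \<in> supp A"
      using supp_mod_decomp[OF x A(1)] by blast
    have "basis_map \<pi> (x - frag_cmul q y) \<in> supp_mod B A q"
      using basis_map_supp[OF _ y(2), of \<pi> A] A supp_subset_supp_mod by blast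
    moreover have "frag_cmul q (basis_map \<pi> y) \<in> supp_mod B A q"
      using g_S[OF y(1)] by (simp add: supp_mod_def supp_cmul)
    ultimately have "basis_map \<pi> (x - frag_cmul q y) + frag_cmul q (basis_map \<pi> y) \<in> supp_mod B A q"
      using subgrp_add[OF subgrp_supp_mod] by blast
    then show ?thesis
      by (simp add: basis_map_diff basis_map_cmul)
  qed
  \<comment> \<open>The translates of the transversal are disjoint, so the coefficients of
    \<open>c i\<close> can be read off from those of the sum.\<close>
  have uniq1: "c i \<in> supp_mod B A q"
    if c: "\<And>i. c i \<in> supp (transversal A)" "(\<Sum>i<p. (basis_map \<pi> ^^ i) (c i)) \<in> supp_mod B A q" "i < p" for c i
  proof -
    have "q dvd Poly_Mapping.lookup (c i) b" if "b \<in> B - A" for b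
    proof (cases "b \<in> transversal A")
      case True
      have "(\<pi> ^^ i) b \<in> B - A"
      proof
        show "(\<pi> ^^ i) b \<in> B"
          using that \<pi>_pow_B by simp
        show "(\<pi> ^^ i) b \<notin> A"
        proof
          assume "(\<pi> ^^ i) b \<in> A"
          then have "(\<pi> ^^ k) ((\<pi> ^^ i) b) \<in> A" for k
            by (induction k) (auto simp: A(2))
          then show False
            using \<pi>_pow_inverse[of b i] c(3) that by (metis Diff_iff less_imp_le)
        qed
      qed
      then have "q dvd Poly_Mapping.lookup (\<Sum>i<p. (basis_map \<pi> ^^ i) (c i)) ((\<pi> ^^ i) b)"
        using c(2) by (auto simp: supp_mod_def)
      moreover have "Poly_Mapping.lookup (\<Sum>i<p. (basis_map \<pi> ^^ i) (c i)) ((\<pi> ^^ i) b) = Poly_Mapping.lookup (c i) b"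
        by (rule lookup_sum_basis_map_pow[OF T(3) c(1) c(3) True])
      ultimately show ?thesis
        by simp
    next
      case False
      then show ?thesis
        using lookup_supp[OF c(1)] by simp
    qed
    then show ?thesis
      using c(1) supp_mono[OF TB] by (auto simp: supp_mod_def)
  qed
  have dec: "\<exists>t. (\<forall>i. t i \<in> supp (transversal A)) \<and> x - (\<Sum>i<p. (basis_map \<pi> ^^ i) (t i)) \<in> supp_mod B A q"
    if "x \<in> supp B" for x
    using transversal_decomp[OF TB T(2) that] supp_subset_supp_mod[OF A(1)] by blast
  have uniq: "\<forall>t. (\<forall>i. t i \<in> supp (transversal A)) \<longrightarrow>
      (\<Sum>i<p. (basis_map \<pi> ^^ i) (t i)) \<in> supp_mod B A q \<longrightarrow> (\<forall>i<p. t i \<in> supp_mod B A q)"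
    using uniq1 by blast
  note * = induced_kernels[OF subgrp_supp_mod R subgrp_supp supp_mono[OF TB] dec uniq x]
  show "norm_map p (basis_map \<pi>) x \<in> supp_mod B A q \<Longrightarrow>
      \<exists>y\<in>supp B. x - (y - basis_map \<pi> y) \<in> supp_mod B A q"
    by (rule *(1))
  show "x - basis_map \<pi> x \<in> supp_mod B A q \<Longrightarrow>
      \<exists>y\<in>supp B. x - norm_map p (basis_map \<pi>) y \<in> supp_mod B A q"
    by (rule *(2))
qed

end

section \<open>Augmented singular chains\<close>

text \<open>
  Degree \<open>n + 1\<close> holds the singular \<open>n\<close>-chains, and degree \<open>0\<close> the augmentation
  module, spanned by the formal empty simplex.
\<close>

definition empty_simplex :: "(nat \<Rightarrow> real) \<Rightarrow> 'a" where
  "empty_simplex = (\<lambda>_. undefined)"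

definition sbasis :: "'a topology \<Rightarrow> nat \<Rightarrow> ((nat \<Rightarrow> real) \<Rightarrow> 'a) set" where
  "sbasis X n = (case n of 0 \<Rightarrow> {empty_simplex} | Suc m \<Rightarrow> singular_simplex_set m X)"

definition sd :: "nat \<Rightarrow> 'a chain \<Rightarrow> 'a chain" where
  "sd n c = (case n of 0 \<Rightarrow> 0
     | Suc 0 \<Rightarrow> frag_extend (\<lambda>_. frag_of empty_simplex) c
     | Suc (Suc m) \<Rightarrow> chain_boundary (Suc m) c)"

definition smap :: "('a \<Rightarrow> 'b) \<Rightarrow> nat \<Rightarrow> ((nat \<Rightarrow> real) \<Rightarrow> 'a) \<Rightarrow> ((nat \<Rightarrow> real) \<Rightarrow> 'b)" where
  "smap f n = (case n of 0 \<Rightarrow> (\<lambda>_. empty_simplex) | Suc m \<Rightarrow> simplex_map m f)"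

abbreviation schain :: "'a topology \<Rightarrow> nat \<Rightarrow> 'a chain set" where
  "schain X n \<equiv> supp (sbasis X n)"

lemma sbasis_simps [simp]:
  "sbasis X 0 = {empty_simplex}" "sbasis X (Suc m) = singular_simplex_set m X"
  by (simp_all add: sbasis_def)

lemma sd_simps [simp]:
  "sd 0 c = 0" "sd (Suc 0) c = frag_extend (\<lambda>_. frag_of empty_simplex) c"
  "sd (Suc (Suc m)) c = chain_boundary (Suc m) c"
  by (simp_all add: sd_def)

lemma smap_simps [simp]: "smap f 0 = (\<lambda>_. empty_simplex)" "smap f (Suc m) = simplex_map m f"
  by (simp_all add: smap_def)

lemma schain_Suc [simp]: "c \<in> supp (singular_simplex_set m X) \<longleftrightarrow> singular_chain m X c"
  by (simp add: supp_def singular_chain_def)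

interpretation sing: differential sd
proof
  show "sd n (x - y) = sd n x - sd n y" for n and x y :: "'a chain"
    by (auto simp: sd_def frag_extend_diff chain_boundary_diff split: nat.split)
qed simp

lemma sd_cmul: "sd n (frag_cmul k c) = frag_cmul k (sd n c)"
  by (auto simp: sd_def frag_extend_cmul chain_boundary_cmul split: nat.split)

lemma basis_map_simplex_map: "basis_map (simplex_map m f) = chain_map m f"
  by (simp add: fun_eq_iff basis_map_def chain_map_def)

lemma sd_basis_map:
  assumes "c \<in> schain X n"
  shows "sd n (basis_map (smap f n) c) = basis_map (smap f (n - 1)) (sd n c)"
proof (cases n)
  case (Suc m)
  show ?thesis
  proof (cases m)
    case 0
    have "frag_extend (\<lambda>_. frag_of empty_simplex) (basis_map (simplex_map 0 f) c) =
        basis_map (\<lambda>_. empty_simplex) (frag_extend (\<lambda>_. frag_of empty_simplex) c)"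
      using subset_UNIV
      by (induction c rule: frag_induction) (simp_all add: basis_map_diff frag_extend_diff)
    then show ?thesis
      using Suc 0 by simp
  next
    case (Suc k)
    then show ?thesis
      using assms \<open>n = Suc m\<close> chain_boundary_chain_map[of m X c f]
      by (simp add: basis_map_simplex_map schain_Suc)
  qed
qed simp

lemma subcomplex_schain: "sing.subcomplex (schain X)"
  unfolding sing.subcomplex_def
proof (intro conjI allI ballI)
  fix n and c :: "'a chain" assume c: "c \<in> schain X n"
  show "sd n c \<in> schain X (n - 1)"
  proof (cases n)
    case (Suc m)
    show ?thesis
    proof (cases m)
      case 0
      have "Poly_Mapping.keys (frag_extend (\<lambda>_. frag_of empty_simplex) c) \<subseteq> {empty_simplex}"
        using keys_frag_extend[of "\<lambda>_. frag_of empty_simplex" c] by (rule order_trans) auto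
      then show ?thesis
        using Suc 0 by (simp add: supp_def)
    next
      case (Suc k)
      then show ?thesis
        using c \<open>n = Suc m\<close> singular_chain_boundary[of m X c] by (simp add: schain_Suc)
    qed
  qed (simp add: subgrp_0 subgrp_supp)
  show "sd (n - 1) (sd n c) = 0"
  proof (cases n)
    case (Suc m)
    show ?thesis
    proof (cases m)
      case (Suc k)
      show ?thesis
      proof (cases k)
        case 0
        have "frag_extend (\<lambda>_. frag_of empty_simplex) (chain_boundary (Suc 0) c) = 0"
          using subset_UNIV
          by (induction c rule: frag_induction)
            (simp_all add: chain_boundary_of frag_extend_add frag_extend_cmul frag_extend_minus
              chain_boundary_diff frag_extend_diff)
        then show ?thesis
          using \<open>n = Suc m\<close> \<open>m = Suc k\<close> 0 by simp
      next
        case (Suc j)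
        then show ?thesis
          using c \<open>n = Suc m\<close> \<open>m = Suc k\<close> chain_boundary_boundary[of "Suc k" X c] by (simp add: schain_Suc)
      qed
    qed (simp add: Suc)
  qed simp
qed (simp add: subgrp_supp)

text \<open>The empty simplex belongs to every subspace, even to the empty one, so the relative
  complexes vanish in degree 0.\<close>

lemma sbasis_subtopology:
  "c \<in> sbasis (subtopology X Y) n \<longleftrightarrow>
     c \<in> sbasis X n \<and> (n > 0 \<longrightarrow> (\<forall>t\<in>standard_simplex (n - 1). c t \<in> Y))"
  by (cases n) (auto simp: singular_simplex_subtopology image_subset_iff)

lemma sbasis_mono: "Y \<subseteq> Z \<Longrightarrow> sbasis (subtopology X Y) n \<subseteq> sbasis (subtopology X Z) n"
  unfolding subset_iff sbasis_subtopology by blast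

lemma smap_sbasis:
  assumes "continuous_map X Y f"
  shows "smap f n ` sbasis X n \<subseteq> sbasis Y n"
  using assms by (cases n) (auto intro: singular_simplex_simplex_map)

text \<open>For the chains subordinate to a cover by two sets.\<close>

lemma subcomplex_supp_Un:
  assumes A: "sing.subcomplex (\<lambda>n. supp (A n))" and B: "sing.subcomplex (\<lambda>n. supp (B n))"
  shows "sing.subcomplex (\<lambda>n. supp (A n \<union> B n))"
proof -
  have split: "\<exists>a\<in>supp (A n). \<exists>b\<in>supp (B n). c = a + b" if c: "c \<in> supp (A n \<union> B n)" for c n
  proof -
    obtain a b where "Poly_Mapping.keys a \<subseteq> A n" "Poly_Mapping.keys b \<subseteq> B n" "a + b = c"
      using frag_split[of c "A n" "B n"] c by (auto simp: supp_def)
    then show ?thesis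
      by (auto simp: supp_def)
  qed
  have mono: "supp (A n) \<subseteq> supp (A n \<union> B n)" "supp (B n) \<subseteq> supp (A n \<union> B n)" for n
    by (simp_all add: supp_mono)
  show ?thesis
    unfolding sing.subcomplex_def
  proof (intro conjI allI ballI subgrp_supp)
    fix n c assume "c \<in> supp (A n \<union> B n)"
    then obtain a b where ab: "a \<in> supp (A n)" "b \<in> supp (B n)" "c = a + b"
      using split by blast
    have "sd n a \<in> supp (A (n - 1) \<union> B (n - 1))" "sd n b \<in> supp (A (n - 1) \<union> B (n - 1))"
      using sing.subcomplexD(2)[OF A ab(1)] sing.subcomplexD(2)[OF B ab(2)] mono by blast+
    then show "sd n c \<in> supp (A (n - 1) \<union> B (n - 1))"
      using subgrp_add[OF subgrp_supp] ab(3) by (simp add: sing.d_add)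
    show "sd (n - 1) (sd n c) = 0"
      using sing.subcomplexD(3)[OF A ab(1)] sing.subcomplexD(3)[OF B ab(2)] ab(3)
      by (simp add: sing.d_add)
  qed
qed

text \<open>Bezout writes 1 as a combination of \<open>i\<close> and \<open>p\<close>, and both are
  periods of \<open>x\<close>.\<close>

lemma funpow_fixed_prime:
  assumes "prime (p::nat)" "(g ^^ p) x = x" "(g ^^ i) x = x" "0 < i" "i < p"
  shows "g x = x"
proof -
  have iter: "(g ^^ (k * a)) x = x" if "(g ^^ k) x = x" for k a
    using that by (induction a) (simp_all add: funpow_add)
  have "coprime i p"
    using assms by (metis coprime_commute nat_dvd_not_less prime_imp_coprime)
  then obtain a b where "i * a = p * b + 1"
    using bezout_nat[of i p] assms(4) by auto
  then have "(g ^^ (i * a)) x = g ((g ^^ (p * b)) x)"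
    by simp
  then show ?thesis
    using iter assms by simp
qed

section \<open>Spaces with a map of prime period\<close>

locale cyclic_space =
  fixes p :: nat and g :: "'a \<Rightarrow> 'a" and X :: "'a topology"
  assumes prime_p: "prime p"
    and cont_g: "continuous_map X X g"
    and g_pow_p: "x \<in> topspace X \<Longrightarrow> (g ^^ p) x = x"
begin

definition Fix :: "'a set" where
  "Fix = {x \<in> topspace X. g x = x}"

abbreviation ch :: "'a set \<Rightarrow> nat \<Rightarrow> 'a chain set" where
  "ch Y \<equiv> schain (subtopology X Y)"

lemma smap_pow: "f \<in> sbasis X (Suc m) \<Longrightarrow> (smap g (Suc m) ^^ i) f = simplex_map m (g ^^ i) f"
proof (induction i)
  case 0
  then show ?case
    by (simp add: simplex_map_id[unfolded id_def] singular_simplex_def extensional_restrict)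
next
  case (Suc i)
  then show ?case
    using fun_cong[OF simplex_map_compose[of m g "g ^^ i"], of f] by (simp add: comp_def)
qed

lemma smap_pow_0: "(smap g 0 ^^ i) empty_simplex = empty_simplex"
  by (induction i) simp_all

sublocale pm: permutation_module p "smap g n" "sbasis X n" for n
proof
  show "smap g n b \<in> sbasis X n" if "b \<in> sbasis X n" for b
    using smap_sbasis[OF cont_g, of n] that by blast
  show "(smap g n ^^ p) b = b" if b: "b \<in> sbasis X n" for b
  proof (cases n)
    case 0
    then show ?thesis
      using b smap_pow_0 by simp
  next
    case (Suc m)
    then show ?thesis
      using b g_pow_p simplex_map_id_gen[of m X b "g ^^ p"] smap_pow[of b m p] by simp
  qed
  show "p > 0"
    using prime_p prime_gt_0_nat by blast
qed

text \<open>Composition with \<open>g\<close> leaves the points of the standard simplex in place.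
  Hence a simplex fixed by \<open>g ^^ i\<close> takes values fixed by \<open>g ^^ i\<close>, and
  these are fixed by \<open>g\<close>. All other simplices have free orbits, which makes the chains
  modulo those of \<open>Fix\<close> induced.\<close>

lemma smap_fixed:
  assumes "b \<in> sbasis X n" "(smap g n ^^ i) b = b" "0 < i" "i < p"
  shows "b \<in> sbasis (subtopology X Fix) n"
proof (cases n)
  case (Suc m)
  have "b t \<in> Fix" if t: "t \<in> standard_simplex m" for t
  proof -
    have "simplex_map m (g ^^ i) b = b"
      using assms(1,2) Suc smap_pow[of b m i] by simp
    then have "simplex_map m (g ^^ i) b t = b t"
      by simp
    then have "(g ^^ i) (b t) = b t"
      using t by (simp add: simplex_map_def)
    moreover have "b t \<in> topspace X"
      using assms(1) Suc t by (auto simp: singular_simplex_def continuous_map_def Pi_iff)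
    ultimately show ?thesis
      using funpow_fixed_prime[OF prime_p g_pow_p _ assms(3,4)] by (simp add: Fix_def)
  qed
  then show ?thesis
    using assms(1) Suc by (auto simp: singular_simplex_subtopology)
qed (use assms in simp)

sublocale smith_complex sd "\<lambda>n. norm_map p (basis_map (smap g n))" "\<lambda>n x. x - basis_map (smap g n) x" "schain X"
proof
  show "sing.subcomplex (schain X)"
    by (rule subcomplex_schain)
  fix n and x y :: "'a chain"
  show "norm_map p (basis_map (smap g n)) (x - y) =
      norm_map p (basis_map (smap g n)) x - norm_map p (basis_map (smap g n)) y"
    by (rule pm.norm_map_diff)
  show "x - y - basis_map (smap g n) (x - y) = x - basis_map (smap g n) x - (y - basis_map (smap g n) y)"
    by (simp add: basis_map_diff)
  assume x: "x \<in> schain X n"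
  have "sd n ((basis_map (smap g n) ^^ i) x) = (basis_map (smap g (n - 1)) ^^ i) (sd n x)" for i
  proof (induction i)
    case (Suc i)
    have "(basis_map (smap g n) ^^ i) x \<in> schain X n"
      using pm.gp_closed[of "schain X n"] pm.g_S x by blast
    from sd_basis_map[OF this] Suc show ?case
      by simp
  qed simp
  moreover have "sd n (sum f I) = (\<Sum>i\<in>I. sd n (f i))" for I and f :: "nat \<Rightarrow> 'a chain"
    by (induction I rule: infinite_finite_induct) (simp_all add: sing.d_add)
  ultimately show "sd n (norm_map p (basis_map (smap g n)) x) = norm_map p (basis_map (smap g (n - 1))) (sd n x)"
    by (simp add: norm_map_def)
  show "sd n (x - basis_map (smap g n) x) = sd n x - basis_map (smap g (n - 1)) (sd n x)"
    using sd_basis_map[OF x] by (simp add: sing.d_diff)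
  show "norm_map p (basis_map (smap g n)) x \<in> schain X n"
    using pm.norm_map_closed[OF subgrp_supp pm.g_S x] .
  show "x - basis_map (smap g n) x \<in> schain X n"
    using subgrp_diff[OF subgrp_supp x pm.g_S[OF x]] .
  show "norm_map p (basis_map (smap g n)) (x - basis_map (smap g n) x) = 0"
    using pm.norm_map_shift[OF x] by (simp add: pm.norm_map_diff)
  show "norm_map p (basis_map (smap g n)) x - basis_map (smap g n) (norm_map p (basis_map (smap g n)) x) = 0"
    using pm.norm_map_shift[OF x] by simp
qed

lemma stable_supp:
  assumes sub: "sing.subcomplex (\<lambda>n. supp (B n))" and B: "\<And>n. B n \<subseteq> sbasis X n"
    and inv: "\<And>n. smap g n ` B n \<subseteq> B n"
  shows "stable (\<lambda>n. supp (B n))"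
proof -
  have *: "basis_map (smap g n) x \<in> supp (B n)" if "x \<in> supp (B n)" for x n
    using basis_map_supp[OF inv that] .
  have "norm_map p (basis_map (smap g n)) x \<in> supp (B n)" "x - basis_map (smap g n) x \<in> supp (B n)"
    if "x \<in> supp (B n)" for x n
    using pm.norm_map_closed[OF subgrp_supp * that] subgrp_diff[OF subgrp_supp that *[OF that]] by blast+
  then show ?thesis
    unfolding stable_def using sub supp_mono[OF B] by (auto simp: image_subset_iff)
qed

lemma smap_inv:
  assumes "g ` Y \<subseteq> Y"
  shows "smap g n ` sbasis (subtopology X Y) n \<subseteq> sbasis (subtopology X Y) n"
  using assms cont_g
  by (intro smap_sbasis) (auto simp: continuous_map_in_subtopology continuous_map_from_subtopology)

lemma stable_ch: "g ` Y \<subseteq> Y \<Longrightarrow> stable (ch Y)"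
  by (intro stable_supp subcomplex_schain smap_inv) (auto simp: sbasis_subtopology)

lemma induced_quotient_supp:
  assumes B: "stable (\<lambda>n. supp (B n))" and A: "stable (\<lambda>n. supp_mod (B n) (A n) q)"
    and AB: "\<And>n. A n \<subseteq> B n" and BX: "\<And>n. B n \<subseteq> sbasis X n"
    and invB: "\<And>n. smap g n ` B n \<subseteq> B n" and invA: "\<And>n. smap g n ` A n \<subseteq> A n"
    and F: "\<And>n. sbasis (subtopology X Fix) n \<inter> B n \<subseteq> A n"
  shows "induced_quotient (\<lambda>n. supp (B n)) (\<lambda>n. supp_mod (B n) (A n) q)"
proof -
  have pm: "permutation_module p (smap g n) (B n)" for n
    using invB BX pm.p_pos pm.\<pi>_pow_p by unfold_locales blast+
  have free: "(smap g n ^^ i) b \<noteq> b" if "b \<in> B n - A n" "0 < i" "i < p" for b n i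
    using smap_fixed[of b n i] that BX F by blast
  have *: "norm_map p (basis_map (smap g n)) x \<in> supp_mod (B n) (A n) q \<Longrightarrow>
      \<exists>y\<in>supp (B n). x - (y - basis_map (smap g n) y) \<in> supp_mod (B n) (A n) q"
    "x - basis_map (smap g n) x \<in> supp_mod (B n) (A n) q \<Longrightarrow>
      \<exists>y\<in>supp (B n). x - norm_map p (basis_map (smap g n)) y \<in> supp_mod (B n) (A n) q"
    if "x \<in> supp (B n)" for x n
    using permutation_module.supp_mod_induced[OF pm[of n] AB[of n] _ free[of _ n] that] invA by blast+
  show ?thesis
    unfolding induced_quotient_def
    using * A B by (auto simp: supp_mod_def)
qed

lemma induced_quotient_supp0:
  assumes "stable (\<lambda>n. supp (B n))" "stable (\<lambda>n. supp (A n))"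
    and "\<And>n. A n \<subseteq> B n" "\<And>n. B n \<subseteq> sbasis X n"
    and "\<And>n. smap g n ` B n \<subseteq> B n" "\<And>n. smap g n ` A n \<subseteq> A n"
    and "\<And>n. sbasis (subtopology X Fix) n \<inter> B n \<subseteq> A n"
  shows "induced_quotient (\<lambda>n. supp (B n)) (\<lambda>n. supp (A n))"
  using induced_quotient_supp[of B A 0] assms by (simp add: supp_mod_0)

lemma induced_quotient_ch:
  assumes "g ` Y \<subseteq> Y" "g ` Z \<subseteq> Z" "Z \<subseteq> Y" "Fix \<inter> Y \<subseteq> Z"
  shows "induced_quotient (ch Y) (ch Z)"
proof (rule induced_quotient_supp0)
  show "sbasis (subtopology X Fix) n \<inter> sbasis (subtopology X Y) n \<subseteq> sbasis (subtopology X Z) n" for n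
    using assms(4) unfolding subset_iff Int_iff sbasis_subtopology by blast
  show "sbasis (subtopology X Y) n \<subseteq> sbasis X n" for n
    by (auto simp: sbasis_subtopology)
qed (use assms stable_ch smap_inv sbasis_mono in \<open>simp_all\<close>)

end

section \<open>Injective basis maps, relative homology and excision\<close>

lemma basis_map_surj:
  assumes "B \<subseteq> \<pi> ` T" "y \<in> supp B"
  shows "\<exists>c\<in>supp T. y = basis_map \<pi> c"
  using assms(2) unfolding supp_def[of B] mem_Collect_eq
proof (induction y rule: frag_induction)
  case zero
  then show ?case
    using subgrp_0[OF subgrp_supp] by (intro bexI[of _ 0]) auto
next
  case (one b)
  then obtain t where "t \<in> T" "b = \<pi> t"
    using assms(1) by blast
  then show ?case
    by (intro bexI[of _ "frag_of t"]) auto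
next
  case (diff a b)
  then obtain c d where "c \<in> supp T" "d \<in> supp T" "a = basis_map \<pi> c" "b = basis_map \<pi> d"
    by blast
  then show ?case
    using subgrp_diff[OF subgrp_supp] by (intro bexI[of _ "c - d"]) (auto simp: basis_map_diff)
qed

lemma lookup_basis_map_inj:
  assumes inj: "inj_on \<pi> T" and c: "c \<in> supp T" and t: "t \<in> T"
  shows "Poly_Mapping.lookup (basis_map \<pi> c) (\<pi> t) = Poly_Mapping.lookup c t"
  using c unfolding supp_def mem_Collect_eq
proof (induction c rule: frag_induction)
  case (one b)
  then show ?case
    using inj t by (auto dest: inj_onD)
qed (auto simp: basis_map_diff lookup_minus)

text \<open>With \<open>B = {}\<close> this gives the injectivity of \<open>basis_map\<close> on
  \<open>supp T\<close>.\<close>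

lemma basis_map_supp_inj:
  assumes "inj_on \<pi> T" "c \<in> supp T" "basis_map \<pi> c \<in> supp B"
  shows "c \<in> supp {t \<in> T. \<pi> t \<in> B}"
proof (rule suppI)
  fix b assume b: "b \<notin> {t \<in> T. \<pi> t \<in> B}"
  show "Poly_Mapping.lookup c b = 0"
  proof (cases "b \<in> T")
    case True
    then show ?thesis
      using b lookup_basis_map_inj[OF assms(1,2) True] lookup_supp[OF assms(3)] by auto
  next
    case False
    then show ?thesis
      using lookup_supp[OF assms(2)] by simp
  qed
qed

lemma supp_Un_decomp:
  assumes "c \<in> supp (A \<union> B)"
  obtains a b where "a \<in> supp A" "b \<in> supp B" "c = a + b"
proof -
  obtain a b where "Poly_Mapping.keys a \<subseteq> A" "Poly_Mapping.keys b \<subseteq> B" "a + b = c"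
    using frag_split[of c A B] assms by (auto simp: supp_def)
  then show thesis
    using that by (auto simp: supp_def)
qed

text \<open>Chain degree \<open>Suc p\<close> is homological degree \<open>p\<close>, because degree
  0 is taken by the augmentation module; the latter cancels in the relative complex.\<close>

lemma acyc_relative_homology:
  assumes "trivial_group (relative_homology_group (int p) X Y)"
  shows "sing.acyc (schain X) (schain (subtopology X Y)) (Suc p)"
  unfolding sing.acyc_def
proof (intro ballI impI)
  fix x assume x: "x \<in> schain X (Suc p)" "sd (Suc p) x \<in> schain (subtopology X Y) (Suc p - 1)"
  have "singular_relcycle p X Y x"
    using x by (cases p) (auto simp: singular_relcycle chain_boundary_def)
  then have "homologous_rel_set p X Y x \<in> carrier (relative_homology_group (int p) X Y)"
    by (auto simp: carrier_relative_homology_group)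
  then have "homologous_rel_set p X Y x = singular_relboundary_set p X Y"
    using assms by (simp add: trivial_group_def)
  then have "singular_relboundary p X Y x"
    using homologous_rel_set_eq_relboundary by blast
  then obtain y e where "singular_chain (Suc p) X y" "singular_chain p (subtopology X Y) e"
      "chain_boundary (Suc p) y = x + e"
    by (auto simp: singular_relboundary_alt)
  moreover from this have "x - chain_boundary (Suc p) y = - e"
    by simp
  ultimately show "\<exists>y\<in>schain X (Suc (Suc p)). x - sd (Suc (Suc p)) y \<in> schain (subtopology X Y) (Suc p)"
    by (intro bexI[of _ y]) (simp_all add: singular_chain_minus)
qed

lemma acyc_relative_homology_all:
  assumes "\<And>k. trivial_group (relative_homology_group k X Y)"
  shows "sing.acyc (schain X) (schain (subtopology X Y)) n"
proof (cases n)
  case 0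
  then show ?thesis
    by (auto simp: sing.acyc_def intro!: bexI[of _ 0])
next
  case (Suc p)
  then show ?thesis
    using acyc_relative_homology assms by blast
qed

text \<open>Iterated subdivision makes a chain small with respect to \<open>U\<close> and
  \<open>V\<close>. It is chain homotopic to the identity by a homotopy that is available for all
  spaces at once and so preserves the chains of \<open>U\<close> and those of
  \<open>V\<close>.\<close>

lemma acyc_excision:
  assumes U: "openin X U" and V: "openin X V" and UV: "topspace X \<subseteq> U \<union> V"
  shows "sing.acyc (schain X) (\<lambda>n. supp (sbasis (subtopology X U) n \<union> sbasis (subtopology X V) n)) n"
    (is "sing.acyc _ ?R n")
proof (cases n)
  case 0
  then show ?thesis
    by (auto simp: sing.acyc_def intro!: bexI[of _ 0])
next
  case (Suc p)
  show ?thesis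
    unfolding sing.acyc_def
  proof (intro ballI impI)
    fix x assume x: "x \<in> schain X n" "sd n x \<in> ?R (n - 1)"
    then have sx: "singular_chain p X x"
      using Suc by simp
    obtain N where N: "\<And>m f. \<lbrakk>N \<le> m; f \<in> Poly_Mapping.keys ((singular_subdivision p ^^ m) x)\<rbrakk>
                      \<Longrightarrow> \<exists>V \<in> {U, V}. f \<in> (standard_simplex p) \<rightarrow> V"
      using sufficient_iterated_singular_subdivision_exists[of "{U, V}" X p x] U V UV sx by auto
    obtain h :: "nat \<Rightarrow> 'a chain \<Rightarrow> 'a chain" where h0: "\<And>p. h p 0 = 0"
      and hdiff: "\<And>p c1 c2. h p (c1 - c2) = h p c1 - h p c2"
      and hchain: "\<And>p X c. singular_chain p X c \<Longrightarrow> singular_chain (Suc p) X (h p c)"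
      and hom: "\<And>p X c. singular_chain p X c
                 \<Longrightarrow> chain_boundary (Suc p) (h p c) + h (p - Suc 0) (chain_boundary p c)
                   = (singular_subdivision p ^^ N) c - c"
      using chain_homotopic_iterated_singular_subdivision[of N] by metis
    have hadd: "h p (a + b) = h p a + h p b" for p a b
      using hdiff[of p a "- b"] hdiff[of p 0 b] h0 by simp
    define s where "s = (singular_subdivision p ^^ N) x"
    have "singular_chain p X ((singular_subdivision p ^^ k) x)" for k
      by (induction k) (auto simp: sx singular_chain_singular_subdivision)
    then have "Poly_Mapping.keys s \<subseteq> singular_simplex_set p X"
      by (simp add: s_def singular_chain_def)
    then have s: "s \<in> ?R n"
      using N[OF order_refl] Suc
      by (force simp: supp_def s_def singular_simplex_subtopology image_subset_iff)
    have hd: "h (p - Suc 0) (chain_boundary p x) \<in> ?R n"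
    proof (cases p)
      case 0
      then show ?thesis
        by (simp add: chain_boundary_def h0 subgrp_0 subgrp_supp)
    next
      case (Suc k)
      have "chain_boundary p x \<in> ?R (Suc k)"
        using x(2) \<open>n = Suc p\<close> Suc by simp
      then obtain a b where ab: "a \<in> supp (sbasis (subtopology X U) (Suc k))"
        "b \<in> supp (sbasis (subtopology X V) (Suc k))" "chain_boundary p x = a + b"
        using supp_Un_decomp by blast
      have "h k a \<in> supp (sbasis (subtopology X U) n)" "h k b \<in> supp (sbasis (subtopology X V) n)"
        using ab(1,2) hchain \<open>n = Suc p\<close> Suc by simp_all
      then have "h k a \<in> ?R n" "h k b \<in> ?R n"
        by (auto simp: supp_def)
      then show ?thesis
        using ab(3) hadd Suc subgrp_add[OF subgrp_supp] by auto
    qed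
    have "x - sd (Suc n) (- h p x) = s - h (p - Suc 0) (chain_boundary p x)"
      using hom[OF sx] \<open>n = Suc p\<close> by (simp add: s_def chain_boundary_minus algebra_simps)
    then have "x - sd (Suc n) (- h p x) \<in> ?R n"
      using subgrp_diff[OF subgrp_supp s hd] by simp
    moreover have "- h p x \<in> schain X (Suc n)"
      using hchain[OF sx] Suc by (simp add: singular_chain_minus)
    ultimately show "\<exists>y\<in>schain X (Suc n). x - sd (Suc n) y \<in> ?R n"
      by blast
  qed
qed

context cyclic_space
begin

text \<open>\<open>coinv\<close> of the zero complex is the kernel of the norm.\<close>

lemma smith_theorem:
  assumes ac: "\<And>n. acyc (schain X) (\<lambda>_. {0}) n"
    and N: "\<And>n. n \<ge> N \<Longrightarrow> acyc (schain X) (ch Fix) n"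
      "\<And>n. n \<ge> N \<Longrightarrow> acyc (schain X) (coinv (ch Fix)) n"
  shows "acyc (schain X) (coinv (\<lambda>_. {0})) n"
proof -
  have gFix: "g ` Fix \<subseteq> Fix"
    by (auto simp: Fix_def)
  have Fix_id: "smap g n b = b" if "b \<in> sbasis (subtopology X Fix) n" for b n
  proof (cases n)
    case (Suc m)
    then have "singular_simplex m (subtopology X Fix) b"
      using that by simp
    then have "simplex_map m g b = b"
      by (rule simplex_map_id_gen) (simp add: Fix_def)
    then show ?thesis
      using Suc by simp
  qed (use that in simp)
  have Fix_id': "basis_map (smap g n) x = x" if "x \<in> ch Fix n" for x n
    using basis_map_pow_id[of "sbasis (subtopology X Fix) n" 1 "smap g n" x] Fix_id that by simp
  have sub: "sbasis (subtopology X Fix) n \<subseteq> sbasis X n" for n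
    by (auto simp: sbasis_subtopology)
  have cmul_sum: "(\<Sum>i<k. x) = frag_cmul (int k) x" for k and x :: "'a chain"
    by (induction k) (simp_all add: frag_cmul_distrib)
  interpret smith_complex_mult sd "\<lambda>n. norm_map p (basis_map (smap g n))" "\<lambda>n x. x - basis_map (smap g n) x"
    "schain X" "frag_cmul (int p)" "ch Fix"
  proof
    fix x y :: "'a chain" and n
    show "frag_cmul (int p) (x - y) = frag_cmul (int p) x - frag_cmul (int p) y"
      by (intro poly_mapping_eqI) (simp add: lookup_minus algebra_simps)
    show "sd n (frag_cmul (int p) x) = frag_cmul (int p) (sd n x)"
      by (rule sd_cmul)
    show "norm_map p (basis_map (smap g n)) (frag_cmul (int p) x) = frag_cmul (int p) (norm_map p (basis_map (smap g n)) x)"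
      by (simp add: norm_map_def basis_map_pow_cmul frag_cmul_sum)
    show "frag_cmul (int p) x - basis_map (smap g n) (frag_cmul (int p) x) =
        frag_cmul (int p) (x - basis_map (smap g n) x)"
      by (simp add: basis_map_cmul) (intro poly_mapping_eqI, simp add: lookup_minus algebra_simps)
    show "frag_cmul (int p) x \<in> A" if "subgrp A" "x \<in> A" for A
      unfolding cmul_sum[symmetric] using that by (intro subgrp_sum)
    show "x = 0" if "frag_cmul (int p) x = 0"
      using that pm.p_pos by simp
    show "norm_map p (basis_map (smap g n)) (norm_map p (basis_map (smap g n)) x) =
        frag_cmul (int p) (norm_map p (basis_map (smap g n)) x)" if "x \<in> schain X n"
    proof -
      have "norm_map p (basis_map (smap g n)) ((basis_map (smap g n) ^^ i) x) =
          norm_map p (basis_map (smap g n)) x" for i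
        using pm.norm_map_gp[OF that] .
      then show ?thesis
        by (subst (2) norm_map_def) (simp only: pm.norm_map_sum cmul_sum)
    qed
    show "stable (ch Fix)"
      using stable_ch gFix .
    show "norm_map p (basis_map (smap g n)) x = frag_cmul (int p) x" if "x \<in> ch Fix n"
    proof -
      have "(basis_map (smap g n) ^^ i) x = x" for i
        by (induction i) (simp_all add: Fix_id' that)
      then show ?thesis
        by (simp add: norm_map_def cmul_sum)
    qed
    show "x - basis_map (smap g n) x = 0" if "x \<in> ch Fix n"
      using Fix_id'[OF that] by simp
    show "x \<in> ch Fix n" if "x \<in> schain X n" "frag_cmul (int p) x \<in> ch Fix n"
      using that(2) pm.p_pos by (auto simp: supp_def subset_iff)
  qed
  \<comment> \<open>Turns \<open>M + pS\<close> into a condition on coefficients, the form in which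
    \<open>induced_quotient_supp\<close> applies.\<close>
  have pext_eq: "pext (ch Fix) = (\<lambda>n. supp_mod (sbasis X n) (sbasis (subtopology X Fix) n) (int p))"
  proof (intro ext equalityI subsetI)
    fix n x assume "x \<in> pext (ch Fix) n"
    then obtain y where y: "x \<in> schain X n" "x - frag_cmul (int p) y \<in> ch Fix n"
      by (auto simp: pext_def)
    have "int p dvd Poly_Mapping.lookup x b" if "b \<notin> sbasis (subtopology X Fix) n" for b
      using lookup_supp[OF y(2) that] by (simp add: lookup_minus)
    then show "x \<in> supp_mod (sbasis X n) (sbasis (subtopology X Fix) n) (int p)"
      using y(1) by (simp add: supp_mod_def)
  next
    fix n x assume "x \<in> supp_mod (sbasis X n) (sbasis (subtopology X Fix) n) (int p)"
    then show "x \<in> pext (ch Fix) n"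
      using supp_mod_decomp[OF _ sub, of x n "int p"] by (auto simp: pext_def supp_mod_def)
  qed
  have "induced_quotient (schain X) (pext (ch Fix))"
    unfolding pext_eq
  proof (rule induced_quotient_supp)
    show "stable (\<lambda>n. supp_mod (sbasis X n) (sbasis (subtopology X Fix) n) (int p))"
      using stable_pext[OF M] by (simp only: pext_eq)
    show "smap g n ` sbasis X n \<subseteq> sbasis X n" for n
      using smap_sbasis[OF cont_g] .
  qed (use stable_S sub gFix smap_inv in auto)
  moreover have "induced_quotient (schain X) (ch Fix)"
    using induced_quotient_ch[of "topspace X" Fix] gFix cont_g
    by (auto simp: Fix_def continuous_map_def)
  ultimately show ?thesis
    using acyc_coinv_zero[of N] ac N by blast
qed

end

section \<open>Chains of the quotient\<close>

locale orbit_map = cyclic_space p g X for p and g :: "'a \<Rightarrow> 'a" and X :: "'a topology" +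
  fixes Q :: "'b topology" and q :: "'a \<Rightarrow> 'b"
  assumes cont_q: "continuous_map X Q q"
    and q_g: "x \<in> topspace X \<Longrightarrow> q (g x) = q x"
begin

abbreviation qch :: "'b set \<Rightarrow> nat \<Rightarrow> 'b chain set" where
  "qch Z \<equiv> schain (subtopology Q Z)"

sublocale cm: chain_morphism sd sd "\<lambda>n. basis_map (smap q n)"
  by unfold_locales (simp add: basis_map_diff)

lemma q_chain: "x \<in> schain X n \<Longrightarrow> sd n (basis_map (smap q n) x) = basis_map (smap q (n - 1)) (sd n x)"
  by (rule sd_basis_map)

lemma smap_q_g: "b \<in> sbasis X n \<Longrightarrow> smap q n (smap g n b) = smap q n b"
proof (cases n)
  case (Suc m)
  assume "b \<in> sbasis X n"
  then have "singular_simplex m X b"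
    using Suc by simp
  then have "simplex_map m (q \<circ> g) b = simplex_map m q b"
    by (rule simplex_map_eq) (simp add: q_g)
  then show ?thesis
    using Suc by (simp add: simplex_map_compose)
qed simp

lemma q_basis_g:
  assumes "x \<in> schain X n"
  shows "basis_map (smap q n) (basis_map (smap g n) x) = basis_map (smap q n) x"
  using assms unfolding supp_def mem_Collect_eq
  by (induction x rule: frag_induction) (simp_all add: smap_q_g basis_map_diff)

lemma q_basis_gp:
  assumes "x \<in> schain X n"
  shows "basis_map (smap q n) ((basis_map (smap g n) ^^ i) x) = basis_map (smap q n) x"
proof (induction i)
  case (Suc i)
  have "(basis_map (smap g n) ^^ i) x \<in> schain X n"
    using pm.gp_closed[of "schain X n"] pm.g_S assms by blast
  then show ?case
    using Suc q_basis_g by simp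
qed simp

lemma q_sum: "basis_map (smap q n) (sum f I) = (\<Sum>i\<in>I. basis_map (smap q n) (f i))"
  by (induction I rule: infinite_finite_induct) (simp_all add: cm.f_add)

lemma q_image:
  assumes "q ` Y \<subseteq> Z" "x \<in> ch Y n"
  shows "basis_map (smap q n) x \<in> qch Z n"
proof -
  have "continuous_map (subtopology X Y) (subtopology Q Z) q"
    using cont_q assms(1) by (auto simp: continuous_map_in_subtopology continuous_map_from_subtopology)
  from basis_map_supp[OF smap_sbasis[OF this] assms(2)] show ?thesis .
qed

lemma homeo_sbasis:
  assumes "homeomorphic_map (subtopology X e) (subtopology Q Z) q"
  shows "smap q n ` sbasis (subtopology X e) n = sbasis (subtopology Q Z) n"
    and "inj_on (smap q n) (sbasis (subtopology X e) n)"
proof -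
  obtain r where r: "homeomorphic_maps (subtopology X e) (subtopology Q Z) q r"
    using assms homeomorphic_map_maps by blast
  then have cq: "continuous_map (subtopology X e) (subtopology Q Z) q"
    and cr: "continuous_map (subtopology Q Z) (subtopology X e) r"
    and rq: "\<And>x. x \<in> topspace (subtopology X e) \<Longrightarrow> r (q x) = x"
    and qr: "\<And>y. y \<in> topspace (subtopology Q Z) \<Longrightarrow> q (r y) = y"
    unfolding homeomorphic_maps_def by blast+
  have left: "smap r n (smap q n b) = b" if "b \<in> sbasis (subtopology X e) n" for b
  proof (cases n)
    case (Suc m)
    then have "singular_simplex m (subtopology X e) b"
      using that by simp
    then have "simplex_map m (r \<circ> q) b = b"
      by (rule simplex_map_id_gen) (simp only: comp_apply rq)
    then show ?thesis
      using Suc by (simp add: simplex_map_compose)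
  qed (use that in simp)
  have right: "smap q n (smap r n b) = b" if "b \<in> sbasis (subtopology Q Z) n" for b
  proof (cases n)
    case (Suc m)
    then have "singular_simplex m (subtopology Q Z) b"
      using that by simp
    then have "simplex_map m (q \<circ> r) b = b"
      by (rule simplex_map_id_gen) (simp only: comp_apply qr)
    then show ?thesis
      using Suc by (simp add: simplex_map_compose)
  qed (use that in simp)
  show "inj_on (smap q n) (sbasis (subtopology X e) n)"
    by (rule inj_on_inverseI[of _ "smap r n"]) (rule left)
  have "b \<in> smap q n ` sbasis (subtopology X e) n" if "b \<in> sbasis (subtopology Q Z) n" for b
  proof -
    have "smap r n b \<in> sbasis (subtopology X e) n"
      using smap_sbasis[OF cr, of n] that by blast
    then show ?thesis
      using right[OF that] by (metis imageI)
  qed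
  then show "smap q n ` sbasis (subtopology X e) n = sbasis (subtopology Q Z) n"
    using smap_sbasis[OF cq, of n] by blast
qed

abbreviation coinv_cone :: "'a set \<Rightarrow> nat \<Rightarrow> ('a chain \<times> 'b chain) set" where
  "coinv_cone Y \<equiv> cm.cone (coinv (ch Y)) (qch (q ` Y))"

text \<open>Up to some \<open>y - g y\<close>, which the projection annihilates, an element of
  \<open>coinv R\<close> lies in \<open>R\<close> itself.\<close>

lemma coinv_image:
  assumes R: "induced_quotient (schain X) R" and RR': "\<And>x. x \<in> R n \<Longrightarrow> basis_map (smap q n) x \<in> R'"
    and x: "x \<in> coinv R n"
  shows "basis_map (smap q n) x \<in> R'"
proof -
  have "x \<in> schain X n" "norm_map p (basis_map (smap g n)) x \<in> R n"
    using x by (simp_all add: coinv_def)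
  then obtain y where y: "y \<in> schain X n" "x - (y - basis_map (smap g n) y) \<in> R n"
    using induced_quotientD(4)[OF R] by blast
  have "basis_map (smap q n) (x - (y - basis_map (smap g n) y)) = basis_map (smap q n) x"
    using q_basis_g[OF y(1)] by (simp add: basis_map_diff)
  then show ?thesis
    using RR'[OF y(2)] by simp
qed

lemma g_topspace: "x \<in> topspace X \<Longrightarrow> (g ^^ i) x \<in> topspace X"
  using cont_g by (induction i) (auto simp: continuous_map_def Pi_iff)

lemma gp_inverse: "x \<in> topspace X \<Longrightarrow> i \<le> p \<Longrightarrow> (g ^^ (p - i)) ((g ^^ i) x) = x"
  using fun_cong[OF funpow_add[of "p - i" i g], of x] by (simp add: g_pow_p)

lemma gp_invariant: "g ` Y \<subseteq> Y \<Longrightarrow> x \<in> Y \<Longrightarrow> (g ^^ i) x \<in> Y"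
  by (induction i) auto

lemma g_Fix: "g ` Fix \<subseteq> Fix"
  by (auto simp: Fix_def)

lemma g_top: "g ` topspace X \<subseteq> topspace X"
  using g_topspace[of _ 1] by auto

text \<open>
  The projection identifies the coinvariants with the chains of the quotient over the
  fixed point set, because \<open>q\<close> is injective there.
\<close>

lemma cone_Fix:
  assumes homeo: "homeomorphic_map (subtopology X Fix) (subtopology Q (q ` Fix)) q"
  shows "cm.cone.acyc (coinv_cone Fix) (cm.cone (coinv (\<lambda>_. {0})) (\<lambda>_. {0})) n"
proof -
  have iq: "induced_quotient (schain X) (ch Fix)"
    using induced_quotient_ch[of "topspace X" Fix] g_Fix g_top by (auto simp: Fix_def)
  have zero: "subcomplex (\<lambda>_. {0})"
    by (auto simp: subcomplex_def subgrp_def)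
  have zero': "sing.subcomplex (\<lambda>_. {0::'b chain})"
    by (auto simp: sing.subcomplex_def subgrp_def)
  have st: "stable (ch Fix)"
    using stable_ch[OF g_Fix] .
  show ?thesis
  proof (rule cm.acyc_cone_iff_iso)
    show "\<exists>c\<in>coinv (ch Fix) n. y - basis_map (smap q n) c \<in> {0}" if y: "y \<in> qch (q ` Fix) n" for n y
    proof -
      obtain c where c: "c \<in> ch Fix n" "y = basis_map (smap q n) c"
        using basis_map_surj[of "sbasis (subtopology Q (q ` Fix)) n" "smap q n" "sbasis (subtopology X Fix) n" y]
          homeo_sbasis(1)[OF homeo, of n] y by blast
      then show ?thesis
        using stable_subset_coinv[OF st, of n] by auto
    qed
    show "c \<in> coinv (\<lambda>_. {0}) n" if c: "c \<in> coinv (ch Fix) n" "basis_map (smap q n) c \<in> {0}" for n c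
    proof -
      have cS: "c \<in> schain X n" "norm_map p (basis_map (smap g n)) c \<in> ch Fix n"
        using c(1) by (simp_all add: coinv_def)
      then obtain y where y: "y \<in> schain X n" "c - (y - basis_map (smap g n) y) \<in> ch Fix n"
        using induced_quotientD(4)[OF iq] by blast
      have "basis_map (smap q n) (c - (y - basis_map (smap g n) y)) \<in> supp {}"
        using q_basis_g[OF y(1)] c(2) by (simp add: basis_map_diff)
      then have "c - (y - basis_map (smap g n) y) \<in> supp {}"
        using basis_map_supp_inj[OF homeo_sbasis(2)[OF homeo] y(2), of "{}"] by simp
      then have "c = y - basis_map (smap g n) y"
        by simp
      then have "norm_map p (basis_map (smap g n)) c = 0"
        using \<sigma>_\<tau>[OF y(1)] by simp
      then show ?thesis
        using cS(1) by (simp add: coinv_def)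
    qed
    show "sd n (basis_map (smap q n) x) = basis_map (smap q (n - 1)) (sd n x)"
      if "x \<in> coinv (ch Fix) n" for n x
      using that by (intro q_chain) (simp add: coinv_def)
  qed (use coinv_subcomplex zero zero' stableD(1)[OF st] subcomplex_schain in auto)
qed

end

text \<open>
  \<open>W\<close> is the free orbit of an open cell \<open>e\<close>, \<open>U\<close> is the union of a subcomplex with
  the punctured cells of the orbit.
\<close>

locale free_cell_orbit = orbit_map +
  fixes U W e :: "'a set"
  assumes gU: "g ` U \<subseteq> U" and U_X: "U \<subseteq> topspace X" and Fix_U: "Fix \<subseteq> U"
    and e_X: "e \<subseteq> topspace X" and W: "W = (\<Union>i<p. (g ^^ i) ` e)"
    and disj: "i < p \<Longrightarrow> j < p \<Longrightarrow> i \<noteq> j \<Longrightarrow> (g ^^ i) ` e \<inter> (g ^^ j) ` e = {}"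
    and open_e: "i < p \<Longrightarrow> openin (subtopology X W) ((g ^^ i) ` e)"
    and q_U: "x \<in> topspace X \<Longrightarrow> q x \<in> q ` U \<Longrightarrow> x \<in> U"
    and q_e: "homeomorphic_map (subtopology X e) (subtopology Q (q ` W)) q"
begin

lemma gp_e: "t \<in> topspace X \<Longrightarrow> t \<in> (g ^^ i) ` e \<Longrightarrow> i < p \<Longrightarrow> (g ^^ (p - i)) t \<in> e"
  using gp_inverse e_X by (auto simp: subset_iff)

lemma W_X: "W \<subseteq> topspace X"
  using e_X g_topspace by (auto simp: W)

lemma gW: "g ` W \<subseteq> W"
proof
  fix y assume "y \<in> g ` W"
  then obtain i x where ix: "i < p" "x \<in> e" "y = (g ^^ Suc i) x"
    by (auto simp: W)
  show "y \<in> W"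
  proof (cases "Suc i < p")
    case True
    then show ?thesis
      using ix unfolding W by blast
  next
    case False
    then have "Suc i = p"
      using ix(1) by simp
    then have "y = (g ^^ 0) x"
      using ix e_X g_pow_p[of x] by auto
    then show ?thesis
      using ix pm.p_pos unfolding W by blast
  qed
qed

abbreviation BU where "BU n \<equiv> sbasis (subtopology X U) n"
abbreviation BUW where "BUW n \<equiv> sbasis (subtopology X U) n \<union> sbasis (subtopology X W) n"
abbreviation Be where "Be n \<equiv> sbasis (subtopology X e) n"

text \<open>The standard simplex is connected, and the translates of \<open>e\<close> are disjoint
  and open in \<open>W\<close>, hence clopen.\<close>

lemma simplex_in_W:
  assumes "s \<in> sbasis (subtopology X W) (Suc m)"
  shows "\<exists>i<p. \<forall>t\<in>standard_simplex m. s t \<in> (g ^^ i) ` e"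
proof -
  have s: "singular_simplex m (subtopology X W) s"
    using assms by simp
  then have cont: "continuous_map (subtopology (powertop_real UNIV) (standard_simplex m)) (subtopology X W) s"
    by (simp add: singular_simplex_def)
  have conn: "connectedin (subtopology X W) (s ` standard_simplex m)"
    using connectedin_continuous_map_image[OF cont] connectedin_standard_simplex[of m]
    by (simp add: connectedin_subtopology)
  obtain t0 where t0: "t0 \<in> standard_simplex m"
    using nonempty_standard_simplex by blast
  have "s t0 \<in> W"
    using s t0 by (auto simp: singular_simplex_subtopology)
  then obtain i where i: "i < p" "s t0 \<in> (g ^^ i) ` e"
    unfolding W by blast
  have "openin (subtopology X W) (\<Union>j\<in>{..<p} - {i}. (g ^^ j) ` e)"
    using open_e by (intro openin_Union) auto
  moreover have "topspace (subtopology X W) - (\<Union>j\<in>{..<p} - {i}. (g ^^ j) ` e) = (g ^^ i) ` e"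
  proof -
    have "topspace (subtopology X W) = W"
      using W_X by (simp add: Int_absorb1)
    then show ?thesis
      using i(1) disj[of i] unfolding W by auto
  qed
  ultimately have "closedin (subtopology X W) ((g ^^ i) ` e)"
    by (metis closedin_diff closedin_topspace)
  then have "s ` standard_simplex m \<subseteq> (g ^^ i) ` e \<or> disjnt (s ` standard_simplex m) ((g ^^ i) ` e)"
    using connectedin_clopen_cases[OF conn] open_e[OF i(1)] by blast
  then show ?thesis
    using i t0 by (auto simp: disjnt_iff)
qed

lemma smap_pow_mem:
  assumes s: "s \<in> sbasis X (Suc m)" and Z: "\<And>t. t \<in> standard_simplex m \<Longrightarrow> (g ^^ i) (s t) \<in> Z"
  shows "(smap g (Suc m) ^^ i) s \<in> sbasis (subtopology X Z) (Suc m)"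
proof -
  have "(smap g (Suc m) ^^ i) s \<in> sbasis X (Suc m)"
    using pm.\<pi>_pow_B s by blast
  then show ?thesis
    using smap_pow[OF s, of i] Z unfolding sbasis_subtopology by (simp add: simplex_map_def)
qed

lemma cover:
  assumes "b \<in> BUW n - BU n"
  shows "\<exists>i<p. \<exists>t\<in>Be n. b = (smap g n ^^ i) t"
proof (cases n)
  case 0
  then show ?thesis
    using assms by simp
next
  case (Suc m)
  then have bW: "b \<in> sbasis (subtopology X W) (Suc m)"
    using assms by blast
  then have b: "b \<in> sbasis X (Suc m)"
    by (simp only: sbasis_subtopology)
  obtain i where i: "i < p" "\<And>t. t \<in> standard_simplex m \<Longrightarrow> b t \<in> (g ^^ i) ` e"
    using simplex_in_W[OF bW] by blast
  have bX: "b t \<in> topspace X" if "t \<in> standard_simplex m" for t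
    using i(2)[OF that] e_X g_topspace by auto
  have "(smap g (Suc m) ^^ (p - i)) b \<in> Be (Suc m)"
    using smap_pow_mem[OF b] gp_e[OF bX i(2) i(1)] by blast
  moreover have "(smap g n ^^ i) ((smap g n ^^ (p - i)) b) = b"
    using pm.\<pi>_pow_inverse[of b n "p - i"] b i(1) Suc by simp
  ultimately show ?thesis
    using i(1) Suc by metis
qed

text \<open>Restricted to positive degree, since every power of \<open>g\<close> fixes the empty
  simplex.\<close>

lemma Be_inj:
  assumes "i < p" "j < p" "s \<in> Be (Suc m)" "t \<in> Be (Suc m)" "(smap g (Suc m) ^^ i) s = (smap g (Suc m) ^^ j) t"
  shows "i = j \<and> s = t"
proof -
  have st: "s \<in> sbasis X (Suc m)" "t \<in> sbasis X (Suc m)"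
    "\<And>u. u \<in> standard_simplex m \<Longrightarrow> s u \<in> e" "\<And>u. u \<in> standard_simplex m \<Longrightarrow> t u \<in> e"
    using assms(3,4) unfolding sbasis_subtopology by auto
  obtain u where u: "u \<in> standard_simplex m"
    using nonempty_standard_simplex by blast
  have "simplex_map m (g ^^ i) s u = simplex_map m (g ^^ j) t u"
    using assms(5) smap_pow[OF st(1)] smap_pow[OF st(2)] by simp
  then have eq: "(g ^^ i) (s u) = (g ^^ j) (t u)"
    using u by (simp add: simplex_map_def)
  have "(g ^^ i) (s u) \<in> (g ^^ i) ` e" "(g ^^ i) (s u) \<in> (g ^^ j) ` e"
    using st(3,4)[OF u] eq by (metis imageI)+
  then have "i = j"
    using disj[of i j] assms(1,2) by blast
  moreover have "s = (smap g (Suc m) ^^ (p - i)) ((smap g (Suc m) ^^ i) s)"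
    "t = (smap g (Suc m) ^^ (p - i)) ((smap g (Suc m) ^^ i) t)"
    using pm.\<pi>_pow_inverse[OF st(1), of i] pm.\<pi>_pow_inverse[OF st(2), of i] assms(1) by auto
  ultimately show ?thesis
    using assms(5) by metis
qed

text \<open>Different translates of simplices of \<open>e\<close> are distinct, so coefficients can
  be read off from the sum. Where one is nonzero, the translate lies in the invariant set
  \<open>U\<close>, and so does the simplex itself.\<close>

lemma Be_unique:
  assumes t: "\<And>i. t i \<in> supp (Be n)" and sum: "(\<Sum>i<p. (basis_map (smap g n) ^^ i) (t i)) \<in> supp (BU n)"
    and i: "i < p"
  shows "t i \<in> ch (e \<inter> U) n"
proof (cases n)
  case 0
  then show ?thesis
    using t[of i] by simp
next
  case (Suc m)
  show ?thesis
  proof (rule suppI)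
    fix b assume b: "b \<notin> sbasis (subtopology X (e \<inter> U)) n"
    show "Poly_Mapping.lookup (t i) b = 0"
    proof (cases "b \<in> Be n")
      case True
      have bX: "b \<in> sbasis X (Suc m)"
        using True Suc by (simp only: sbasis_subtopology)
      have "(smap g n ^^ i) b \<notin> BU n"
      proof
        assume *: "(smap g n ^^ i) b \<in> BU n"
        have "(smap g n ^^ k) ((smap g n ^^ i) b) \<in> BU n" for k
          using * smap_inv[OF gU, of n] by (induction k) auto
        then have "b \<in> BU n"
          using pm.\<pi>_pow_inverse[OF bX, of i] i Suc by (metis less_imp_le)
        then have "b \<in> sbasis (subtopology X (e \<inter> U)) n"
          using True unfolding sbasis_subtopology by blast
        then show False
          using b by blast
      qed
      then have "Poly_Mapping.lookup (\<Sum>i<p. (basis_map (smap g n) ^^ i) (t i)) ((smap g n ^^ i) b) = 0"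
        using lookup_supp[OF sum] by blast
      moreover have "Poly_Mapping.lookup (\<Sum>i<p. (basis_map (smap g n) ^^ i) (t i)) ((smap g n ^^ i) b) =
          Poly_Mapping.lookup (t i) b"
      proof (rule pm.lookup_sum_basis_map_pow[where T = "Be n"])
        show "i = j \<and> s = t" if "i < p" "j < p" "s \<in> Be n" "t \<in> Be n"
            "(smap g n ^^ i) s = (smap g n ^^ j) t" for i j s t
          using Be_inj that Suc by blast
      qed (use t i True in auto)
      ultimately show ?thesis
        by simp
    next
      case False
      then show ?thesis
        using lookup_supp[OF t] by blast
    qed
  qed
qed

lemma BUW_X: "BUW n \<subseteq> sbasis X n" and BU_X: "BU n \<subseteq> sbasis X n" and Be_BUW: "Be n \<subseteq> BUW n"
proof -
  have "e \<subseteq> W"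
    using pm.p_pos unfolding W by (auto intro!: bexI[of _ 0])
  then show "Be n \<subseteq> BUW n"
    using sbasis_mono by blast
qed (auto simp: sbasis_subtopology)

lemma BUW_inv: "smap g n ` BUW n \<subseteq> BUW n"
  using smap_inv[OF gU, of n] smap_inv[OF gW, of n] by blast

lemma BUW_decomp:
  assumes "x \<in> supp (BUW n)"
  obtains t where "\<forall>i. t i \<in> supp (Be n)" "x - (\<Sum>i<p. (basis_map (smap g n) ^^ i) (t i)) \<in> supp (BU n)"
proof -
  interpret B: permutation_module p "smap g n" "BUW n"
    using BUW_inv[of n] BUW_X[of n] pm.p_pos pm.\<pi>_pow_p by unfold_locales blast+
  show thesis
    using B.transversal_decomp[OF Be_BUW cover assms] that by blast
qed

lemma subcomplex_BUW: "subcomplex (\<lambda>n. supp (BUW n))"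
  by (intro subcomplex_supp_Un subcomplex_schain)

lemma stable_BUW: "stable (\<lambda>n. supp (BUW n))"
  using stable_supp[OF subcomplex_BUW BUW_X BUW_inv] .

lemma stable_BU: "stable (ch U)"
  using stable_ch[OF gU] .

lemma sd_gp: "x \<in> schain X n \<Longrightarrow> sd n ((basis_map (smap g n) ^^ i) x) = (basis_map (smap g (n - 1)) ^^ i) (sd n x)"
proof (induction i)
  case (Suc i)
  then have "(basis_map (smap g n) ^^ i) x \<in> schain X n"
    using pm.gp_closed[of "schain X n"] pm.g_S by blast
  from sd_basis_map[OF this] Suc show ?case
    by simp
qed simp

lemma sd_sum: "sd n (sum f I) = (\<Sum>i\<in>I. sd n (f i))"
  by (induction I rule: infinite_finite_induct) (simp_all add: sing.d_add)

lemma Be_X: "Be n \<subseteq> sbasis X n"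
  by (auto simp: sbasis_subtopology)

lemma Be_S: "x \<in> supp (Be n) \<Longrightarrow> x \<in> schain X n"
  using supp_mono[OF Be_X] by blast

text \<open>Modulo the chains of \<open>U\<close>, the chains of \<open>U\<close> and
  \<open>W\<close> are \<open>p\<close> translates of the chains of \<open>e\<close> modulo those of
  \<open>e \<inter> U\<close>, and the boundary problem splits accordingly.\<close>

lemma acyc_BUW_BU:
  assumes H: "acyc (ch e) (ch (e \<inter> U)) n"
  shows "acyc (\<lambda>n. supp (BUW n)) (ch U) n"
  unfolding acyc_def
proof (intro ballI impI)
  fix x assume x: "x \<in> supp (BUW n)" "sd n x \<in> supp (BU (n - 1))"
  obtain t where "\<forall>i. t i \<in> supp (Be n)" "x - (\<Sum>i<p. (basis_map (smap g n) ^^ i) (t i)) \<in> supp (BU n)"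
    using BUW_decomp[OF x(1)] .
  then have t: "\<And>i. t i \<in> supp (Be n)" "x - (\<Sum>i<p. (basis_map (smap g n) ^^ i) (t i)) \<in> supp (BU n)"
    by blast+
  have "sd n (x - (\<Sum>i<p. (basis_map (smap g n) ^^ i) (t i))) =
      sd n x - (\<Sum>i<p. (basis_map (smap g (n - 1)) ^^ i) (sd n (t i)))"
    using sd_gp[OF Be_S[OF t(1)]] by (simp add: d_diff sd_sum)
  then have "sd n x - (\<Sum>i<p. (basis_map (smap g (n - 1)) ^^ i) (sd n (t i))) \<in> supp (BU (n - 1))"
    using subcomplexD(2)[OF subcomplex_schain t(2)] by simp
  then have "sd n x - (sd n x - (\<Sum>i<p. (basis_map (smap g (n - 1)) ^^ i) (sd n (t i)))) \<in> supp (BU (n - 1))"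
    by (rule subgrp_diff[OF subgrp_supp x(2)])
  then have "(\<Sum>i<p. (basis_map (smap g (n - 1)) ^^ i) (sd n (t i))) \<in> supp (BU (n - 1))"
    by simp
  moreover have "sd n (t i) \<in> supp (Be (n - 1))" for i
    using subcomplexD(2)[OF subcomplex_schain t(1)] .
  ultimately have "sd n (t i) \<in> ch (e \<inter> U) (n - 1)" if "i < p" for i
    using Be_unique[of "\<lambda>i. sd n (t i)" "n - 1" i] that by blast
  then have "\<exists>y\<in>supp (Be (Suc n)). t i - sd (Suc n) y \<in> ch (e \<inter> U) n" if "i < p" for i
    using H t(1)[of i] that unfolding acyc_def by blast
  then obtain y where y: "\<And>i. i < p \<Longrightarrow> y i \<in> supp (Be (Suc n))"
    "\<And>i. i < p \<Longrightarrow> t i - sd (Suc n) (y i) \<in> ch (e \<inter> U) n"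
    by metis
  define Y where "Y = (\<Sum>i<p. (basis_map (smap g (Suc n)) ^^ i) (y i))"
  have "(basis_map (smap g n) ^^ i) (t i - sd (Suc n) (y i)) \<in> supp (BU n)" if "i < p" for i
  proof (rule pm.gp_closed)
    show "t i - sd (Suc n) (y i) \<in> supp (BU n)"
      using y(2)[OF that] supp_mono[OF sbasis_mono[of "e \<inter> U" U]] by blast
  qed (use basis_map_supp[OF smap_inv[OF gU]] in blast)
  then have "(\<Sum>i<p. (basis_map (smap g n) ^^ i) (t i - sd (Suc n) (y i))) \<in> supp (BU n)"
    by (intro subgrp_sum subgrp_supp) auto
  then have "(x - (\<Sum>i<p. (basis_map (smap g n) ^^ i) (t i))) +
      (\<Sum>i<p. (basis_map (smap g n) ^^ i) (t i - sd (Suc n) (y i))) \<in> supp (BU n)"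
    using subgrp_add[OF subgrp_supp t(2)] by blast
  moreover have "sd (Suc n) Y = (\<Sum>i<p. (basis_map (smap g n) ^^ i) (sd (Suc n) (y i)))"
    unfolding Y_def sd_sum using sd_gp[OF Be_S[OF y(1)]] by (intro sum.cong) auto
  ultimately have "x - sd (Suc n) Y \<in> supp (BU n)"
    by (simp add: basis_map_pow_diff sum_subtractf)
  moreover have "Y \<in> supp (BUW (Suc n))"
    unfolding Y_def
  proof (intro subgrp_sum subgrp_supp pm.gp_closed)
    show "basis_map (smap g (Suc n)) x \<in> supp (BUW (Suc n))" if "x \<in> supp (BUW (Suc n))" for x
      using basis_map_supp[OF BUW_inv that] .
    show "y i \<in> supp (BUW (Suc n))" if "i \<in> {..<p}" for i
      using y(1) that supp_mono[OF Be_BUW] by blast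
  qed
  ultimately show "\<exists>y\<in>supp (BUW (Suc n)). x - sd (Suc n) y \<in> supp (BU n)"
    by blast
qed

text \<open>\<open>u\<close> arises by moving all components of \<open>x\<close> into
  \<open>e\<close>. Apart from chains of \<open>U\<close>, this changes neither the norm nor the
  image in the quotient.\<close>

lemma norm_decomp:
  assumes "x \<in> supp (BUW n)"
  obtains u where "u \<in> supp (Be n)"
    "norm_map p (basis_map (smap g n)) (x - u) \<in> supp (BU n)"
    "norm_map p (basis_map (smap g (n - 1))) (sd n (x - u)) \<in> supp (BU (n - 1))"
    "basis_map (smap q n) (x - u) \<in> qch (q ` U) n"
proof -
  obtain t where "\<forall>i. t i \<in> supp (Be n)" "x - (\<Sum>i<p. (basis_map (smap g n) ^^ i) (t i)) \<in> supp (BU n)"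
    using BUW_decomp[OF assms] .
  then have t: "\<And>i. t i \<in> supp (Be n)" "x - (\<Sum>i<p. (basis_map (smap g n) ^^ i) (t i)) \<in> supp (BU n)"
    by blast+
  define u where "u = (\<Sum>i<p. t i)"
  define m where "m = x - (\<Sum>i<p. (basis_map (smap g n) ^^ i) (t i))"
  have tS: "t i \<in> schain X n" for i
    using Be_S t(1) by blast
  have u: "u \<in> supp (Be n)"
    unfolding u_def using t(1) by (intro subgrp_sum subgrp_supp)
  have x: "x = m + (\<Sum>i<p. (basis_map (smap g n) ^^ i) (t i))"
    by (simp add: m_def)
  have gtS: "(\<Sum>i<p. (basis_map (smap g n) ^^ i) (t i)) \<in> schain X n"
    using tS pm.gp_closed[of "schain X n"] pm.g_S by (intro subgrp_sum subgrp_supp) blast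
  have "norm_map p (basis_map (smap g n)) (\<Sum>i<p. (basis_map (smap g n) ^^ i) (t i)) =
      norm_map p (basis_map (smap g n)) u"
    unfolding u_def pm.norm_map_sum using pm.norm_map_gp[OF tS] by simp
  then have nu: "norm_map p (basis_map (smap g n)) (x - u) = norm_map p (basis_map (smap g n)) m"
    by (simp add: x \<sigma>_add \<sigma>_diff)
  have m: "m \<in> supp (BU n)"
    using t(2) by (simp add: m_def)
  then have 1: "norm_map p (basis_map (smap g n)) (x - u) \<in> supp (BU n)"
    using nu stableD(3)[OF stable_BU] by simp
  have "x - u \<in> schain X n"
    using assms supp_mono[OF BUW_X] Be_S[OF u] subgrp_diff[OF subgrp_supp] by blast
  then have "norm_map p (basis_map (smap g (n - 1))) (sd n (x - u)) = sd n (norm_map p (basis_map (smap g n)) (x - u))"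
    using \<sigma>_d by simp
  then have 2: "norm_map p (basis_map (smap g (n - 1))) (sd n (x - u)) \<in> supp (BU (n - 1))"
    using subcomplexD(2)[OF subcomplex_schain 1] by simp
  have "basis_map (smap q n) (\<Sum>i<p. (basis_map (smap g n) ^^ i) (t i)) = basis_map (smap q n) u"
    unfolding u_def q_sum using q_basis_gp[OF tS] by simp
  then have "basis_map (smap q n) (x - u) = basis_map (smap q n) m"
    by (simp add: x cm.f_add basis_map_diff)
  then have "basis_map (smap q n) (x - u) \<in> qch (q ` U) n"
    using q_image[OF order_refl m] by simp
  with u 1 2 show thesis
    using that by blast
qed

lemma norm_Be_unique:
  assumes "u \<in> supp (Be n)" "norm_map p (basis_map (smap g n)) u \<in> supp (BU n)"
  shows "u \<in> ch (e \<inter> U) n"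
  using Be_unique[of "\<lambda>_. u" n 0] assms pm.p_pos by (simp add: norm_map_def)

lemma eU_U: "x \<in> ch (e \<inter> U) n \<Longrightarrow> x \<in> supp (BU n)"
  using supp_mono[OF sbasis_mono[of "e \<inter> U" U]] by blast

lemma induced_BUW: "induced_quotient (schain X) (\<lambda>n. supp (BUW n))"
proof (rule induced_quotient_supp0)
  show "sbasis (subtopology X Fix) n \<inter> sbasis X n \<subseteq> BUW n" for n
    using sbasis_mono[OF Fix_U] by blast
qed (use stable_S stable_BUW BUW_X BUW_inv smap_sbasis[OF cont_g] in auto)

text \<open>The coinvariants of an induced module are a single copy of the inducing one, here the
  chains of \<open>e\<close> modulo \<open>e \<inter> U\<close>; \<open>norm_decomp\<close> moves
  the problem there.\<close>

lemma acyc_coinv_BUW_BU: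
  assumes H: "acyc (ch e) (ch (e \<inter> U)) n"
  shows "acyc (coinv (\<lambda>n. supp (BUW n))) (coinv (ch U)) n"
proof (rule acyc_coinv_gen[OF induced_BUW stable_BU])
  show "supp (BU n) \<subseteq> supp (BUW n)" for n
    by (rule supp_mono) blast
  fix x assume x: "x \<in> supp (BUW n)" "norm_map p (basis_map (smap g (n - 1))) (sd n x) \<in> supp (BU (n - 1))"
  obtain u where u: "u \<in> supp (Be n)" "norm_map p (basis_map (smap g n)) (x - u) \<in> supp (BU n)"
    "norm_map p (basis_map (smap g (n - 1))) (sd n (x - u)) \<in> supp (BU (n - 1))"
    using norm_decomp[OF x(1)] .
  have "norm_map p (basis_map (smap g (n - 1))) (sd n x) - norm_map p (basis_map (smap g (n - 1))) (sd n (x - u))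
      \<in> supp (BU (n - 1))"
    using subgrp_diff[OF subgrp_supp x(2) u(3)] .
  then have "norm_map p (basis_map (smap g (n - 1))) (sd n u) \<in> supp (BU (n - 1))"
    by (simp add: d_diff \<sigma>_diff)
  then have "sd n u \<in> ch (e \<inter> U) (n - 1)"
    using norm_Be_unique subcomplexD(2)[OF subcomplex_schain u(1)] by blast
  then obtain z where z: "z \<in> supp (Be (Suc n))" "u - sd (Suc n) z \<in> ch (e \<inter> U) n"
    using acycD[OF H u(1)] by blast
  have "norm_map p (basis_map (smap g n)) (u - sd (Suc n) z) \<in> supp (BU n)"
    using stableD(3)[OF stable_BU eU_U[OF z(2)]] .
  with u(2) have "norm_map p (basis_map (smap g n)) (x - u) + norm_map p (basis_map (smap g n)) (u - sd (Suc n) z)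
      \<in> supp (BU n)"
    by (rule subgrp_add[OF subgrp_supp])
  then have "norm_map p (basis_map (smap g n)) (x - sd (Suc n) z) \<in> supp (BU n)"
    by (simp add: \<sigma>_diff)
  then show "\<exists>z\<in>supp (BUW (Suc n)). norm_map p (basis_map (smap g n)) (x - sd (Suc n) z) \<in> supp (BU n)"
    using z(1) supp_mono[OF Be_BUW] by blast
qed

abbreviation QUW where
  "QUW n \<equiv> sbasis (subtopology Q (q ` U)) n \<union> sbasis (subtopology Q (q ` W)) n"

lemma q_BUW:
  assumes "x \<in> supp (BUW n)"
  shows "basis_map (smap q n) x \<in> supp (QUW n)"
proof -
  obtain a b where ab: "a \<in> supp (BU n)" "b \<in> ch W n" "x = a + b"
    using supp_Un_decomp[OF assms] .
  have "basis_map (smap q n) a \<in> supp (QUW n)" "basis_map (smap q n) b \<in> supp (QUW n)"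
    using q_image[OF order_refl ab(1)] q_image[OF order_refl ab(2)] by (auto simp: supp_def)
  then show ?thesis
    using ab(3) subgrp_add[OF subgrp_supp] by (simp add: cm.f_add)
qed

text \<open>Both quotients are one copy of the chains of \<open>e\<close> modulo
  \<open>e \<inter> U\<close>: the coinvariants because \<open>W\<close> is a free orbit, the chains
  of the quotient because \<open>q\<close> maps \<open>e\<close> homeomorphically onto the image of
  \<open>W\<close>.\<close>

lemma cone_BUW_BU:
  "cm.cone.acyc (cm.cone (coinv (\<lambda>n. supp (BUW n))) (\<lambda>n. supp (QUW n))) (coinv_cone U) n"
proof (rule cm.acyc_cone_iff_iso)
  show "\<exists>c\<in>coinv (\<lambda>n. supp (BUW n)) n. y - basis_map (smap q n) c \<in> qch (q ` U) n"
    if y: "y \<in> supp (QUW n)" for n y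
  proof -
    obtain a b where ab: "a \<in> qch (q ` U) n" "b \<in> qch (q ` W) n" "y = a + b"
      using supp_Un_decomp[OF y] .
    obtain c where c: "c \<in> supp (Be n)" "b = basis_map (smap q n) c"
      using basis_map_surj[of "sbasis (subtopology Q (q ` W)) n" "smap q n" "Be n" b]
        homeo_sbasis(1)[OF q_e, of n] ab(2) by blast
    have "c \<in> coinv (\<lambda>n. supp (BUW n)) n"
      using c(1) supp_mono[OF Be_BUW] stable_subset_coinv[OF stable_BUW, of n] by blast
    then show ?thesis
      using ab c by (intro bexI[of _ c]) auto
  qed
  show "c \<in> coinv (ch U) n" if c: "c \<in> coinv (\<lambda>n. supp (BUW n)) n" "basis_map (smap q n) c \<in> qch (q ` U) n" for n c
  proof -
    have cS: "c \<in> schain X n" "norm_map p (basis_map (smap g n)) c \<in> supp (BUW n)"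
      using c(1) by (simp_all add: coinv_def)
    then obtain y where y: "y \<in> schain X n" "c - (y - basis_map (smap g n) y) \<in> supp (BUW n)"
      using induced_quotientD(4)[OF induced_BUW] by blast
    define x where "x = c - (y - basis_map (smap g n) y)"
    have x: "x \<in> supp (BUW n)"
      using y(2) by (simp add: x_def)
    have qx: "basis_map (smap q n) x = basis_map (smap q n) c"
      using q_basis_g[OF y(1)] by (simp add: x_def basis_map_diff)
    have \<sigma>x: "norm_map p (basis_map (smap g n)) x = norm_map p (basis_map (smap g n)) c"
      using \<sigma>_\<tau>[OF y(1)] by (simp add: x_def \<sigma>_diff)
    obtain u where u: "u \<in> supp (Be n)" "norm_map p (basis_map (smap g n)) (x - u) \<in> supp (BU n)"
      "basis_map (smap q n) (x - u) \<in> qch (q ` U) n"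
      using norm_decomp[OF x] .
    have "basis_map (smap q n) x - basis_map (smap q n) (x - u) \<in> qch (q ` U) n"
      using subgrp_diff[OF subgrp_supp _ u(3)] c(2) qx by simp
    then have "basis_map (smap q n) u \<in> qch (q ` U) n"
      by (simp add: basis_map_diff)
    then have "u \<in> supp {t \<in> Be n. smap q n t \<in> sbasis (subtopology Q (q ` U)) n}"
      by (rule basis_map_supp_inj[OF homeo_sbasis(2)[OF q_e] u(1)])
    \<comment> \<open>\<open>q_U\<close> says that \<open>U\<close> is saturated, so a simplex of
      \<open>e\<close> that projects into the image of \<open>U\<close> lies in
      \<open>U\<close>.\<close>
    moreover have "{t \<in> Be n. smap q n t \<in> sbasis (subtopology Q (q ` U)) n} \<subseteq> BU n"
    proof
      fix s assume "s \<in> {t \<in> Be n. smap q n t \<in> sbasis (subtopology Q (q ` U)) n}"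
      then have s: "s \<in> Be n" "smap q n s \<in> sbasis (subtopology Q (q ` U)) n"
        by auto
      show "s \<in> BU n"
      proof (cases n)
        case (Suc m)
        have "s v \<in> U" if v: "v \<in> standard_simplex m" for v
        proof -
          have "smap q n s v \<in> q ` U"
            using s(2) v Suc unfolding sbasis_subtopology by simp
          then have "q (s v) \<in> q ` U"
            using v Suc by (simp add: simplex_map_def)
          moreover have "s v \<in> e"
            using s(1) v Suc unfolding sbasis_subtopology by simp
          ultimately show ?thesis
            using q_U e_X by blast
        qed
        then show ?thesis
          using s(1) Suc unfolding sbasis_subtopology by simp
      qed (use s(1) in simp)
    qed
    ultimately have "u \<in> supp (BU n)"
      using supp_mono by blast
    then have "norm_map p (basis_map (smap g n)) u \<in> supp (BU n)"
      using stableD(3)[OF stable_BU] by blast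
    with u(2) have "norm_map p (basis_map (smap g n)) (x - u) + norm_map p (basis_map (smap g n)) u \<in> supp (BU n)"
      by (rule subgrp_add[OF subgrp_supp])
    then have "norm_map p (basis_map (smap g n)) c \<in> supp (BU n)"
      using \<sigma>x by (simp add: \<sigma>_diff)
    then show ?thesis
      using cS(1) by (simp add: coinv_def)
  qed
  show "sd n (basis_map (smap q n) x) = basis_map (smap q (n - 1)) (sd n x)"
    if "x \<in> coinv (\<lambda>n. supp (BUW n)) n" for n x
    using that by (intro q_chain) (simp add: coinv_def)
  show "sing.subcomplex (\<lambda>n. supp (QUW n))"
    by (intro subcomplex_supp_Un subcomplex_schain)
qed (use coinv_subcomplex subcomplex_BUW subcomplex_schain in auto)

end

context orbit_map
begin

lemma cone_mono:
  "(\<And>n. B n \<subseteq> A n) \<Longrightarrow> (\<And>n. B' n \<subseteq> A' n) \<Longrightarrow> cm.cone B B' n \<subseteq> cm.cone A A' n"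
  unfolding cm.cone_def by (intro Sigma_mono) (auto split: nat.split)

text \<open>Passes through the mixed cone of \<open>B\<close> and \<open>A'\<close>, so that one
  component changes at a time.\<close>

lemma cone_step:
  assumes A: "subcomplex A" and B: "subcomplex B" and A': "sing.subcomplex A'" and B': "sing.subcomplex B'"
    and sub: "\<And>n. B n \<subseteq> A n"
    and fA: "\<And>n x. x \<in> A n \<Longrightarrow> basis_map (smap q n) x \<in> A' n"
    and fB: "\<And>n x. x \<in> B n \<Longrightarrow> basis_map (smap q n) x \<in> B' n"
    and sub': "\<And>n. B' n \<subseteq> A' n" and AS: "\<And>n. A n \<subseteq> schain X n"
    and AB: "\<And>n. acyc A B n" and AB': "\<And>n. sing.acyc A' B' n"
  shows "cm.cone.acyc (cm.cone A A') (cm.cone B B') n"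
proof (rule cm.cone.acyc_trans)
  have chain: "sd n (basis_map (smap q n) x) = basis_map (smap q (n - 1)) (sd n x)" if "x \<in> A n" for x n
    using q_chain that AS by blast
  have mixed: "basis_map (smap q n) x \<in> A' n" if "x \<in> B n" for x n
    using fA sub that by blast
  show "cm.cone.subcomplex (cm.cone A A')"
    using cm.cone_subcomplex[OF A A' fA chain] .
  show "cm.cone.subcomplex (cm.cone B A')"
    using cm.cone_subcomplex[OF B A' mixed chain] sub by blast
  show "cm.cone.subcomplex (cm.cone B B')"
    using cm.cone_subcomplex[OF B B' fB chain] sub by blast
  show "cm.cone B A' n \<subseteq> cm.cone A A' n" for n
    by (intro cone_mono sub order_refl)
  show "cm.cone B B' n \<subseteq> cm.cone B A' n" for n
    by (intro cone_mono sub' order_refl)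
  show "cm.cone.acyc (cm.cone A A') (cm.cone B A') n"
    using cm.acyc_cone_left[OF A B A' AB sub fA] .
  show "cm.cone.acyc (cm.cone B A') (cm.cone B B') n"
    using cm.acyc_cone_right[OF A' B' B AB' fB] .
qed

lemma subcomplex_coinv_ch: "subcomplex (coinv (ch Y))"
  by (rule coinv_subcomplex[OF subcomplex_schain])

lemma induced_S_ch: "g ` Y \<subseteq> Y \<Longrightarrow> Y \<subseteq> topspace X \<Longrightarrow> Fix \<subseteq> Y \<Longrightarrow> induced_quotient (schain X) (ch Y)"
  using induced_quotient_ch[of "topspace X" Y] g_top by (auto simp: Fix_def)

lemma coinv_ch_image:
  assumes "g ` Y \<subseteq> Y" "Y \<subseteq> topspace X" "Fix \<subseteq> Y" "x \<in> coinv (ch Y) n"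
  shows "basis_map (smap q n) x \<in> qch (q ` Y) n"
  using coinv_image[OF induced_S_ch[OF assms(1-3)] q_image[OF order_refl] assms(4)] .

lemma coinv_cone_subcomplex:
  assumes "g ` Y \<subseteq> Y" "Y \<subseteq> topspace X" "Fix \<subseteq> Y"
  shows "cm.cone.subcomplex (coinv_cone Y)"
  using coinv_ch_image[OF assms] q_chain
  by (intro cm.cone_subcomplex subcomplex_coinv_ch subcomplex_schain) (auto simp: coinv_def)

lemma ch_mono: "Y \<subseteq> Z \<Longrightarrow> ch Y n \<subseteq> ch Z n"
  by (intro supp_mono sbasis_mono)

lemma qch_mono: "Y \<subseteq> Z \<Longrightarrow> qch Y n \<subseteq> qch Z n"
  by (intro supp_mono sbasis_mono)

lemma coinv_cone_mono: "Y \<subseteq> Z \<Longrightarrow> coinv_cone Y n \<subseteq> coinv_cone Z n"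
  by (intro cone_mono coinv_mono ch_mono qch_mono image_mono)

text \<open>
  The comparison of coinvariants with chains of the quotient is a quasi-isomorphism on
  \<open>Y\<close> relative to the fixed points, and the relative complexes have bounded homology.
\<close>

definition good :: "'a set \<Rightarrow> bool" where
  "good Y \<longleftrightarrow> (\<forall>n. cm.cone.acyc (coinv_cone Y) (coinv_cone Fix) n) \<and>
     (\<exists>N. \<forall>n\<ge>N. acyc (ch Y) (ch Fix) n \<and> acyc (coinv (ch Y)) (coinv (ch Fix)) n)"

lemma good_Fix: "good Fix"
proof -
  have "cm.cone.acyc (coinv_cone Fix) (coinv_cone Fix) n" for n
    using coinv_cone_subcomplex[OF g_Fix] by (intro cm.cone.acyc_refl) (auto simp: Fix_def)
  then show ?thesis
    unfolding good_def using acyc_refl[OF subcomplex_schain] acyc_refl[OF subcomplex_coinv_ch] by blast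
qed

end

context free_cell_orbit
begin

text \<open>Interpolates between \<open>Y\<close> and \<open>Fix\<close> by the chains subordinate
  to \<open>U\<close> and \<open>W\<close>, those of \<open>U\<close> and those of
  \<open>Y'\<close>. The links are excision, the free orbit of cells, the retraction onto
  \<open>Y'\<close>, and the hypothesis on \<open>Y'\<close>. Only the free orbit contributes
  homology relative to \<open>Y'\<close>, namely that of \<open>e\<close> modulo
  \<open>e \<inter> U\<close>, which \<open>H\<close> bounds.\<close>

lemma good_step:
  assumes gY': "g ` Y' \<subseteq> Y'" and gY: "g ` Y \<subseteq> Y" and Fix_Y': "Fix \<subseteq> Y'" and Y'U: "Y' \<subseteq> U"
    and UY: "U \<subseteq> Y" and WY: "W \<subseteq> Y" and YX: "Y \<subseteq> topspace X"
    and exc: "\<And>n. acyc (ch Y) (\<lambda>n. supp (BUW n)) n"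
    and excQ: "\<And>n. sing.acyc (qch (q ` Y)) (\<lambda>n. supp (QUW n)) n"
    and ret: "\<And>n. acyc (ch U) (ch Y') n" and retQ: "\<And>n. sing.acyc (qch (q ` U)) (qch (q ` Y')) n"
    and H: "\<And>n. n \<ge> N \<Longrightarrow> acyc (ch e) (ch (e \<inter> U)) n"
    and good: "good Y'"
  shows "good Y"
proof -
  have FY: "Fix \<subseteq> Y" and Y'X: "Y' \<subseteq> topspace X" and Y'Y: "Y' \<subseteq> Y" and FX: "Fix \<subseteq> topspace X"
    using Fix_Y' Y'U UY YX by auto
  have BUW_Y: "BUW n \<subseteq> sbasis (subtopology X Y) n" for n
    using sbasis_mono[OF UY] sbasis_mono[OF WY] by blast
  have sBUW_Y: "supp (BUW n) \<subseteq> ch Y n" for n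
    using supp_mono[OF BUW_Y] .
  have sBU_BUW: "ch U n \<subseteq> supp (BUW n)" for n
    by (rule supp_mono) blast
  have QUW_Y: "supp (QUW n) \<subseteq> qch (q ` Y) n" for n
    using sbasis_mono[of "q ` U" "q ` Y"] sbasis_mono[of "q ` W" "q ` Y"] UY WY
    by (intro supp_mono) blast
  have sQU: "qch (q ` U) n \<subseteq> supp (QUW n)" for n
    by (rule supp_mono) blast
  have iq: "induced_quotient (ch Y) (\<lambda>n. supp (BUW n))"
  proof (rule induced_quotient_supp0)
    show "sbasis (subtopology X Fix) n \<inter> sbasis (subtopology X Y) n \<subseteq> BUW n" for n
      using sbasis_mono[OF Fix_U] by blast
    show "sbasis (subtopology X Y) n \<subseteq> sbasis X n" for n
      by (auto simp: sbasis_subtopology)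
  qed (use stable_ch[OF gY] stable_BUW BUW_Y BUW_inv smap_inv[OF gY] in auto)
  have iqU: "induced_quotient (ch U) (ch Y')"
    using induced_quotient_ch[OF gU gY' Y'U] Fix_Y' by blast
  \<comment> \<open>Excision and the retraction are given on chains. As the quotients are induced,
    \<open>acyc_coinv\<close> carries them over to the coinvariants.\<close>
  have 1: "acyc (coinv (ch Y)) (coinv (\<lambda>n. supp (BUW n))) n" for n
    using acyc_coinv[OF induced_S_ch[OF gY YX FY] iq exc] .
  have 2: "acyc (coinv (ch U)) (coinv (ch Y')) n" for n
    using acyc_coinv[OF induced_S_ch[OF gU U_X Fix_U] iqU ret] .
  note sub = subcomplex_coinv_ch coinv_subcomplex[OF subcomplex_BUW] subcomplex_schain
    subcomplex_BUW coinv_cone_subcomplex[OF gY YX FY] coinv_cone_subcomplex[OF gU U_X Fix_U]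
    coinv_cone_subcomplex[OF gY' Y'X Fix_Y'] coinv_cone_subcomplex[OF g_Fix FX order_refl]
  have coinvBUW: "coinv (\<lambda>n. supp (BUW n)) n \<subseteq> coinv (ch Y) n" "coinv (ch U) n \<subseteq> coinv (\<lambda>n. supp (BUW n)) n" for n
    using coinv_mono[of "\<lambda>n. supp (BUW n)" "ch Y" n] coinv_mono[of "ch U" "\<lambda>n. supp (BUW n)" n] sBUW_Y sBU_BUW
    by blast+
  have subQUW: "sing.subcomplex (\<lambda>n. supp (QUW n))"
    by (intro subcomplex_supp_Un subcomplex_schain)
  have fBUW: "basis_map (smap q n) x \<in> supp (QUW n)" if "x \<in> coinv (\<lambda>n. supp (BUW n)) n" for n x
    using coinv_image[OF induced_BUW q_BUW that] .
  have subM: "cm.cone.subcomplex (cm.cone (coinv (\<lambda>n. supp (BUW n))) (\<lambda>n. supp (QUW n)))"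
    using fBUW q_chain coinv_subset by (intro cm.cone_subcomplex sub subQUW) blast+
  have c1: "cm.cone.acyc (coinv_cone Y) (cm.cone (coinv (\<lambda>n. supp (BUW n))) (\<lambda>n. supp (QUW n))) n" for n
    by (rule cone_step) (fact sub subQUW coinvBUW coinv_ch_image[OF gY YX FY] fBUW QUW_Y coinv_subset 1 excQ)+
  have q_mono: "qch (q ` Y') n \<subseteq> qch (q ` U) n" for n
    using Y'U by (intro qch_mono) blast
  have c3: "cm.cone.acyc (coinv_cone U) (coinv_cone Y') n" for n
    by (rule cone_step)
      (fact sub coinv_mono[OF ch_mono[OF Y'U]] coinv_ch_image[OF gU U_X Fix_U] coinv_ch_image[OF gY' Y'X Fix_Y']
        q_mono coinv_subset 2 retQ)+
  have m1: "cm.cone (coinv (\<lambda>n. supp (BUW n))) (\<lambda>n. supp (QUW n)) n \<subseteq> coinv_cone Y n" for n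
    by (intro cone_mono coinvBUW(1) QUW_Y)
  have m2: "coinv_cone U n \<subseteq> cm.cone (coinv (\<lambda>n. supp (BUW n))) (\<lambda>n. supp (QUW n)) n" for n
    by (intro cone_mono coinvBUW(2) sQU)
  have "cm.cone.acyc (coinv_cone Y) (coinv_cone U) n" for n
    using cm.cone.acyc_trans[OF sub(5) subM sub(6) m1 m2 c1 cone_BUW_BU] .
  then have "cm.cone.acyc (coinv_cone Y) (coinv_cone Y') n" for n
    using cm.cone.acyc_trans[OF sub(5,6,7) coinv_cone_mono[OF UY] coinv_cone_mono[OF Y'U] _ c3] by blast
  then have C: "cm.cone.acyc (coinv_cone Y) (coinv_cone Fix) n" for n
    using cm.cone.acyc_trans[OF sub(5,7,8) coinv_cone_mono[OF Y'Y] coinv_cone_mono[OF Fix_Y']] good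
    unfolding good_def by blast
  obtain N' where N': "\<And>n. n \<ge> N' \<Longrightarrow> acyc (ch Y') (ch Fix) n"
    "\<And>n. n \<ge> N' \<Longrightarrow> acyc (coinv (ch Y')) (coinv (ch Fix)) n"
    using good unfolding good_def by blast
  have B: "acyc (ch Y) (ch Fix) n" "acyc (coinv (ch Y)) (coinv (ch Fix)) n" if n: "n \<ge> max N N'" for n
  proof -
    have nN: "n \<ge> N" "n \<ge> N'"
      using n by auto
    have "acyc (ch Y) (ch U) n"
      using acyc_trans[OF sub(3,4,3) sBUW_Y sBU_BUW exc acyc_BUW_BU[OF H[OF nN(1)]]] .
    then have "acyc (ch Y) (ch Y') n"
      using acyc_trans[OF sub(3,3,3) ch_mono[OF UY] ch_mono[OF Y'U] _ ret] by blast
    then show "acyc (ch Y) (ch Fix) n"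
      using acyc_trans[OF sub(3,3,3) ch_mono[OF Y'Y] ch_mono[OF Fix_Y'] _ N'(1)[OF nN(2)]] by blast
    have "acyc (coinv (ch Y)) (coinv (ch U)) n"
      using acyc_trans[OF sub(1,2,1) coinvBUW 1 acyc_coinv_BUW_BU[OF H[OF nN(1)]]] .
    then have "acyc (coinv (ch Y)) (coinv (ch Y')) n"
      using acyc_trans[OF sub(1,1,1) coinv_mono[OF ch_mono[OF UY]] coinv_mono[OF ch_mono[OF Y'U]] _ 2] by blast
    then show "acyc (coinv (ch Y)) (coinv (ch Fix)) n"
      using acyc_trans[OF sub(1,1,1) coinv_mono[OF ch_mono[OF Y'Y]] coinv_mono[OF ch_mono[OF Fix_Y']] _ N'(2)[OF nN(2)]]
      by blast
  qed
  show ?thesis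
    unfolding good_def using B C by blast
qed

end

context orbit_map
begin

text \<open>\<open>smith_theorem\<close> makes the source \<open>S / ker N\<close> of the comparison
  acyclic. The comparison is a quasi-isomorphism relative to \<open>Fix\<close> by
  \<open>good\<close>, and on \<open>Fix\<close> itself by \<open>cone_Fix\<close>;
  \<open>acyc_from_cone\<close> combines the two facts.\<close>

theorem acyclic_quotient:
  assumes good: "good (topspace X)" and surj: "q ` topspace X = topspace Q"
    and homeo: "homeomorphic_map (subtopology X Fix) (subtopology Q (q ` Fix)) q"
    and ac: "\<And>n. acyc (schain X) (\<lambda>_. {0}) n"
  shows "sing.acyc (schain Q) (\<lambda>_. {0}) n"
proof -
  have FX: "Fix \<subseteq> topspace X"
    by (auto simp: Fix_def)
  have "x \<in> coinv (schain X) n \<longleftrightarrow> x \<in> schain X n" for x n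
    using stableD(3)[OF stable_S] by (auto simp: coinv_def)
  then have top: "coinv (schain X) = schain X" "ch (topspace X) = schain X"
    "qch (q ` topspace X) = schain Q"
    by (auto simp: surj)
  obtain N where N: "\<And>n. n \<ge> N \<Longrightarrow> acyc (schain X) (ch Fix) n"
    "\<And>n. n \<ge> N \<Longrightarrow> acyc (schain X) (coinv (ch Fix)) n"
    using conjunct2[OF good[unfolded good_def]] unfolding top by meson
  have SK: "acyc (schain X) (coinv (\<lambda>_. {0})) n" for n
    using smith_theorem[OF ac N] .
  have zero: "subcomplex (\<lambda>_. {0})" "sing.subcomplex (\<lambda>_. {0::'b chain})"
    by (auto simp: subcomplex_def sing.subcomplex_def subgrp_def)
  \<comment> \<open>The projection of the norm of \<open>x\<close> is \<open>p\<close> times the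
    projection of \<open>x\<close>, and chains of the quotient have no torsion.\<close>
  have fK: "basis_map (smap q n) x = 0" if "x \<in> coinv (\<lambda>_. {0}) n" for n x
  proof -
    have x: "x \<in> schain X n" "norm_map p (basis_map (smap g n)) x = 0"
      using that by (auto simp: coinv_def)
    have "basis_map (smap q n) (norm_map p (basis_map (smap g n)) x) = (\<Sum>i<p. basis_map (smap q n) x)"
      unfolding norm_map_def q_sum q_basis_gp[OF x(1)] ..
    then have "int p * Poly_Mapping.lookup (basis_map (smap q n) x) b = 0" for b
      using x(2) lookup_sum[of "\<lambda>_. basis_map (smap q n) x" "{..<p}" b] by simp
    then show ?thesis
      using pm.p_pos by (intro poly_mapping_eqI) simp
  qed
  have fS: "basis_map (smap q n) x \<in> schain Q n" if "x \<in> schain X n" for n x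
    using basis_map_supp[OF smap_sbasis[OF cont_q] that] .
  have K: "subcomplex (coinv (\<lambda>_. {0}))"
    using coinv_subcomplex[OF zero(1)] .
  have subK: "cm.cone.subcomplex (cm.cone (coinv (\<lambda>_. {0})) (\<lambda>_. {0}))"
    using fK q_chain coinv_subset by (intro cm.cone_subcomplex K zero) blast+
  have mono: "coinv_cone Fix n \<subseteq> coinv_cone (topspace X) n" for n
    using coinv_cone_mono[OF FX] .
  have mono0: "cm.cone (coinv (\<lambda>_. {0})) (\<lambda>_. {0}) n \<subseteq> coinv_cone Fix n" for n
    by (intro cone_mono coinv_mono) (simp_all add: subgrp_0 subgrp_supp)
  have gd: "cm.cone.acyc (coinv_cone (topspace X)) (coinv_cone Fix) n" for n
    using conjunct1[OF good[unfolded good_def]] by blast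
  have "cm.cone.acyc (coinv_cone (topspace X)) (cm.cone (coinv (\<lambda>_. {0})) (\<lambda>_. {0})) n" for n
    using cm.cone.acyc_trans[OF coinv_cone_subcomplex[OF g_top order_refl FX]
        coinv_cone_subcomplex[OF g_Fix FX order_refl] subK mono mono0 gd cone_Fix[OF homeo]] .
  then have cone: "cm.cone.acyc (cm.cone (schain X) (schain Q)) (cm.cone (coinv (\<lambda>_. {0})) (\<lambda>_. {0})) n" for n
    unfolding top .
  show ?thesis
    by (rule cm.acyc_from_cone[OF subcomplex_schain subcomplex_schain K cone SK fK fS q_chain])
qed

end

section \<open>Reduced homology\<close>

lemma supp_singleton: "x \<in> supp {b} \<Longrightarrow> x = frag_cmul (Poly_Mapping.lookup x b) (frag_of b)"
  by (intro poly_mapping_eqI) (auto simp: lookup_supp)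

lemma trivial_homology_imp_boundary:
  assumes "x \<in> carrier (relative_homology_group (int p) X {}) \<Longrightarrow> x = \<one>\<^bsub>relative_homology_group (int p) X {}\<^esub>"
    and "x = homologous_rel_set p X {} c" "singular_relcycle p X {} c"
  obtains y where "singular_chain (Suc p) X y" "chain_boundary (Suc p) y = c"
proof -
  have "x \<in> carrier (relative_homology_group (int p) X {})"
    using assms(2,3) by (auto simp: carrier_relative_homology_group)
  then have "homologous_rel_set p X {} c = singular_relboundary_set p X {}"
    using assms by simp
  then have "singular_relboundary p X {} c"
    using homologous_rel_set_eq_relboundary by blast
  then show thesis
    using that by (auto simp: singular_boundary)
qed

lemma acyc_homology:
  assumes "trivial_group (homology_group (int (Suc k)) X)"
  shows "sing.acyc (schain X) (\<lambda>_. {0}) (Suc (Suc k))"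
  unfolding sing.acyc_def
proof (intro ballI impI)
  fix c assume c: "c \<in> schain X (Suc (Suc k))" "sd (Suc (Suc k)) c \<in> {0}"
  have "singular_relcycle (Suc k) X {} c"
    using c by (simp add: singular_cycle)
  then obtain y where "singular_chain (Suc (Suc k)) X y" "chain_boundary (Suc (Suc k)) y = c"
    using assms trivial_homology_imp_boundary[of _ "Suc k" X c] unfolding trivial_group_def
    by (metis singletonD)
  then show "\<exists>y\<in>schain X (Suc (Suc (Suc k))). c - sd (Suc (Suc (Suc k))) y \<in> {0}"
    by (intro bexI[of _ y]) simp_all
qed

lemma point_chain_zero:
  assumes "sd (Suc 0) c = 0"
  shows "chain_map 0 (\<lambda>x. ()) c = 0"
proof -
  \<comment> \<open>There is only one function into the one-point type, so each simplex of the point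
    is literally \<open>empty_simplex\<close> and the map to the point becomes the
    augmentation.\<close>
  have "chain_map 0 (\<lambda>x. ()) c = frag_extend (\<lambda>_. frag_of empty_simplex) (chain_map 0 (\<lambda>x. ()) c)"
    by (subst frag_expansion) (intro frag_extend_eq arg_cong[of _ _ frag_of] ext, simp)
  also have "\<dots> = basis_map (\<lambda>_. empty_simplex) (sd (Suc 0) c)"
    using subset_UNIV[of "Poly_Mapping.keys c"]
    by (induction c rule: frag_induction)
      (simp_all add: basis_map_diff frag_extend_diff chain_map_diff)
  finally show ?thesis
    using assms by simp
qed

lemma augmentation_zero:
  assumes "chain_map 0 (\<lambda>x. ()) c = 0"
  shows "sd (Suc 0) c = 0"
proof -
  have "sd (Suc 0) c = basis_map (\<lambda>_. empty_simplex) (chain_map 0 (\<lambda>x. ()) c)"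
    using subset_UNIV[of "Poly_Mapping.keys c"]
    by (induction c rule: frag_induction)
      (simp_all add: basis_map_diff frag_extend_diff chain_map_diff)
  then show ?thesis
    using assms by simp
qed

lemma continuous_to_point: "continuous_map X (discrete_topology {()}) (\<lambda>x. ())"
  by simp

text \<open>Reduced homology is the kernel of the map to the homology of a point. A 0-chain of the
  point that bounds has augmentation zero and therefore vanishes, so this kernel consists of the
  classes of augmentation zero.\<close>

lemma reduced_homology_0:
  assumes "singular_relcycle 0 X {} c"
  shows "homologous_rel_set 0 X {} c \<in> carrier (reduced_homology_group 0 X) \<longleftrightarrow> sd (Suc 0) c = 0"
proof -
  have ind: "hom_induced (int 0) X {} (discrete_topology {()}) {} (\<lambda>x. ()) (homologous_rel_set 0 X {} c) =
      homologous_rel_set 0 (discrete_topology {()}) {} (chain_map 0 (\<lambda>x. ()) c)"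
    using assms by (intro hom_induced_chain_map continuous_to_point) auto
  have "singular_relboundary 0 (discrete_topology {()}) {} (chain_map 0 (\<lambda>x. ()) c) \<longleftrightarrow> sd (Suc 0) c = 0"
  proof
    assume "singular_relboundary 0 (discrete_topology {()}) {} (chain_map 0 (\<lambda>x. ()) c)"
    then obtain y where y: "singular_chain (Suc 0) (discrete_topology {()}) y"
      "chain_boundary (Suc 0) y = chain_map 0 (\<lambda>x. ()) c"
      by (auto simp: singular_boundary)
    have "sd (Suc 0) (sd (Suc (Suc 0)) y) = 0"
      using sing.subcomplexD(5)[OF subcomplex_schain[of "discrete_topology {()}"], of y "Suc 0"] y(1) by simp
    then have "sd (Suc 0) (chain_map 0 (\<lambda>x. ()) c) = 0"
      using y(2) by simp
    then have "chain_map 0 (\<lambda>x. ()) (chain_map 0 (\<lambda>x. ()) c) = 0"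
      by (rule point_chain_zero)
    then have "chain_map 0 ((\<lambda>x. ()) \<circ> (\<lambda>x. ())) c = 0"
      by (simp only: chain_map_compose comp_apply)
    then show "sd (Suc 0) c = 0"
      by (intro augmentation_zero) (simp add: comp_def)
  qed (simp add: point_chain_zero)
  then show ?thesis
    using ind assms one_relative_homology_group[of 0 "discrete_topology {()}" "{}"]
    by (auto simp: carrier_reduced_homology_group kernel_def carrier_relative_homology_group_0
        homologous_rel_set_eq_relboundary)
qed

text \<open>In degree 0 acyclicity means that the augmentation is onto, which takes a point of
  \<open>X\<close>. Degree 1 is reduced homology in degree 0; above it, reduced and unreduced
  homology agree.\<close>

lemma acyc_of_reduced_homology:
  assumes red: "\<And>n::int. trivial_group (reduced_homology_group n X)" and ne: "topspace X \<noteq> {}"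
  shows "sing.acyc (schain X) (\<lambda>_. {0}) n"
proof (cases n)
  case 0
  obtain a where a: "a \<in> topspace X"
    using ne by blast
  define s where "s = restrict (\<lambda>_::nat \<Rightarrow> real. a) (standard_simplex 0)"
  have s: "singular_simplex 0 X s"
    using a by (simp add: s_def singular_simplex_def)
  show ?thesis
    unfolding sing.acyc_def
  proof (intro ballI impI)
    fix x :: "'a chain" assume "x \<in> schain X n"
    then have "x = frag_cmul (Poly_Mapping.lookup x empty_simplex) (frag_of empty_simplex)"
      using 0 supp_singleton by simp
    then have "x - sd (Suc n) (frag_cmul (Poly_Mapping.lookup x empty_simplex) (frag_of s)) = 0"
      using 0 by (simp add: frag_extend_cmul)
    moreover have "frag_cmul (Poly_Mapping.lookup x empty_simplex) (frag_of s) \<in> schain X (Suc n)"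
      using s 0 by (intro supp_cmul) (simp add: singular_chain_of)
    ultimately show "\<exists>y\<in>schain X (Suc n). x - sd (Suc n) y \<in> {0}"
      by blast
  qed
next
  case (Suc m)
  show ?thesis
  proof (cases m)
    case 0
    show ?thesis
      unfolding sing.acyc_def
    proof (intro ballI impI)
      fix c assume c: "c \<in> schain X n" "sd n c \<in> {0}"
      have rc: "singular_relcycle 0 X {} c"
        using c Suc 0 by (simp add: singular_cycle chain_boundary_def)
      have "sd (Suc 0) c = 0"
        using c(2) Suc 0 by simp
      then have "homologous_rel_set 0 X {} c \<in> carrier (reduced_homology_group 0 X)"
        using reduced_homology_0[OF rc] by blast
      then have "homologous_rel_set 0 X {} c = \<one>\<^bsub>homology_group 0 X\<^esub>"
        using red[of 0] by (simp add: trivial_group_def one_reduced_homology_group)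
      then obtain y where "singular_chain (Suc 0) X y" "chain_boundary (Suc 0) y = c"
        using trivial_homology_imp_boundary[of "homologous_rel_set 0 X {} c" 0 X c] rc by auto
      then show "\<exists>y\<in>schain X (Suc n). c - sd (Suc n) y \<in> {0}"
        using Suc 0 by (intro bexI[of _ y]) simp_all
    qed
  next
    case (Suc k)
    have "trivial_group (homology_group (int (Suc k)) X)"
      using red[of "int (Suc k)"] un_reduced_homology_group[of "int (Suc k)" X] by simp
    then show ?thesis
      using acyc_homology \<open>n = Suc m\<close> Suc by blast
  qed
qed

lemma reduced_homology_of_acyc:
  assumes ac: "\<And>n. sing.acyc (schain X) (\<lambda>_. {0}) n"
  shows "trivial_group (reduced_homology_group n X)"
proof (cases "n < 0")
  case True
  then show ?thesis
    by (rule trivial_reduced_homology_group)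
next
  case False
  then obtain m where m: "n = int m"
    by (metis int_nat_eq not_le)
  have *: "x = \<one>\<^bsub>homology_group n X\<^esub>" if x: "x \<in> carrier (reduced_homology_group n X)" for x
  proof -
    have "x \<in> carrier (homology_group (int m) X)"
      using x carrier_reduced_homology_group_subset m by blast
    then obtain c where c: "singular_relcycle m X {} c" "x = homologous_rel_set m X {} c"
      by (auto simp: carrier_relative_homology_group)
    have "sd (Suc m) c = 0"
    proof (cases m)
      case 0
      then show ?thesis
        using reduced_homology_0[of X c] c x m by simp
    next
      case (Suc k)
      then show ?thesis
        using c(1) by (simp add: singular_cycle)
    qed
    moreover have "c \<in> schain X (Suc m)"
      using c(1) by (simp add: singular_cycle)
    ultimately obtain y where y: "y \<in> schain X (Suc (Suc m))" "c - sd (Suc (Suc m)) y \<in> {0}"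
      using sing.acycD[OF ac[of "Suc m"]] by (metis singletonI)
    then have "singular_relboundary m X {} c"
      by (auto simp: singular_boundary)
    then show ?thesis
      using c(2) m homologous_rel_set_eq_relboundary[of m X "{}" c] by simp
  qed
  have one: "\<one>\<^bsub>reduced_homology_group n X\<^esub> \<in> carrier (reduced_homology_group n X)"
    by (rule monoid.one_closed[OF group.is_monoid[OF group_reduced_homology_group]])
  have "carrier (reduced_homology_group n X) = {\<one>\<^bsub>reduced_homology_group n X\<^esub>}"
  proof
    show "carrier (reduced_homology_group n X) \<subseteq> {\<one>\<^bsub>reduced_homology_group n X\<^esub>}"
      using * unfolding one_reduced_homology_group by blast
  qed (use one in blast)
  then show ?thesis
    using group_reduced_homology_group by (simp add: trivial_group_def)
qed

text \<open>Exactness of H_{n+1}(A) -> H_{n+1}(A/B) -> H_n(B) at the middle term.\<close>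

lemma acyc_pair:
  assumes "sing.subcomplex A" "sing.subcomplex B" "\<And>n. B n \<subseteq> A n"
    and A: "sing.acyc A (\<lambda>_. {0}) (Suc n)" and B: "sing.acyc B (\<lambda>_. {0}) n"
  shows "sing.acyc A B (Suc n)"
  unfolding sing.acyc_def
proof (intro ballI impI)
  fix x assume x: "x \<in> A (Suc n)" "sd (Suc n) x \<in> B (Suc n - 1)"
  have "sd n (sd (Suc n) x) = 0"
    using sing.subcomplexD(5)[OF assms(1) x(1)] .
  then obtain y where y: "y \<in> B (Suc n)" "sd (Suc n) x - sd (Suc n) y \<in> {0}"
    using sing.acycD[OF B, of "sd (Suc n) x"] x(2) by (metis diff_Suc_1 singletonI)
  have "x - y \<in> A (Suc n)"
    using subgrp_diff[OF sing.subcomplexD(1)[OF assms(1)] x(1)] y(1) assms(3) by blast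
  moreover have "sd (Suc n) (x - y) \<in> {0}"
    using y(2) by (simp add: sing.d_diff)
  ultimately obtain z where "z \<in> A (Suc (Suc n))" "x - y - sd (Suc (Suc n)) z \<in> {0}"
    using sing.acycD[OF A] by blast
  then show "\<exists>z\<in>A (Suc (Suc n)). x - sd (Suc (Suc n)) z \<in> B (Suc n)"
    using y(1) by (intro bexI[of _ z]) (auto simp: algebra_simps)
qed

section \<open>Discs\<close>

definition dnorm :: "nat \<Rightarrow> (nat \<Rightarrow> real) \<Rightarrow> real" where
  "dnorm n v = sqrt (\<Sum>i<n. v i ^ 2)"

definition origin :: "nat \<Rightarrow> real" where
  "origin = (\<lambda>_. 0)"

lemma Euclidean_top_of_set: "Euclidean_space n = top_of_set {x. \<forall>i\<ge>n. x i = 0}"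
  by (simp add: Euclidean_space_def euclidean_product_topology)

lemma sum_squares_nonneg: "0 \<le> (\<Sum>i<n. (v i :: real) ^ 2)"
  by (simp add: sum_nonneg)

lemma dnorm_nonneg [simp]: "0 \<le> dnorm n v"
  by (simp add: dnorm_def sum_squares_nonneg)

lemma dnorm_scale: "dnorm n (\<lambda>i. c * v i) = \<bar>c\<bar> * dnorm n v"
  by (simp add: dnorm_def power_mult_distrib real_sqrt_mult flip: sum_distrib_left)

lemma closed_disc_eq: "closed_disc n = top_of_set {x. (\<forall>i\<ge>n. x i = 0) \<and> dnorm n x \<le> 1}"
  by (simp add: closed_disc_def Euclidean_top_of_set subtopology_subtopology dnorm_def Int_def)

lemma open_disc_eq: "open_disc n = top_of_set {x. (\<forall>i\<ge>n. x i = 0) \<and> dnorm n x < 1}"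
  by (simp add: open_disc_def Euclidean_top_of_set subtopology_subtopology dnorm_def Int_def)

lemma topspace_closed_disc: "topspace (closed_disc n) = {x. (\<forall>i\<ge>n. x i = 0) \<and> dnorm n x \<le> 1}"
  by (simp add: closed_disc_eq)

lemma topspace_open_disc: "topspace (open_disc n) = {x. (\<forall>i\<ge>n. x i = 0) \<and> dnorm n x < 1}"
  by (simp add: open_disc_eq)

lemma disc_boundary_eq: "disc_boundary n = {x. (\<forall>i\<ge>n. x i = 0) \<and> dnorm n x = 1}"
  by (auto simp: disc_boundary_def topspace_closed_disc topspace_open_disc)

lemma open_subset_closed_disc: "topspace (open_disc n) \<subseteq> topspace (closed_disc n)"
  by (auto simp: topspace_closed_disc topspace_open_disc)

lemma closed_disc_cases:
  assumes "v \<in> topspace (closed_disc n)"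
  obtains "v \<in> topspace (open_disc n)" | "v \<in> disc_boundary n"
  using assms by (auto simp: disc_boundary_def)

lemma dnorm_origin [simp]: "dnorm n origin = 0"
  by (simp add: dnorm_def origin_def)

lemma origin_open_disc [simp]: "origin \<in> topspace (open_disc n)"
  by (simp add: topspace_open_disc) (simp add: origin_def)

lemma origin_closed_disc [simp]: "origin \<in> topspace (closed_disc n)"
  using open_subset_closed_disc origin_open_disc by blast

lemma dnorm_eq_0:
  assumes "\<forall>i\<ge>n. v i = 0"
  shows "dnorm n v = 0 \<longleftrightarrow> v = origin"
proof
  assume "dnorm n v = 0"
  then have "(\<Sum>i<n. v i ^ 2) = 0"
    by (simp add: dnorm_def)
  then have "\<forall>i<n. v i = 0"
    by (simp add: sum_nonneg_eq_0_iff)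
  with assms show "v = origin"
    unfolding origin_def by (meson ext not_le)
qed simp

lemma continuous_on_dnorm [continuous_intros]:
  assumes "continuous_on S f"
  shows "continuous_on S (\<lambda>x. dnorm n (f x))"
proof -
  have "continuous_on S (\<lambda>x. f x i)" for i
    using assms by (rule continuous_on_product_then_coordinatewise)
  then show ?thesis
    unfolding dnorm_def by (intro continuous_intros)
qed

lemma compact_closed_disc: "compact_space (closed_disc n)"
proof -
  have sub: "{x. (\<forall>i\<ge>n. x i = 0) \<and> dnorm n x \<le> 1} \<subseteq> PiE UNIV (\<lambda>_. {-1..1})"
  proof
    fix x :: "nat \<Rightarrow> real" assume x: "x \<in> {x. (\<forall>i\<ge>n. x i = 0) \<and> dnorm n x \<le> 1}"
    have "x i \<in> {-1..1}" for i
    proof (cases "i < n")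
      case True
      have "x i ^ 2 \<le> (\<Sum>i<n. x i ^ 2)"
        using True by (intro member_le_sum) auto
      also have "\<dots> \<le> 1"
        using x by (simp add: dnorm_def)
      finally show ?thesis
        by (simp add: abs_square_le_1 abs_le_iff)
    next
      case False
      then show ?thesis
        using x by simp
    qed
    then show "x \<in> PiE UNIV (\<lambda>_. {-1..1})"
      by auto
  qed
  have "closed ({x::nat \<Rightarrow> real. dnorm n x \<le> 1} \<inter> (\<Inter>i\<in>{n..}. {x. x i = 0}))"
    by (intro closed_Int closed_INT ballI closed_Collect_le closed_Collect_eq continuous_intros continuous_on_id
        continuous_on_product_coordinates)
  moreover have "{x::nat \<Rightarrow> real. dnorm n x \<le> 1} \<inter> (\<Inter>i\<in>{n..}. {x. x i = 0}) = {x. (\<forall>i\<ge>n. x i = 0) \<and> dnorm n x \<le> 1}"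
    by auto
  ultimately have closed: "closed {x::nat \<Rightarrow> real. (\<forall>i\<ge>n. x i = 0) \<and> dnorm n x \<le> 1}"
    by simp
  have "compactin (powertop_real UNIV) (PiE UNIV (\<lambda>_::nat. {-1..1::real}))"
    by (simp add: compactin_PiE)
  then have "compact (PiE UNIV (\<lambda>_::nat. {-1..1::real}))"
    by (simp add: euclidean_product_topology)
  then have "compact {x::nat \<Rightarrow> real. (\<forall>i\<ge>n. x i = 0) \<and> dnorm n x \<le> 1}"
    using compact_Int_closed[OF _ closed, of "PiE UNIV (\<lambda>_::nat. {-1..1::real})"] Int_absorb1[OF sub] by metis
  then show ?thesis
    by (simp add: closed_disc_eq compact_space_subtopology)
qed

text \<open>Runs along a ray, linearly from \<open>v / |v|\<close> at \<open>t = 0\<close> to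
  \<open>v\<close> at \<open>t = 1\<close>; points of the unit sphere stay fixed.\<close>

definition radial :: "nat \<Rightarrow> real \<times> (nat \<Rightarrow> real) \<Rightarrow> (nat \<Rightarrow> real)" where
  "radial n = (\<lambda>(t, v) i. (t + (1 - t) / dnorm n v) * v i)"

lemma radial_1 [simp]: "radial n (1, v) = v"
  by (simp add: radial_def)

lemma radial_boundary: "v \<in> disc_boundary n \<Longrightarrow> radial n (t, v) = v"
  by (simp add: radial_def disc_boundary_eq)

lemma dnorm_radial:
  assumes "dnorm n v \<noteq> 0" "t \<in> {0..1}"
  shows "dnorm n (radial n (t, v)) = t * dnorm n v + (1 - t)"
proof -
  have "t + (1 - t) / dnorm n v \<ge> 0"
    using assms dnorm_nonneg[of n v] by (intro add_nonneg_nonneg divide_nonneg_nonneg) auto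
  then show ?thesis
    using assms dnorm_scale[of n "t + (1 - t) / dnorm n v" v]
    by (simp add: radial_def distrib_right)
qed

lemma radial_closed_disc:
  assumes v: "v \<in> topspace (closed_disc n) - {origin}" and t: "t \<in> {0..1}"
  shows "radial n (t, v) \<in> topspace (closed_disc n) - {origin}"
    and "t = 0 \<Longrightarrow> radial n (t, v) \<in> disc_boundary n"
proof -
  have nz: "dnorm n v \<noteq> 0" and le: "dnorm n v \<le> 1" and z: "\<forall>i\<ge>n. v i = 0"
    using v dnorm_eq_0[of n v] by (auto simp: topspace_closed_disc)
  have pos: "dnorm n v > 0"
    using nz dnorm_nonneg[of n v] by linarith
  have "t * dnorm n v + (1 - t) \<le> t * 1 + (1 - t)"
    using le t by (intro add_right_mono mult_left_mono) auto
  moreover have "t * dnorm n v + (1 - t) \<noteq> 0"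
  proof
    assume *: "t * dnorm n v + (1 - t) = 0"
    have "t * dnorm n v \<ge> 0" "1 - t \<ge> 0"
      using t by auto
    then have "t = 1" "t * dnorm n v = 0"
      using * by linarith+
    then show False
      using nz by simp
  qed
  moreover have z': "\<forall>i\<ge>n. radial n (t, v) i = 0"
    using z by (simp add: radial_def)
  ultimately show "radial n (t, v) \<in> topspace (closed_disc n) - {origin}"
    using dnorm_radial[OF nz t] dnorm_eq_0[of n "radial n (t, v)"] by (auto simp: topspace_closed_disc)
  show "radial n (t, v) \<in> disc_boundary n" if "t = 0"
    using dnorm_radial[OF nz t] that z' by (simp add: disc_boundary_eq)
qed

lemma continuous_radial:
  assumes "\<And>t v. (t, v) \<in> S \<Longrightarrow> dnorm n v \<noteq> 0"
  shows "continuous_on S (radial n)"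
proof -
  have snd: "continuous_on S (\<lambda>p. snd p i)" for i
    by (intro continuous_on_product_then_coordinatewise[of S snd] continuous_intros)
  have "continuous_on S (\<lambda>p. (fst p + (1 - fst p) / dnorm n (snd p)) * snd p i)" for i
    using assms by (intro continuous_intros snd) (metis prod.collapse)
  then have "continuous_on S (\<lambda>p i. (fst p + (1 - fst p) / dnorm n (snd p)) * snd p i)"
    by (rule continuous_on_coordinatewise_then_product)
  then show ?thesis
    by (simp add: radial_def case_prod_unfold)
qed

text \<open>
  Radial projection away from the centres deforms \<open>U\<close>, obtained from \<open>Y\<close> by attaching
  finitely many punctured cells, onto \<open>Y\<close>.
\<close>

lemma punctured_retract:
  assumes Z: "Hausdorff_space Z" and I: "finite I" and Y: "closedin Z Y"
    and \<Phi>: "\<And>i. i \<in> I \<Longrightarrow> continuous_map (closed_disc n) Z (\<Phi> i)"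
    and bd: "\<And>i. i \<in> I \<Longrightarrow> \<Phi> i ` disc_boundary n \<subseteq> Y"
    and inj: "\<And>i. i \<in> I \<Longrightarrow> inj_on (\<Phi> i) (topspace (open_disc n))"
    and disjY: "\<And>i. i \<in> I \<Longrightarrow> \<Phi> i ` topspace (open_disc n) \<inter> Y = {}"
    and disj: "\<And>i j. i \<in> I \<Longrightarrow> j \<in> I \<Longrightarrow> i \<noteq> j \<Longrightarrow>
      \<Phi> i ` topspace (open_disc n) \<inter> \<Phi> j ` topspace (open_disc n) = {}"
    and U: "U = Y \<union> (\<Union>i\<in>I. \<Phi> i ` (topspace (open_disc n) - {origin}))"
  shows "trivial_group (relative_homology_group k (subtopology Z U) Y)"
proof -
  define ZU where "ZU = subtopology Z U"
  define V where "V = topspace (closed_disc n) - {origin}"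
  have im: "\<Phi> i v \<in> topspace Z" if "i \<in> I" "v \<in> topspace (closed_disc n)" for i v
    using \<Phi>[OF that(1)] that(2) by (auto simp: continuous_map_def)
  have UZ: "U \<subseteq> topspace Z"
    using closedin_subset[OF Y] im open_subset_closed_disc unfolding U by blast
  have topU: "topspace ZU = U"
    using UZ by (auto simp: ZU_def)
  \<comment> \<open>The cell and the disc coordinate of a point in an open cell, unique by
    \<open>disj\<close> and \<open>inj\<close>.\<close>
  define sel where "sel x = (SOME q. fst q \<in> I \<and> snd q \<in> topspace (open_disc n) \<and> x = \<Phi> (fst q) (snd q))" for x
  have sel: "sel (\<Phi> i v) = (i, v)" if iv: "i \<in> I" "v \<in> topspace (open_disc n)" for i v
    unfolding sel_def
  proof (rule some_equality)
    fix q assume q: "fst q \<in> I \<and> snd q \<in> topspace (open_disc n) \<and> \<Phi> i v = \<Phi> (fst q) (snd q)"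
    then have "fst q = i"
      using disj[of i "fst q"] iv by blast
    moreover from this have "snd q = v"
      using inj_onD[OF inj[OF iv(1)]] q iv by metis
    ultimately show "q = (i, v)"
      by (metis prod.collapse)
  qed (use iv in simp)
  define h where "h = (\<lambda>(t, x). if x \<in> (\<Union>i\<in>I. \<Phi> i ` topspace (open_disc n))
      then \<Phi> (fst (sel x)) (radial n (t, snd (sel x))) else x)"
  \<comment> \<open>The formula persists on the boundary sphere, where \<open>radial\<close> is the
    identity. So one function \<open>h\<close> serves on all closed pieces of the pasting below, and
    only its continuity on each piece is left to show.\<close>
  have h_cell: "h (t, \<Phi> i v) = \<Phi> i (radial n (t, v))" if iv: "i \<in> I" "v \<in> topspace (closed_disc n)" for t i v
    using iv(2)
  proof (cases rule: closed_disc_cases)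
    case 1
    then show ?thesis
      using iv(1) sel by (auto simp: h_def)
  next
    case 2
    then have "\<Phi> i v \<in> Y"
      using bd iv(1) by blast
    then have "\<Phi> i v \<notin> (\<Union>i\<in>I. \<Phi> i ` topspace (open_disc n))"
      using disjY by blast
    then show ?thesis
      using 2 radial_boundary by (simp add: h_def)
  qed
  have h_Y: "h (t, x) = x" if "x \<in> Y" for t x
    using disjY that by (auto simp: h_def)
  have h_1: "h (1, x) = x" for x
    using sel by (auto simp: h_def)
  have VU: "\<Phi> i v \<in> U \<longleftrightarrow> v \<in> V" if iv: "i \<in> I" "v \<in> topspace (closed_disc n)" for i v
    using iv(2)
  proof (cases rule: closed_disc_cases)
    case 1
    have "\<Phi> i origin \<notin> U"
    proof
      assume "\<Phi> i origin \<in> U"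
      moreover have "\<Phi> i origin \<notin> Y"
        using disjY[OF iv(1)] origin_open_disc by blast
      ultimately obtain j w where jw: "j \<in> I" "w \<in> topspace (open_disc n)" "w \<noteq> origin" "\<Phi> i origin = \<Phi> j w"
        unfolding U by blast
      then show False
        using sel[OF iv(1) origin_open_disc] sel[OF jw(1,2)] by simp
    qed
    then show ?thesis
      using 1 iv by (auto simp: V_def U)
  next
    case 2
    then have "\<Phi> i v \<in> U" "v \<noteq> origin"
      using bd iv(1) by (auto simp: U disc_boundary_eq)
    then show ?thesis
      using iv by (simp add: V_def)
  qed
  have cont: "continuous_map (prod_topology (top_of_set {0..1}) ZU) ZU h"
  proof (rule pasting_lemma_closed[where I = "insert None (Some ` I)" and f = "\<lambda>_. h"
        and T = "\<lambda>j. {0..1} \<times> (case j of None \<Rightarrow> Y | Some i \<Rightarrow> U \<inter> \<Phi> i ` topspace (closed_disc n))"])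
    show "finite (insert None (Some ` I))"
      using I by simp
    fix j assume j: "j \<in> insert None (Some ` I)"
    have closed_cell: "closedin Z (\<Phi> i ` topspace (closed_disc n))" if "i \<in> I" for i
      using that \<Phi> Z compact_closed_disc
      by (meson compactin_imp_closedin compact_space_def image_compactin)
    have "closedin ZU (case j of None \<Rightarrow> Y | Some i \<Rightarrow> U \<inter> \<Phi> i ` topspace (closed_disc n))"
    proof (cases j)
      case None
      have "Y = U \<inter> Y"
        by (auto simp: U)
      then show ?thesis
        using Y None unfolding ZU_def by (metis closedin_subtopology_Int_closed option.simps(4))
    next
      case (Some i)
      then show ?thesis
        using closed_cell j unfolding ZU_def by (auto intro: closedin_subtopology_Int_closed)
    qed
    then show "closedin (prod_topology (top_of_set {0..1}) ZU)
        ({0..1} \<times> (case j of None \<Rightarrow> Y | Some i \<Rightarrow> U \<inter> \<Phi> i ` topspace (closed_disc n)))"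
      by (metis closedin_prod_Times_iff closedin_topspace topspace_euclidean_subtopology)
    show "continuous_map (subtopology (prod_topology (top_of_set {0..1}) ZU)
        ({0..1} \<times> (case j of None \<Rightarrow> Y | Some i \<Rightarrow> U \<inter> \<Phi> i ` topspace (closed_disc n)))) ZU h"
    proof (cases j)
      case None
      have "continuous_map (subtopology (prod_topology (top_of_set {0..1}) ZU) ({0..1} \<times> Y)) ZU snd"
        by (intro continuous_map_from_subtopology continuous_map_snd)
      then have "continuous_map (subtopology (prod_topology (top_of_set {0..1}) ZU) ({0..1} \<times> Y)) ZU h"
        by (rule continuous_map_eq) (auto simp: h_Y)
      then show ?thesis
        using None by simp
    next
      case (Some i)
      then have i: "i \<in> I"
        using j by auto
      define C where "C = U \<inter> \<Phi> i ` topspace (closed_disc n)"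
      have pre: "{v \<in> topspace (closed_disc n). \<Phi> i v \<in> C} = V"
        using VU[OF i] by (auto simp: C_def V_def)
      \<comment> \<open>The disc is compact, so \<open>\<Phi> i\<close> is proper; this survives the
        restriction to \<open>V\<close> because \<open>V\<close> is the full preimage of
        \<open>C\<close>.\<close>
      have "proper_map (closed_disc n) Z (\<Phi> i)"
        using compact_closed_disc \<Phi>[OF i] Z continuous_imp_proper_map Hausdorff_imp_kc_space by blast
      then have proper: "proper_map (subtopology (closed_disc n) V) (subtopology Z C) (\<Phi> i)"
        using pre by (rule proper_map_restriction)
      have contV: "continuous_map (subtopology (closed_disc n) V) (subtopology Z C) (\<Phi> i)"
        using \<Phi>[OF i] pre by (auto simp: continuous_map_in_subtopology continuous_map_from_subtopology)
      have surj: "\<Phi> i ` topspace (subtopology (closed_disc n) V) = topspace (subtopology Z C)"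
        using pre im[OF i] by (auto simp: C_def)
      \<comment> \<open>Continuity of \<open>h\<close> is to descend along a quotient map, but the
        product of a quotient map with an identity is in general no quotient map. Proper maps are
        stable under such products, whence the use of perfect maps.\<close>
      have "perfect_map (prod_topology (top_of_set {0..1::real}) (subtopology (closed_disc n) V))
          (prod_topology (top_of_set {0..1}) (subtopology Z C)) (\<lambda>(t, v). (id t, \<Phi> i v))"
        unfolding perfect_map_def
      proof (intro conjI)
        show "continuous_map (prod_topology (top_of_set {0..1::real}) (subtopology (closed_disc n) V))
          (prod_topology (top_of_set {0..1}) (subtopology Z C)) (\<lambda>(t, v). (id t, \<Phi> i v))"
          using contV by (simp add: continuous_map_prod_top del: id_apply)
        show "proper_map (prod_topology (top_of_set {0..1::real}) (subtopology (closed_disc n) V))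
          (prod_topology (top_of_set {0..1}) (subtopology Z C)) (\<lambda>(t, v). (id t, \<Phi> i v))"
          using proper proper_map_id by (subst proper_map_prod) blast
        show "(\<lambda>(t, v). (id t, \<Phi> i v)) ` topspace (prod_topology (top_of_set {0..1::real}) (subtopology (closed_disc n) V)) =
          topspace (prod_topology (top_of_set {0..1}) (subtopology Z C))"
          unfolding topspace_prod_topology surj[symmetric] by force
      qed
      then have quot: "quotient_map (prod_topology (top_of_set {0..1::real}) (subtopology (closed_disc n) V))
          (prod_topology (top_of_set {0..1}) (subtopology Z C)) (\<lambda>(t, v). (id t, \<Phi> i v))"
        by (rule perfect_imp_quotient_map)
      have VD: "subtopology (closed_disc n) V = top_of_set V"
        by (simp add: closed_disc_eq subtopology_subtopology V_def Int_absorb1 topspace_closed_disc)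
      have V0: "dnorm n v \<noteq> 0" if "v \<in> V" for v
        using that dnorm_eq_0[of n v] by (auto simp: V_def topspace_closed_disc)
      have "continuous_map (top_of_set ({0..1} \<times> V)) (top_of_set V) (radial n)"
        using continuous_radial[of "{0..1} \<times> V" n] V0 radial_closed_disc(1)[of _ n]
        by (auto simp: V_def)
      then have rad: "continuous_map (prod_topology (top_of_set {0..1}) (subtopology (closed_disc n) V))
          (subtopology (closed_disc n) V) (radial n)"
        unfolding VD by simp
      have "continuous_map (prod_topology (top_of_set {0..1}) (subtopology (closed_disc n) V))
          (subtopology Z C) (\<Phi> i \<circ> radial n)"
        using continuous_map_compose[OF rad contV] .
      then have "continuous_map (prod_topology (top_of_set {0..1}) (subtopology (closed_disc n) V))
          (subtopology Z C) (h \<circ> (\<lambda>(t, v). (id t, \<Phi> i v)))"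
      proof (rule continuous_map_eq)
        fix p assume p: "p \<in> topspace (prod_topology (top_of_set {0..1::real}) (subtopology (closed_disc n) V))"
        obtain t v where tv: "p = (t, v)"
          by force
        then have "v \<in> topspace (closed_disc n)"
          using p by simp
        then show "(\<Phi> i \<circ> radial n) p = (h \<circ> (\<lambda>(t, v). (id t, \<Phi> i v))) p"
          using h_cell[OF i] tv by simp
      qed
      then have "continuous_map (prod_topology (top_of_set {0..1}) (subtopology Z C)) (subtopology Z C) h"
        by (rule continuous_compose_quotient_map[OF quot])
      moreover have "subtopology Z C = subtopology ZU C"
        by (simp add: ZU_def C_def subtopology_subtopology inf_assoc)
      ultimately have "continuous_map (prod_topology (top_of_set {0..1}) (subtopology ZU C)) ZU h"
        by (simp add: continuous_map_in_subtopology)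
      then have "continuous_map (subtopology (prod_topology (top_of_set {0..1}) ZU) ({0..1} \<times> C)) ZU h"
        by (simp add: subtopology_Times subtopology_subtopology)
      then show ?thesis
        using Some by (simp add: C_def)
    qed
  next
    fix x assume x: "x \<in> topspace (prod_topology (top_of_set {0..1::real}) ZU)"
    then obtain t y where ty: "x = (t, y)" "t \<in> {0..1}" "y \<in> U"
      using topU by auto
    show "\<exists>j. j \<in> insert None (Some ` I) \<and>
        x \<in> {0..1} \<times> (case j of None \<Rightarrow> Y | Some i \<Rightarrow> U \<inter> \<Phi> i ` topspace (closed_disc n)) \<and> h x = h x"
    proof (cases "y \<in> Y")
      case True
      then show ?thesis
        using ty by (intro exI[of _ None]) auto
    next
      case False
      then obtain i v where "i \<in> I" "v \<in> topspace (open_disc n)" "y = \<Phi> i v"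
        using ty(3) unfolding U by blast
      then show ?thesis
        using ty open_subset_closed_disc by (intro exI[of _ "Some i"]) auto
    qed
  qed simp
  have h0: "h (0, x) \<in> Y" if x: "x \<in> U" for x
  proof (cases "x \<in> Y")
    case False
    then obtain i v where iv: "i \<in> I" "v \<in> topspace (open_disc n) - {origin}" "x = \<Phi> i v"
      using x unfolding U by blast
    then have "v \<in> topspace (closed_disc n) - {origin}"
      using open_subset_closed_disc by blast
    then show ?thesis
      using h_cell[OF iv(1), of v 0] radial_closed_disc(2)[of v n 0] bd[OF iv(1)] iv(3) by auto
  qed (simp add: h_Y)
  have cont0: "continuous_map ZU ZU (\<lambda>x. h (0, x))"
  proof -
    have "continuous_map ZU (prod_topology (top_of_set {0..1::real}) ZU) (\<lambda>x. (0, x))"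
      by (simp add: continuous_map_pairwise comp_def)
    from continuous_map_compose[OF this cont] show ?thesis
      by (simp add: comp_def)
  qed
  have "continuous_map ZU (subtopology ZU Y) (\<lambda>x. h (0, x))"
    using cont0 h0 topU by (auto simp: continuous_map_in_subtopology)
  moreover have "homotopic_with (\<lambda>k. k ` Y \<subseteq> Y) ZU ZU (\<lambda>x. h (0, x)) id"
    unfolding homotopic_with_def
    using cont h_1 h_Y by (intro exI[of _ h]) auto
  ultimately show ?thesis
    unfolding ZU_def by (rule trivial_relative_homology_group_alt)
qed

lemma contractible_open_disc: "contractible_space (open_disc n)"
proof -
  define h where "h = (\<lambda>(t::real, v::nat \<Rightarrow> real) i. (1 - t) * v i)"
  define D where "D = {x. (\<forall>i\<ge>n. x i = (0::real)) \<and> dnorm n x < 1}"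
  have snd: "continuous_on S (\<lambda>p. snd p i)" for i and S :: "(real \<times> (nat \<Rightarrow> real)) set"
    by (intro continuous_on_product_then_coordinatewise[of S snd] continuous_intros)
  have "continuous_on ({0..1} \<times> D) (\<lambda>p i. (1 - fst p) * snd p i)"
    by (intro continuous_on_coordinatewise_then_product continuous_intros snd)
  moreover have "h (t, v) \<in> D" if "t \<in> {0..1}" "v \<in> D" for t v
  proof -
    have "(1 - t) * dnorm n v \<le> 1 * dnorm n v"
      using that by (intro mult_right_mono) auto
    then show ?thesis
      using that by (auto simp: h_def D_def dnorm_scale)
  qed
  ultimately have "continuous_map (prod_topology (top_of_set {0..1}) (top_of_set D)) (top_of_set D) h"
    by (auto simp: h_def case_prod_unfold)
  then have "homotopic_with (\<lambda>x. True) (top_of_set D) (top_of_set D) id (\<lambda>x. origin)"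
    unfolding homotopic_with_def by (intro exI[of _ h]) (auto simp: h_def origin_def)
  then show ?thesis
    unfolding contractible_space_def open_disc_eq D_def by blast
qed

lemma nsphere_eq:
  assumes "n > 0"
  shows "nsphere (n - 1) = top_of_set (disc_boundary n)"
proof -
  have "{..n - 1} = {..<n}"
    using assms by auto
  then have "nsphere (n - 1) = top_of_set ({x. \<forall>i\<ge>n. x i = 0} \<inter> {x. (\<Sum>i<n. x i ^ 2) = 1})"
    using assms by (simp add: nsphere_def Euclidean_top_of_set subtopology_subtopology)
  also have "{x. \<forall>i\<ge>n. x i = 0} \<inter> {x. (\<Sum>i<n. x i ^ 2) = 1} = disc_boundary n"
    by (auto simp: disc_boundary_eq dnorm_def)
  finally show ?thesis .
qed

lemma punctured_disc_homotopy_equivalent_nsphere: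
  assumes n: "n > 0"
  shows "subtopology (open_disc n) (- {origin}) homotopy_equivalent_space nsphere (n - 1)"
proof -
  define P where "P = {x. (\<forall>i\<ge>n. x i = (0::real)) \<and> 0 < dnorm n x \<and> dnorm n x < 1}"
  have Peq: "subtopology (open_disc n) (- {origin}) = top_of_set P"
  proof -
    have "{x. (\<forall>i\<ge>n. x i = 0) \<and> dnorm n x < 1} \<inter> - {origin} = P"
      using dnorm_eq_0[of n] dnorm_nonneg[of n] by (auto simp: P_def less_le)
    then show ?thesis
      by (simp add: open_disc_eq subtopology_subtopology)
  qed
  define f where "f v = radial n (0, v)" for v
  \<comment> \<open>The unit sphere does not lie in the open disc, so it is embedded as the sphere
    of radius 1/2. Accordingly \<open>h\<close> starts at \<open>v / (2 |v|)\<close> and ends at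
    \<open>v\<close>.\<close>
  define s where "s v = (\<lambda>i. (1/2) * v i)" for v :: "nat \<Rightarrow> real"
  define h where "h = (\<lambda>(t::real, v::nat \<Rightarrow> real) i. (t + (1 - t) / (2 * dnorm n v)) * v i)"
  have snd: "continuous_on S (\<lambda>p. snd p i)" for i and S :: "(real \<times> (nat \<Rightarrow> real)) set"
    by (intro continuous_on_product_then_coordinatewise[of S snd] continuous_intros)
  have coord: "continuous_on S (\<lambda>v. v i)" for i and S :: "(nat \<Rightarrow> real) set"
    by (intro continuous_on_product_then_coordinatewise[of S "\<lambda>v. v"] continuous_intros)
  have "f v \<in> disc_boundary n" if "v \<in> P" for v
  proof -
    have "v \<noteq> origin"
      using that by (auto simp: P_def)
    then show ?thesis
      using that radial_closed_disc(2)[of v n 0] by (simp add: f_def P_def topspace_closed_disc)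
  qed
  moreover have "continuous_on P (\<lambda>v i. (1 / dnorm n v) * v i)"
    by (intro continuous_on_coordinatewise_then_product continuous_intros coord continuous_on_id) (auto simp: P_def)
  ultimately have f: "continuous_map (top_of_set P) (top_of_set (disc_boundary n)) f"
    by (auto simp: f_def radial_def)
  have "continuous_on (disc_boundary n) s"
    unfolding s_def by (intro continuous_on_coordinatewise_then_product continuous_intros coord)
  moreover have "s v \<in> P" if "v \<in> disc_boundary n" for v
    using that dnorm_scale[of n "1/2" v] by (auto simp: s_def P_def disc_boundary_eq)
  ultimately have s: "continuous_map (top_of_set (disc_boundary n)) (top_of_set P) s"
    by auto
  have "(f \<circ> s) v = v" if "v \<in> disc_boundary n" for v
  proof -
    have d: "dnorm n (s v) = 1/2"
      using that dnorm_scale[of n "1/2" v] by (simp add: s_def disc_boundary_eq)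
    show ?thesis
      unfolding comp_def f_def radial_def prod.case d by (simp add: s_def)
  qed
  then have fs: "homotopic_with (\<lambda>x. True) (top_of_set (disc_boundary n)) (top_of_set (disc_boundary n)) (f \<circ> s) id"
    using continuous_map_compose[OF s f] by (intro homotopic_with_equal) auto
  have h_P: "h (t, v) \<in> P" if t: "t \<in> {0..1}" and v: "v \<in> P" for t v
  proof -
    have d: "0 < dnorm n v" "dnorm n v < 1" and z: "\<forall>i\<ge>n. v i = 0"
      using v by (auto simp: P_def)
    have "t + (1 - t) / (2 * dnorm n v) \<ge> 0"
      using d t by (intro add_nonneg_nonneg divide_nonneg_nonneg) auto
    then have eq: "dnorm n (h (t, v)) = t * dnorm n v + (1 - t) / 2"
      using d dnorm_scale[of n "t + (1 - t) / (2 * dnorm n v)" v] by (simp add: h_def distrib_right)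
    have "0 < t * dnorm n v + (1 - t) / 2"
    proof (cases "t = 0")
      case False
      then have "0 < t * dnorm n v" "0 \<le> (1 - t) / 2"
        using t d by auto
      then show ?thesis
        by linarith
    qed simp
    moreover have "t * dnorm n v + (1 - t) / 2 < 1"
    proof (cases "t = 0")
      case False
      then have "t * dnorm n v < t * 1"
        using t d by (intro mult_strict_left_mono) auto
      moreover have "(1 - t) / 2 \<le> 1 - t"
        using t by simp
      ultimately show ?thesis
        by linarith
    qed simp
    ultimately show ?thesis
      using z eq by (simp add: P_def) (simp add: h_def)
  qed
  have "continuous_on ({0..1} \<times> P) (\<lambda>p i. (fst p + (1 - fst p) / (2 * dnorm n (snd p))) * snd p i)"
    by (intro continuous_on_coordinatewise_then_product continuous_intros snd) (auto simp: P_def)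
  then have "continuous_map (prod_topology (top_of_set {0..1}) (top_of_set P)) (top_of_set P) h"
    using h_P by (auto simp: h_def case_prod_unfold)
  then have sf: "homotopic_with (\<lambda>x. True) (top_of_set P) (top_of_set P) (s \<circ> f) id"
    unfolding homotopic_with_def
    by (intro exI[of _ h]) (auto simp: h_def s_def f_def radial_def)
  show ?thesis
    unfolding homotopy_equivalent_space_def Peq nsphere_eq[OF n]
    using f s fs sf by blast
qed

lemma trivial_homology_open_disc: "trivial_group (homology_group (int (Suc k)) (open_disc n))"
proof -
  have nz: "int (Suc k) \<noteq> 0"
    by simp
  show ?thesis
    using trivial_reduced_homology_group_contractible_space[OF contractible_open_disc]
    unfolding un_reduced_homology_group[OF nz, symmetric] .
qed

text \<open>Up to homotopy the punctured disc is a sphere of dimension \<open>n - 1\<close>; for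
  \<open>n = 0\<close> it is empty.\<close>

lemma trivial_homology_punctured_disc:
  assumes "Suc k \<ge> n"
  shows "trivial_group (homology_group (int (Suc k)) (subtopology (open_disc n) (- {origin})))"
proof (cases "n = 0")
  case True
  have "topspace (subtopology (open_disc n) (- {origin})) = {}"
    using True dnorm_eq_0[of 0] by (auto simp: topspace_open_disc dnorm_def)
  then show ?thesis
    by (rule trivial_homology_group_empty)
next
  case False
  have "trivial_group (homology_group (int (Suc k)) (nsphere (n - 1)))"
    using trivial_reduced_homology_group_nsphere[of "int (Suc k)" "n - 1"]
      un_reduced_homology_group[of "int (Suc k)" "nsphere (n - 1)"] assms False by simp
  moreover have "homology_group (int (Suc k)) (subtopology (open_disc n) (- {origin})) \<cong>
      homology_group (int (Suc k)) (nsphere (n - 1))"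
    using punctured_disc_homotopy_equivalent_nsphere False
    by (intro homotopy_equivalent_space_imp_isomorphic_homology_groups) auto
  ultimately show ?thesis
    using isomorphic_group_triviality[OF _ group_relative_homology_group group_relative_homology_group] by blast
qed

text \<open>Chain degree \<open>m\<close> is homological degree \<open>m - 1\<close>, so the
  relative group sits between H_{m-1} of the cell and H_{m-2} of the punctured cell. The bound
  \<open>n + 3\<close> keeps \<open>m - 2\<close> positive, where reduced and unreduced homology
  agree, and at least \<open>n\<close>, beyond the dimension of the sphere.\<close>

lemma punctured_cell_bounded:
  assumes \<Phi>: "homeomorphic_map (open_disc n) (subtopology X e) \<Phi>" and m: "m \<ge> n + 3"
  shows "sing.acyc (schain (subtopology X e)) (schain (subtopology X (e - {\<Phi> origin}))) m"
proof -
  obtain k where k: "m = Suc (Suc (Suc k))" "Suc k \<ge> n"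
  proof
    show "m = Suc (Suc (Suc (m - 3)))" "Suc (m - 3) \<ge> n"
      using m by simp_all
  qed
  have "homology_group (int (Suc (Suc k))) (open_disc n) \<cong> homology_group (int (Suc (Suc k))) (subtopology X e)"
    using \<Phi> by (intro homeomorphic_space_imp_isomorphic_homology_groups) (auto simp: homeomorphic_space)
  from isomorphic_group_triviality[OF this group_relative_homology_group group_relative_homology_group]
  have "trivial_group (homology_group (int (Suc (Suc k))) (subtopology X e))"
    using trivial_homology_open_disc[of "Suc k" n] by blast
  then have A: "sing.acyc (schain (subtopology X e)) (\<lambda>_. {0}) (Suc (Suc (Suc k)))"
    by (rule acyc_homology)
  have surj: "\<Phi> ` topspace (open_disc n) = topspace (subtopology X e)" and inj: "inj_on \<Phi> (topspace (open_disc n))"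
    using \<Phi> by (auto simp: homeomorphic_eq_everything_map)
  have "homeomorphic_map (subtopology (open_disc n) (- {origin}))
      (subtopology (subtopology X e) (- {\<Phi> origin})) \<Phi>"
  proof (rule homeomorphic_map_subtopologies[OF \<Phi>])
    show "\<Phi> ` (topspace (open_disc n) \<inter> - {origin}) = topspace (subtopology X e) \<inter> - {\<Phi> origin}"
      using surj inj_onD[OF inj] origin_open_disc[of n] by blast
  qed
  moreover have "subtopology (subtopology X e) (- {\<Phi> origin}) = subtopology X (e - {\<Phi> origin})"
    by (simp add: subtopology_subtopology Diff_eq)
  ultimately have "homology_group (int (Suc k)) (subtopology (open_disc n) (- {origin})) \<cong>
      homology_group (int (Suc k)) (subtopology X (e - {\<Phi> origin}))"
    by (intro homeomorphic_space_imp_isomorphic_homology_groups) (auto simp: homeomorphic_space)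
  from isomorphic_group_triviality[OF this group_relative_homology_group group_relative_homology_group]
  have "trivial_group (homology_group (int (Suc k)) (subtopology X (e - {\<Phi> origin})))"
    using trivial_homology_punctured_disc[OF k(2)] by blast
  then have B: "sing.acyc (schain (subtopology X (e - {\<Phi> origin}))) (\<lambda>_. {0}) (Suc (Suc k))"
    by (rule acyc_homology)
  have "schain (subtopology X (e - {\<Phi> origin})) n \<subseteq> schain (subtopology X e) n" for n
    by (intro supp_mono sbasis_mono) blast
  from acyc_pair[OF subcomplex_schain subcomplex_schain this A B] show ?thesis
    unfolding k(1) .
qed

section \<open>Finite complexes with an action of prime order\<close>

locale prime_cw =
  fixes p :: nat and X :: "'a topology" and E :: "nat \<Rightarrow> 'a set set" and \<phi> :: "int \<Rightarrow> 'a \<Rightarrow> 'a"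
  assumes prime_p: "prime p" and GCW: "finite_G_CW_complex (integer_mod_group p) X E \<phi>"
begin

abbreviation "G \<equiv> integer_mod_group p"
abbreviation "g \<equiv> \<phi> 1"
abbreviation "Q \<equiv> orbit_space G X \<phi>"
abbreviation "q \<equiv> orbit G \<phi>"

lemma p_gt_1: "p > 1"
  using prime_p prime_gt_1_nat by blast

lemma carrier_G: "carrier G = {0..<int p}"
  using p_gt_1 by (simp add: carrier_integer_mod_group)

lemma G_CW: "G_CW_complex G X E \<phi>" and finite_cells: "finite (\<Union>n. E n)"
  using GCW by (simp_all add: finite_G_CW_complex_def)

lemma CW: "CW_complex X E" and action: "group_action G (topspace X) \<phi>"
  and cellular: "h \<in> carrier G \<Longrightarrow> cellular_map X E X E (\<phi> h)"
  and fixed_cell: "h \<in> carrier G \<Longrightarrow> e \<in> E n \<Longrightarrow> \<phi> h ` e = e \<Longrightarrow> x \<in> e \<Longrightarrow> \<phi> h x = x"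
proof -
  note * = G_CW[unfolded G_CW_complex_def]
  show "CW_complex X E"
    using * by (elim conjE)
  show "group_action G (topspace X) \<phi>"
    using * by (elim conjE)
  have "\<forall>h\<in>carrier G. cellular_map X E X E (\<phi> h)"
    using * by (elim conjE)
  moreover have "\<forall>h\<in>carrier G. \<forall>n. \<forall>e\<in>E n. \<phi> h ` e = e \<longrightarrow> (\<forall>x\<in>e. \<phi> h x = x)"
    using * by (elim conjE)
  ultimately show "h \<in> carrier G \<Longrightarrow> cellular_map X E X E (\<phi> h)"
    "h \<in> carrier G \<Longrightarrow> e \<in> E n \<Longrightarrow> \<phi> h ` e = e \<Longrightarrow> x \<in> e \<Longrightarrow> \<phi> h x = x"
    by simp_all
qed

lemma Hausdorff_X: "Hausdorff_space X" and cells_cover: "(\<Union>n. \<Union>(E n)) = topspace X"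
  and cells_disjoint: "e \<in> E m \<Longrightarrow> f \<in> E n \<Longrightarrow> e \<inter> f \<noteq> {} \<Longrightarrow> m = n \<and> e = f"
  and characteristic: "e \<in> E n \<Longrightarrow> \<exists>\<Phi>. characteristic_map X E n e \<Phi>"
proof -
  note * = CW[unfolded CW_complex_def]
  show "Hausdorff_space X"
    using * by (elim conjE)
  show "(\<Union>n. \<Union>(E n)) = topspace X"
    using * by (elim conjE)
  have "\<forall>m n. \<forall>e\<in>E m. \<forall>f\<in>E n. e \<inter> f \<noteq> {} \<longrightarrow> m = n \<and> e = f"
    using * by (elim conjE)
  moreover have "\<forall>n. \<forall>e\<in>E n. \<exists>\<Phi>. characteristic_map X E n e \<Phi>"
    using * by (elim conjE)
  ultimately show "e \<in> E m \<Longrightarrow> f \<in> E n \<Longrightarrow> e \<inter> f \<noteq> {} \<Longrightarrow> m = n \<and> e = f"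
    "e \<in> E n \<Longrightarrow> \<exists>\<Phi>. characteristic_map X E n e \<Phi>"
    by simp_all
qed

interpretation act: group_action G "topspace X" \<phi>
  by (rule action)

lemma phi_pow: "k < p \<Longrightarrow> x \<in> topspace X \<Longrightarrow> \<phi> (int k) x = (g ^^ k) x"
proof (induction k)
  case 0
  have "\<phi> \<one>\<^bsub>G\<^esub> x = x"
    using act.id_eq_one 0 by (metis restrict_apply')
  then show ?case
    by simp
next
  case (Suc k)
  have "\<phi> (1 \<otimes>\<^bsub>G\<^esub> int k) x = \<phi> 1 (\<phi> (int k) x)"
    using Suc.prems p_gt_1 by (intro act.composition_rule) (auto simp: carrier_G)
  moreover have "1 \<otimes>\<^bsub>G\<^esub> int k = int (Suc k)"
    using Suc.prems by simp
  ultimately show ?case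
    using Suc by simp
qed

lemma g_carrier: "1 \<in> carrier G"
  using p_gt_1 by (simp add: carrier_G)

lemma g_pow: "x \<in> topspace X \<Longrightarrow> (g ^^ p) x = x"
proof -
  assume x: "x \<in> topspace X"
  have "\<phi> (1 \<otimes>\<^bsub>G\<^esub> int (p - 1)) x = \<phi> 1 (\<phi> (int (p - 1)) x)"
    using x p_gt_1 by (intro act.composition_rule) (auto simp: carrier_G)
  moreover have "1 \<otimes>\<^bsub>G\<^esub> int (p - 1) = 0"
    using p_gt_1 by (simp add: of_nat_diff)
  moreover have "\<phi> 0 x = x"
    using phi_pow[of 0 x] p_gt_1 x by simp
  moreover have "(g ^^ p) x = g ((g ^^ (p - 1)) x)"
    using p_gt_1 by (metis Suc_diff_1 comp_apply funpow.simps(2) less_trans zero_less_one)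
  ultimately show ?thesis
    using phi_pow[of "p - 1" x] p_gt_1 x by simp
qed

lemma q_def: "x \<in> topspace X \<Longrightarrow> q x = (\<lambda>k. (g ^^ k) x) ` {..<p}"
proof -
  assume x: "x \<in> topspace X"
  have "{0..<int p} = int ` {..<p}"
    by (auto simp: image_iff) (metis nat_int nat_less_iff zle_iff_zadd lessThan_iff int_nat_eq)
  then have "q x = (\<lambda>k. \<phi> (int k) x) ` {..<p}"
    unfolding orbit_def carrier_G by auto
  then show ?thesis
    using phi_pow[OF _ x] by (metis (no_types, lifting) image_cong lessThan_iff)
qed

lemma cont_g: "continuous_map X X g"
  using cellular[OF g_carrier] by (simp add: cellular_map_def)

lemma q_g: "x \<in> topspace X \<Longrightarrow> q (g x) = q x"
proof -
  assume x: "x \<in> topspace X"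
  have gx: "g x \<in> topspace X"
    using cont_g x by (auto simp: continuous_map_def Pi_iff)
  have "(g ^^ k) (g x) \<in> (\<lambda>k. (g ^^ k) x) ` {..<p}" if "k < p" for k
  proof (cases "Suc k < p")
    case True
    then show ?thesis
      by (intro image_eqI[of _ _ "Suc k"]) (simp_all add: funpow_swap1)
  next
    case False
    then have "Suc k = p"
      using that by simp
    then have "(g ^^ k) (g x) = (g ^^ 0) x"
      using g_pow[OF x] by (metis comp_apply funpow_Suc_right funpow_0)
    then show ?thesis
      using p_gt_1 by (intro image_eqI[of _ _ 0]) simp_all
  qed
  moreover have "(g ^^ k) x \<in> (\<lambda>k. (g ^^ k) (g x)) ` {..<p}" if "k < p" for k
  proof (cases k)
    case 0
    have "(g ^^ (p - 1)) (g x) = x"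
      using g_pow[OF x] p_gt_1 by (metis Suc_diff_1 comp_apply funpow_Suc_right less_trans zero_less_one)
    then show ?thesis
      using p_gt_1 0 by (intro image_eqI[of _ _ "p - 1"]) simp_all
  next
    case (Suc j)
    then show ?thesis
      using that by (intro image_eqI[of _ _ j]) (simp_all add: funpow_swap1)
  qed
  ultimately show ?thesis
    unfolding q_def[OF x] q_def[OF gx] by blast
qed

sublocale orbit_map p g X Q q
proof
  show "prime p" "continuous_map X X g"
    by (rule prime_p cont_g)+
  show "continuous_map X Q q"
    using quotient_map_orbit_space by (rule quotient_imp_continuous_map)
qed (use g_pow q_g in auto)

lemma q_gp: "x \<in> topspace X \<Longrightarrow> q ((g ^^ k) x) = q x"
  using g_topspace q_g by (induction k) auto

lemma q_eq: "x \<in> topspace X \<Longrightarrow> y \<in> topspace X \<Longrightarrow> q x = q y \<longleftrightarrow> (\<exists>k<p. y = (g ^^ k) x)"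
proof
  assume xy: "x \<in> topspace X" "y \<in> topspace X" and eq: "q x = q y"
  have "y \<in> q y"
    unfolding q_def[OF xy(2)] using p_gt_1 by (intro image_eqI[of _ _ 0]) simp_all
  then show "\<exists>k<p. y = (g ^^ k) x"
    unfolding eq[symmetric] q_def[OF xy(1)] by auto
next
  assume "x \<in> topspace X" "\<exists>k<p. y = (g ^^ k) x"
  then show "q x = q y"
    using q_gp by auto
qed

text \<open>The saturation of a set is a finite union of preimages under powers of \<open>g\<close>;
  this makes \<open>q\<close> both closed and open.\<close>

lemma preimage_image:
  assumes "C \<subseteq> topspace X"
  shows "{x \<in> topspace X. q x \<in> q ` C} = (\<Union>k<p. {x \<in> topspace X. (g ^^ k) x \<in> C})"
proof (intro equalityI subsetI)
  fix x assume "x \<in> {x \<in> topspace X. q x \<in> q ` C}"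
  then obtain c where c: "x \<in> topspace X" "c \<in> C" "q x = q c"
    by blast
  then obtain k where "k < p" "c = (g ^^ k) x"
    using q_eq[of x c] assms by blast
  then show "x \<in> (\<Union>k<p. {x \<in> topspace X. (g ^^ k) x \<in> C})"
    using c by blast
next
  fix x assume "x \<in> (\<Union>k<p. {x \<in> topspace X. (g ^^ k) x \<in> C})"
  then obtain k where k: "x \<in> topspace X" "(g ^^ k) x \<in> C"
    by blast
  then have "q ((g ^^ k) x) \<in> q ` C"
    by blast
  then show "x \<in> {x \<in> topspace X. q x \<in> q ` C}"
    using k q_gp by simp
qed

lemma cont_gp: "continuous_map X X (g ^^ k)"
proof (induction k)
  case (Suc k)
  then show ?case
    using continuous_map_compose[OF Suc cont_g] by (simp add: comp_def)
qed (simp add: id_def[symmetric])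

lemma q_surj: "q ` topspace X = topspace Q"
  using quotient_map_orbit_space[of X G \<phi>] by (simp add: quotient_map_def)

lemma closed_map_q: "closed_map X Q q"
  unfolding closed_map_def
proof (intro allI impI)
  fix C assume C: "closedin X C"
  have "closedin X {x \<in> topspace X. q x \<in> q ` C}"
    unfolding preimage_image[OF closedin_subset[OF C]]
    using closedin_continuous_map_preimage[OF cont_gp C] by (intro closedin_Union) auto
  moreover have "q ` C \<subseteq> topspace Q"
    using closedin_subset[OF C] q_surj by blast
  ultimately show "closedin Q (q ` C)"
    using quotient_map_orbit_space[of X G \<phi>] unfolding quotient_map_closedin by blast
qed

lemma open_map_q: "open_map X Q q"
  unfolding open_map_def
proof (intro allI impI)
  fix C assume C: "openin X C"
  have "openin X {x \<in> topspace X. q x \<in> q ` C}"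
    unfolding preimage_image[OF openin_subset[OF C]]
    using openin_continuous_map_preimage[OF cont_gp C] by (intro openin_Union) auto
  moreover have "q ` C \<subseteq> topspace Q"
    using openin_subset[OF C] q_surj by blast
  ultimately show "openin Q (q ` C)"
    using quotient_map_orbit_space[of X G \<phi>] unfolding quotient_map_def by blast
qed

text \<open>The skeleton of dimension \<open>n - 1\<close>, which has to be empty for
  \<open>n = 0\<close>; with truncated subtraction, \<open>skeleton E (n - 1)\<close> would yield
  the vertices there.\<close>

definition low :: "nat \<Rightarrow> 'a set" where
  "low n = (\<Union>m\<in>{..<n}. \<Union>(E m))"

lemma cell_subset: "e \<in> E n \<Longrightarrow> e \<subseteq> topspace X"
  unfolding cells_cover[symmetric] by blast

lemma low_subset: "low n \<subseteq> topspace X"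
  unfolding cells_cover[symmetric] low_def by blast

lemma characteristicD:
  assumes "characteristic_map X E n e \<Phi>" "e \<in> E n"
  shows "continuous_map (closed_disc n) X \<Phi>" "homeomorphic_map (open_disc n) (subtopology X e) \<Phi>"
    "\<Phi> ` disc_boundary n \<subseteq> low n" "\<Phi> ` topspace (open_disc n) = e" "inj_on \<Phi> (topspace (open_disc n))"
proof -
  show "continuous_map (closed_disc n) X \<Phi>" and h: "homeomorphic_map (open_disc n) (subtopology X e) \<Phi>"
    and "\<Phi> ` disc_boundary n \<subseteq> low n"
    using assms(1) by (auto simp: characteristic_map_def low_def)
  show "\<Phi> ` topspace (open_disc n) = e" "inj_on \<Phi> (topspace (open_disc n))"
    using h cell_subset[OF assms(2)] by (auto simp: homeomorphic_eq_everything_map Int_absorb1)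
qed

lemma closed_disc_image:
  assumes \<Phi>: "characteristic_map X E n e \<Phi>" and e: "e \<in> E n"
  shows "closedin X (\<Phi> ` topspace (closed_disc n))" "e \<subseteq> \<Phi> ` topspace (closed_disc n)"
    "\<Phi> ` topspace (closed_disc n) \<subseteq> e \<union> low n"
proof -
  note D = characteristicD[OF \<Phi> e]
  show "closedin X (\<Phi> ` topspace (closed_disc n))"
    using D(1) Hausdorff_X compact_closed_disc
    by (meson compactin_imp_closedin compact_space_def image_compactin)
  show "e \<subseteq> \<Phi> ` topspace (closed_disc n)"
    using D(4) open_subset_closed_disc by blast
  show "\<Phi> ` topspace (closed_disc n) \<subseteq> e \<union> low n"
    using D(3,4) closed_disc_cases by blast
qed

lemma cell_closure:
  assumes "e \<in> E n"
  obtains K where "closedin X K" "e \<subseteq> K" "K \<subseteq> e \<union> low n"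
proof -
  obtain \<Phi> where \<Phi>: "characteristic_map X E n e \<Phi>"
    using characteristic[OF assms] by blast
  show thesis
    using that closed_disc_image[OF \<Phi> assms] .
qed

lemma cell_low_disjoint:
  assumes "e \<in> E n"
  shows "e \<inter> low n = {}"
proof (rule ccontr)
  assume "e \<inter> low n \<noteq> {}"
  then obtain x m f where "x \<in> e" "m < n" "f \<in> E m" "x \<in> f"
    unfolding low_def by blast
  then show False
    using cells_disjoint[OF assms, of f m] by blast
qed

lemma cell_nonempty:
  assumes "e \<in> E n"
  shows "e \<noteq> {}"
proof -
  obtain \<Phi> where "characteristic_map X E n e \<Phi>"
    using characteristic[OF assms] by blast
  from characteristicD(4)[OF this assms] show ?thesis
    using origin_open_disc by blast
qed

lemma cell_connected: "e \<in> E n \<Longrightarrow> connectedin X e"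
proof -
  assume e: "e \<in> E n"
  obtain \<Phi> where \<Phi>: "characteristic_map X E n e \<Phi>"
    using characteristic[OF e] by blast
  have "connected_space (open_disc n)"
    using contractible_open_disc contractible_imp_connected_space by blast
  then have "connected_space (subtopology X e)"
    using characteristicD(2)[OF \<Phi> e] homeomorphic_connected_space homeomorphic_space by blast
  then show ?thesis
    using cell_subset[OF e] by (simp add: connectedin_def)
qed

text \<open>The closure of an \<open>n\<close>-cell adds only points of lower cells, so each cell is
  closed in the union. As there are finitely many, each is open as well.\<close>

lemma cell_openin:
  assumes D: "D \<subseteq> (\<Union>m. E m)" and e: "e \<in> D" and dim: "\<And>f. f \<in> D \<Longrightarrow> f \<in> E n"
  shows "openin (subtopology X (\<Union>D)) e" "closedin (subtopology X (\<Union>D)) e"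
proof -
  have closed: "closedin (subtopology X (\<Union>D)) f" if f: "f \<in> D" for f
  proof -
    obtain K where K: "closedin X K" "f \<subseteq> K" "K \<subseteq> f \<union> low n"
      using cell_closure[OF dim[OF f]] .
    have "low n \<inter> \<Union>D = {}"
      using cell_low_disjoint dim by blast
    then have "\<Union>D \<inter> K = f"
      using K f by blast
    then show ?thesis
      using closedin_subtopology_Int_closed[OF K(1), of "\<Union>D"] by simp
  qed
  then show "closedin (subtopology X (\<Union>D)) e"
    using e by blast
  have "finite D"
    using D finite_cells finite_subset by blast
  then have "closedin (subtopology X (\<Union>D)) (\<Union>(D - {e}))"
    using closed by (intro closedin_Union) auto
  moreover have "topspace (subtopology X (\<Union>D)) - \<Union>(D - {e}) = e"
  proof -
    have "topspace (subtopology X (\<Union>D)) = \<Union>D"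
      using cell_subset dim by fastforce
    moreover have "e \<inter> \<Union>(D - {e}) = {}"
      using cells_disjoint dim e by blast
    ultimately show ?thesis
      using e by blast
  qed
  ultimately show "openin (subtopology X (\<Union>D)) e"
    by (metis openin_diff openin_topspace)
qed

lemma g_low: "x \<in> low n \<Longrightarrow> (g ^^ k) x \<in> low n"
proof (induction k)
  case (Suc k)
  then have y: "(g ^^ k) x \<in> low n"
    by blast
  show ?case
  proof (cases n)
    case 0
    then show ?thesis
      using y by (simp add: low_def)
  next
    case (Suc m)
    then have "low n = skeleton E m"
      by (auto simp: low_def skeleton_def lessThan_Suc_atMost)
    then show ?thesis
      using y cellular[OF g_carrier] by (auto simp: cellular_map_def)
  qed
qed simp

text \<open>A point of an \<open>n\<close>-cell that \<open>g\<close> sends into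
  \<open>low n\<close> would remain in \<open>low n\<close>, yet \<open>p - 1\<close> further
  applications of \<open>g\<close> bring it back.\<close>

lemma g_cells: "x \<in> \<Union>(E n) \<Longrightarrow> (g ^^ k) x \<in> \<Union>(E n)"
proof (induction k)
  case (Suc k)
  then have y: "(g ^^ k) x \<in> \<Union>(E n)"
    by blast
  then have yX: "(g ^^ k) x \<in> topspace X"
    using cell_subset by blast
  have low_Suc: "low (Suc n) = low n \<union> \<Union>(E n)"
    by (simp add: low_def lessThan_Suc Un_commute)
  then have "(g ^^ Suc k) x \<in> low n \<union> \<Union>(E n)"
    using g_low[of "(g ^^ k) x" "Suc n" 1] y by auto
  moreover have "(g ^^ Suc k) x \<notin> low n"
  proof
    assume "(g ^^ Suc k) x \<in> low n"
    then have "(g ^^ (p - 1)) ((g ^^ 1) ((g ^^ k) x)) \<in> low n"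
      using g_low by simp
    then have "(g ^^ k) x \<in> low n"
      using gp_inverse[OF yX, of 1] p_gt_1 by simp
    then show False
      using y cell_low_disjoint by blast
  qed
  ultimately show ?case
    by blast
qed simp

text \<open>Cells are connected, and clopen in the union of all cells of their dimension.\<close>

lemma g_cell_subset:
  assumes e: "e \<in> E n"
  shows "\<exists>f\<in>E n. (g ^^ k) ` e \<subseteq> f"
proof -
  have D: "E n \<subseteq> (\<Union>m. E m)"
    by blast
  have sub: "(g ^^ k) ` e \<subseteq> \<Union>(E n)"
    using g_cells e by blast
  have conn: "connectedin X ((g ^^ k) ` e)"
    using connectedin_continuous_map_image[OF cont_gp cell_connected[OF e]] .
  then have conn': "connectedin (subtopology X (\<Union>(E n))) ((g ^^ k) ` e)"
    using sub by (simp add: connectedin_subtopology)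
  obtain x where x: "x \<in> e"
    using cell_nonempty[OF e] by blast
  then obtain f where f: "f \<in> E n" "(g ^^ k) x \<in> f"
    using sub by blast
  have "(g ^^ k) ` e \<subseteq> f \<or> disjnt ((g ^^ k) ` e) f"
    using connectedin_clopen_cases[OF conn'] cell_openin[OF D f(1)] by blast
  then show ?thesis
    using f x by (auto simp: disjnt_iff)
qed

text \<open>The inclusion of \<open>g_cell_subset\<close>, applied both to \<open>g ^^ k\<close> and
  to its inverse \<open>g ^^ (p - k)\<close>, becomes an equality.\<close>

lemma g_cell:
  assumes e: "e \<in> E n" and k: "k \<le> p"
  shows "(g ^^ k) ` e \<in> E n"
proof -
  obtain f where f: "f \<in> E n" "(g ^^ k) ` e \<subseteq> f"
    using g_cell_subset[OF e] by blast
  obtain f' where f': "f' \<in> E n" "(g ^^ (p - k)) ` f \<subseteq> f'"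
    using g_cell_subset[OF f(1)] by blast
  have "(g ^^ (p - k)) ((g ^^ k) x) = x" if "x \<in> e" for x
    using gp_inverse k cell_subset[OF e] that by blast
  then have "e \<subseteq> f'"
    using f(2) f'(2) by (metis image_subset_iff subsetI)
  then have "f' = e"
    using cells_disjoint[OF e f'(1)] cell_nonempty[OF e] by blast
  have "f \<subseteq> (g ^^ k) ` e"
  proof
    fix y assume y: "y \<in> f"
    then have "(g ^^ (p - k)) y \<in> e"
      using f'(2) \<open>f' = e\<close> by blast
    moreover have "(g ^^ k) ((g ^^ (p - k)) y) = y"
      using gp_inverse[of y "p - k"] k cell_subset[OF f(1)] y by auto
    ultimately show "y \<in> (g ^^ k) ` e"
      by (metis imageI)
  qed
  then show ?thesis
    using f by (metis subset_antisym)
qed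

text \<open>A translate that meets \<open>e\<close> equals \<open>e\<close>. The condition on
  stabilisers of cells then makes a nontrivial power of \<open>g\<close> fix \<open>e\<close>
  pointwise, and primality passes this on to \<open>g\<close>.\<close>

lemma cell_fixed_or_free:
  assumes e: "e \<in> E n"
  shows "e \<subseteq> Fix \<or> (\<forall>k. 0 < k \<longrightarrow> k < p \<longrightarrow> (g ^^ k) ` e \<inter> e = {})"
proof (cases "\<exists>k. 0 < k \<and> k < p \<and> (g ^^ k) ` e \<inter> e \<noteq> {}")
  case True
  then obtain k where k: "0 < k" "k < p" "(g ^^ k) ` e \<inter> e \<noteq> {}"
    by blast
  then have eq: "(g ^^ k) ` e = e"
    using cells_disjoint[OF g_cell[OF e less_imp_le[OF k(2)]] e k(3)] by simp
  have "g x = x" if x: "x \<in> e" for x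
  proof -
    have xX: "x \<in> topspace X"
      using cell_subset[OF e] x by blast
    have "\<phi> (int k) ` e = (g ^^ k) ` e"
      using phi_pow[OF k(2)] cell_subset[OF e] by (intro image_cong) auto
    then have "\<phi> (int k) x = x"
      using fixed_cell[of "int k" e n x] k eq e x by (simp add: carrier_G)
    then show ?thesis
      using funpow_fixed_prime[OF prime_p g_pow[OF xX] _ k(1,2)] phi_pow[OF k(2) xX] by simp
  qed
  then show ?thesis
    using cell_subset[OF e] by (auto simp: Fix_def)
qed blast

lemma closedin_Fix: "closedin X Fix"
proof -
  have "closedin X {x \<in> topspace X. g x = id x}"
    by (rule closedin_continuous_maps_eq[OF Hausdorff_X cont_g continuous_map_id])
  then show ?thesis
    by (simp add: Fix_def)
qed

lemma compact_X: "compact_space X"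
proof -
  have "\<exists>K. compactin X K \<and> e \<subseteq> K" if e: "e \<in> E n" for e n
  proof -
    obtain \<Phi> where \<Phi>: "characteristic_map X E n e \<Phi>"
      using characteristic[OF e] by blast
    then have "compactin X (\<Phi> ` topspace (closed_disc n))"
      using characteristicD(1)[OF \<Phi> e] compact_closed_disc image_compactin compact_space_def by blast
    then show ?thesis
      using closed_disc_image(2)[OF \<Phi> e] by blast
  qed
  then obtain K where K: "\<And>e. e \<in> (\<Union>n. E n) \<Longrightarrow> compactin X (K e) \<and> e \<subseteq> K e"
    by (metis UN_E)
  have "compactin X (\<Union>e\<in>(\<Union>n. E n). K e)"
    using K finite_cells by (intro compactin_Union) auto
  moreover have "(\<Union>e\<in>(\<Union>n. E n). K e) = topspace X"
  proof
    show "(\<Union>e\<in>(\<Union>n. E n). K e) \<subseteq> topspace X"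
      using K compactin_subset_topspace by blast
    show "topspace X \<subseteq> (\<Union>e\<in>(\<Union>n. E n). K e)"
      using K cells_cover by fastforce
  qed
  ultimately show ?thesis
    by (simp add: compact_space_def)
qed

text \<open>\<open>X\<close> is compact Hausdorff, hence normal, and normality together with the
  Hausdorff property passes to images under closed continuous maps.\<close>

lemma Hausdorff_Q: "Hausdorff_space Q"
proof -
  have "normal_space X"
    using compact_X Hausdorff_X compact_Hausdorff_or_regular_imp_normal_space by blast
  then show ?thesis
    using normal_Hausdorff_space_closed_continuous_map_image[OF _ Hausdorff_X closed_map_q cont_q q_surj] by blast
qed

end

section \<open>Attaching free orbits of cells\<close>

context prime_cw
begin

lemma gp_mod: "x \<in> topspace X \<Longrightarrow> (g ^^ i) x = (g ^^ (i mod p)) x"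
proof (induction i rule: less_induct)
  case (less i)
  show ?case
  proof (cases "i < p")
    case False
    then have "(g ^^ i) x = (g ^^ (i - p)) ((g ^^ p) x)"
      using fun_cong[OF funpow_add[of "i - p" p g], of x] by simp
    then show ?thesis
      using less False p_gt_1 by (simp add: g_pow le_mod_geq)
  qed simp
qed

lemma saturated:
  assumes "g ` Y \<subseteq> Y" "Y \<subseteq> topspace X" "x \<in> topspace X" "q x \<in> q ` Y"
  shows "x \<in> Y"
proof -
  obtain y where y: "y \<in> Y" "q x = q y"
    using assms(4) by blast
  then obtain k where "x = (g ^^ k) y"
    using q_eq[of y x] assms(2,3) by auto
  then show ?thesis
    using gp_invariant[OF assms(1)] y(1) by blast
qed

text \<open>\<open>q\<close> stays closed when restricted to the saturated set \<open>Y\<close>, and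
  then to \<open>V\<close>, which is closed in \<open>Y\<close>. A closed continuous injection is a
  homeomorphism onto its image.\<close>

lemma homeomorphic_q:
  assumes gY: "g ` Y \<subseteq> Y" and YX: "Y \<subseteq> topspace X" and V: "V \<subseteq> Y" "closedin (subtopology X Y) V"
    and im: "q ` V = q ` Y" and inj: "inj_on q V"
  shows "homeomorphic_map (subtopology X V) (subtopology Q (q ` Y)) q"
proof (rule bijective_closed_imp_homeomorphic_map)
  have VX: "V \<subseteq> topspace X"
    using V YX by blast
  have "{x \<in> topspace X. q x \<in> q ` Y} = Y"
    using saturated[OF gY YX] YX by blast
  then have cl: "closed_map (subtopology X Y) (subtopology Q (q ` Y)) q"
    using closed_map_restriction[OF closed_map_q] by blast
  have sub: "subtopology (subtopology X Y) V = subtopology X V"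
    using V(1) by (simp add: subtopology_subtopology Int_absorb1)
  show "closed_map (subtopology X V) (subtopology Q (q ` Y)) q"
    unfolding closed_map_def
  proof (intro allI impI)
    fix K assume "closedin (subtopology X V) K"
    then have "closedin (subtopology X Y) K"
      using closedin_trans_full[OF _ V(2)] sub by simp
    then show "closedin (subtopology Q (q ` Y)) (q ` K)"
      using cl by (simp add: closed_map_def)
  qed
  show "continuous_map (subtopology X V) (subtopology Q (q ` Y)) q"
    using cont_q im by (auto simp: continuous_map_in_subtopology continuous_map_from_subtopology)
  have "q ` Y \<subseteq> topspace Q"
    using q_surj YX by blast
  then show "q ` topspace (subtopology X V) = topspace (subtopology Q (q ` Y))"
    using VX im by (simp add: Int_absorb1)
  show "inj_on q (topspace (subtopology X V))"
    using VX inj by (simp add: Int_absorb1)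
qed

lemma homeomorphic_Fix: "homeomorphic_map (subtopology X Fix) (subtopology Q (q ` Fix)) q"
proof (rule homeomorphic_q)
  show "closedin (subtopology X Fix) Fix"
    using closedin_subset_topspace[OF closedin_Fix] by blast
  show "inj_on q Fix"
  proof (rule inj_onI)
    fix x y assume xy: "x \<in> Fix" "y \<in> Fix" "q x = q y"
    then obtain k where "y = (g ^^ k) x"
      using q_eq[of x y] by (auto simp: Fix_def)
    moreover have "(g ^^ k) x = x"
      using xy(1) by (induction k) (auto simp: Fix_def)
    ultimately show "x = y"
      by simp
  qed
qed (auto simp: Fix_def)

lemma free_cell_disjoint:
  assumes e: "e \<in> E n" and free: "\<not> e \<subseteq> Fix" and ij: "i < p" "j < p" "i \<noteq> j"
  shows "(g ^^ i) ` e \<inter> (g ^^ j) ` e = {}"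
proof -
  have *: "(g ^^ i) ` e \<inter> (g ^^ j) ` e = {}" if ij: "i < j" "j < p" for i j
  proof (rule ccontr)
    assume "(g ^^ i) ` e \<inter> (g ^^ j) ` e \<noteq> {}"
    then obtain a b where ab: "a \<in> e" "b \<in> e" "(g ^^ i) a = (g ^^ j) b"
      by blast
    have aX: "a \<in> topspace X" and bX: "b \<in> topspace X"
      using ab cell_subset[OF e] by blast+
    have "(g ^^ j) b = (g ^^ i) ((g ^^ (j - i)) b)"
      using fun_cong[OF funpow_add[of i "j - i" g], of b] ij by simp
    then have "(g ^^ (p - i)) ((g ^^ i) a) = (g ^^ (p - i)) ((g ^^ i) ((g ^^ (j - i)) b))"
      using ab(3) by simp
    then have "a = (g ^^ (j - i)) b"
      using gp_inverse[of a i] gp_inverse[of "(g ^^ (j - i)) b" i] aX g_topspace[OF bX] ij by simp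
    then have "(g ^^ (j - i)) ` e \<inter> e \<noteq> {}"
      using ab by blast
    then show False
      using cell_fixed_or_free[OF e] free ij by (metis less_imp_diff_less zero_less_diff)
  qed
  show ?thesis
    using *[of i j] *[of j i] ij by (metis Int_commute linorder_neqE_nat)
qed

lemma orbit_invariant:
  assumes "A \<subseteq> topspace X"
  shows "g ` (\<Union>k<p. (g ^^ k) ` A) \<subseteq> (\<Union>k<p. (g ^^ k) ` A)"
proof
  fix y assume "y \<in> g ` (\<Union>k<p. (g ^^ k) ` A)"
  then obtain k x where kx: "x \<in> A" "y = (g ^^ Suc k) x"
    by auto
  then have "y = (g ^^ (Suc k mod p)) x"
    using gp_mod assms by blast
  moreover have "Suc k mod p < p"
    using p_gt_1 by simp
  ultimately show "y \<in> (\<Union>k<p. (g ^^ k) ` A)"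
    using kx(1) by blast
qed

text \<open>The invariant of the induction that builds \<open>X\<close> from \<open>Fix\<close> by
  one orbit of cells at a time.\<close>

definition admissible :: "'a set \<Rightarrow> bool" where
  "admissible Y \<longleftrightarrow> closedin X Y \<and> g ` Y \<subseteq> Y \<and> Fix \<subseteq> Y \<and> good Y"

text \<open>Supplies the topology behind \<open>good_step\<close>: the punctured cells retract onto
  \<open>Y'\<close> both in \<open>X\<close> and in the quotient, and \<open>U\<close> and
  \<open>W\<close> are open in the enlarged set, as are their images.\<close>

lemma admissible_attach:
  assumes adm: "admissible Y'" and e: "e \<in> E n" and low: "low n \<subseteq> Y'" and eY': "e \<inter> Y' = {}"
  shows "admissible (Y' \<union> (\<Union>k<p. (g ^^ k) ` e))"
proof -
  have clY': "closedin X Y'" and gY': "g ` Y' \<subseteq> Y'" and FY': "Fix \<subseteq> Y'" and good: "good Y'"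
    using adm by (auto simp: admissible_def)
  have Y'X: "Y' \<subseteq> topspace X" and eX: "e \<subseteq> topspace X"
    using closedin_subset[OF clY'] cell_subset[OF e] by auto
  have free: "\<not> e \<subseteq> Fix"
    using eY' FY' cell_nonempty[OF e] by blast
  obtain \<Phi> where \<Phi>: "characteristic_map X E n e \<Phi>"
    using characteristic[OF e] by blast
  note D = characteristicD[OF \<Phi> e]
  define \<Psi> where "\<Psi> k = (g ^^ k) \<circ> \<Phi>" for k
  define W where "W = (\<Union>k<p. (g ^^ k) ` e)"
  define Y where "Y = Y' \<union> W"
  define U where "U = Y' \<union> (\<Union>k<p. (g ^^ k) ` (e - {\<Phi> origin}))"
  have z: "\<Phi> origin \<in> e"
    using D(4) origin_open_disc by blast
  have \<Psi>cont: "continuous_map (closed_disc n) X (\<Psi> k)" for k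
    unfolding \<Psi>_def using continuous_map_compose[OF D(1) cont_gp] .
  have \<Psi>bd: "\<Psi> k ` disc_boundary n \<subseteq> Y'" for k
    using D(3) g_low low unfolding \<Psi>_def by fastforce
  have \<Psi>od: "\<Psi> k ` topspace (open_disc n) = (g ^^ k) ` e" for k
    unfolding \<Psi>_def D(4)[symmetric] by (simp add: image_comp)
  have \<Phi>od0: "\<Phi> ` (topspace (open_disc n) - {origin}) = e - {\<Phi> origin}"
    using D(4,5) origin_open_disc[of n] by (auto simp: inj_on_def)
  have \<Psi>od0: "\<Psi> k ` (topspace (open_disc n) - {origin}) = (g ^^ k) ` (e - {\<Phi> origin})" for k
    unfolding \<Psi>_def \<Phi>od0[symmetric] by (simp add: image_comp)
  have gp_inj: "x = y" if "x \<in> topspace X" "y \<in> topspace X" "(g ^^ k) x = (g ^^ k) y" "k < p" for x y k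
    using arg_cong[OF that(3), of "g ^^ (p - k)"] gp_inverse[OF that(1)] gp_inverse[OF that(2)] that(4) by simp
  have disj: "(g ^^ i) ` e \<inter> (g ^^ j) ` e = {}" if "i < p" "j < p" "i \<noteq> j" for i j
    using free_cell_disjoint[OF e free that] .
  have WY': "W \<inter> Y' = {}"
  proof (rule ccontr)
    assume "W \<inter> Y' \<noteq> {}"
    then obtain k x where kx: "k < p" "x \<in> e" "(g ^^ k) x \<in> Y'"
      unfolding W_def by blast
    have "(g ^^ (p - k)) ((g ^^ k) x) \<in> Y'"
      using gp_invariant[OF gY' kx(3)] .
    then show False
      using gp_inverse[OF subsetD[OF eX kx(2)] less_imp_le[OF kx(1)]] kx(2) eY' by auto
  qed
  have gW: "g ` W \<subseteq> W"
    unfolding W_def using orbit_invariant[OF eX] .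
  have gU: "g ` U \<subseteq> U"
    unfolding U_def image_Un using gY' orbit_invariant[of "e - {\<Phi> origin}"] eX by blast
  have WX: "W \<subseteq> topspace X"
    unfolding W_def using eX g_topspace by blast
  have UX: "U \<subseteq> topspace X"
    unfolding U_def using Y'X eX g_topspace by blast
  have UY: "U \<subseteq> Y" and WY: "W \<subseteq> Y" and Y_eq: "Y = U \<union> W"
    unfolding U_def W_def Y_def by blast+
  have YX: "Y \<subseteq> topspace X"
    unfolding Y_def using Y'X WX by blast
  have gY: "g ` Y \<subseteq> Y"
    unfolding Y_def image_Un using gY' gW by blast
  have eW: "e \<subseteq> W"
    using p_gt_1 unfolding W_def by (auto intro!: bexI[of _ 0])
  \<comment> \<open>The orbit of the centre of the cell. It is finite, hence closed, which makes its
    complement \<open>U\<close> open in \<open>Y\<close>.\<close>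
  define Z where "Z = (\<lambda>k. (g ^^ k) (\<Phi> origin)) ` {..<p}"
  have ZX: "Z \<subseteq> topspace X"
    unfolding Z_def using z eX g_topspace by blast
  have U_eq: "U = Y - Z"
  proof (intro equalityI subsetI)
    fix x assume x: "x \<in> U"
    have "x \<notin> Z"
    proof
      assume "x \<in> Z"
      then obtain j where j: "j < p" "x = (g ^^ j) (\<Phi> origin)"
        unfolding Z_def by blast
      then have "x \<in> W"
        using z unfolding W_def by blast
      then have "x \<notin> Y'"
        using WY' by blast
      then obtain k y where ky: "k < p" "y \<in> e" "y \<noteq> \<Phi> origin" "x = (g ^^ k) y"
        using x unfolding U_def by blast
      have "j = k"
        using disj[of j k] j ky z by blast
      then show False
        using gp_inj[of y "\<Phi> origin" k] ky j z eX by auto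
    qed
    then show "x \<in> Y - Z"
      using x UY by blast
  next
    fix x assume "x \<in> Y - Z"
    then show "x \<in> U"
      unfolding Y_def W_def U_def Z_def by blast
  qed
  have eU: "e \<inter> U = e - {\<Phi> origin}"
  proof -
    have "\<Phi> origin \<in> Z"
      unfolding Z_def using p_gt_1 by (intro image_eqI[of _ _ 0]) simp_all
    moreover have "x \<in> U" if "x \<in> e - {\<Phi> origin}" for x
      using that p_gt_1 unfolding U_def by (auto intro!: bexI[of _ 0])
    ultimately show ?thesis
      using U_eq by blast
  qed
  have Dcells: "(\<lambda>k. (g ^^ k) ` e) ` {..<p} \<subseteq> (\<Union>m. E m)" "\<And>f. f \<in> (\<lambda>k. (g ^^ k) ` e) ` {..<p} \<Longrightarrow> f \<in> E n"
    using g_cell[OF e less_imp_le] by auto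
  have D_W: "\<Union>((\<lambda>k. (g ^^ k) ` e) ` {..<p}) = W"
    by (simp add: W_def)
  have open_cell: "openin (subtopology X W) ((g ^^ k) ` e)" "closedin (subtopology X W) ((g ^^ k) ` e)" if "k < p" for k
    using cell_openin[OF Dcells(1) _ Dcells(2), of "(g ^^ k) ` e"] that unfolding D_W by blast+
  have inj_q: "inj_on q e"
  proof (rule inj_onI)
    fix a b assume ab: "a \<in> e" "b \<in> e" "q a = q b"
    then obtain k where k: "k < p" "b = (g ^^ k) a"
      using q_eq[of a b] eX by blast
    have "k = 0"
      using disj[of k 0] k ab p_gt_1 by auto
    then show "a = b"
      using k by simp
  qed
  have qeW: "q ` e = q ` W"
  proof
    show "q ` W \<subseteq> q ` e"
      unfolding W_def using q_gp eX by (auto simp: subset_iff)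
  qed (use eW in blast)
  have q_homeo: "homeomorphic_map (subtopology X e) (subtopology Q (q ` W)) q"
    using homeomorphic_q[OF gW WX eW _ qeW inj_q] open_cell(2)[of 0] p_gt_1 by simp
  interpret fco: free_cell_orbit p g X Q q U W e
  proof
    show "x \<in> U" if "x \<in> topspace X" "q x \<in> q ` U" for x
      using saturated[OF gU UX that] .
  qed (use gU UX FY' U_def eX W_def disj open_cell q_homeo in auto)
  have clY: "closedin X Y"
  proof -
    have "closedin X (\<Psi> k ` topspace (closed_disc n))" for k
      using \<Psi>cont[of k] Hausdorff_X compact_closed_disc
      by (meson compactin_imp_closedin compact_space_def image_compactin)
    then have cl: "closedin X (Y' \<union> (\<Union>k<p. \<Psi> k ` topspace (closed_disc n)))"
      using clY' by (intro closedin_Un closedin_Union) auto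
    have D1: "\<Psi> k ` topspace (closed_disc n) \<subseteq> Y' \<union> (g ^^ k) ` e" for k
    proof
      fix y assume "y \<in> \<Psi> k ` topspace (closed_disc n)"
      then obtain v where "y = \<Psi> k v" "v \<in> topspace (open_disc n) \<or> v \<in> disc_boundary n"
        using closed_disc_cases by blast
      then show "y \<in> Y' \<union> (g ^^ k) ` e"
        using \<Psi>od[of k] \<Psi>bd[of k] by blast
    qed
    have D2: "(g ^^ k) ` e \<subseteq> \<Psi> k ` topspace (closed_disc n)" for k
      using \<Psi>od[of k] open_subset_closed_disc by blast
    have "Y' \<union> (\<Union>k<p. \<Psi> k ` topspace (closed_disc n)) = Y"
    proof (intro equalityI)
      show "Y' \<union> (\<Union>k<p. \<Psi> k ` topspace (closed_disc n)) \<subseteq> Y"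
        unfolding Y_def W_def by (intro Un_least UN_least Un_upper1 order_trans[OF D1]) auto
      show "Y \<subseteq> Y' \<union> (\<Union>k<p. \<Psi> k ` topspace (closed_disc n))"
        unfolding Y_def W_def by (intro Un_mono UN_mono D2) auto
    qed
    with cl show ?thesis
      by simp
  qed
  have openU: "openin (subtopology X Y) U" and openW: "openin (subtopology X Y) W"
  proof -
    have "closedin X Z"
      using ZX Hausdorff_X closedin_Hausdorff_finite[of X Z] by (simp add: Z_def)
    then show "openin (subtopology X Y) U"
      unfolding U_eq by (rule openin_subtopology_diff_closed[OF YX])
    have "W = Y - Y'"
      unfolding Y_def using WY' by blast
    then show "openin (subtopology X Y) W"
      using openin_subtopology_diff_closed[OF YX clY'] by simp
  qed
  have subsub: "subtopology (subtopology T B) A = subtopology T A" if "A \<subseteq> B" for A B and T :: "'c topology"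
    using that by (simp add: subtopology_subtopology Int_absorb1)
  have exc: "acyc (ch Y) (\<lambda>n. supp (fco.BUW n)) n" for n
    using acyc_excision[OF openU openW, of n] equalityD1[OF Y_eq] YX
    by (simp add: subsub[OF UY] subsub[OF WY] Int_absorb1)
  have "{x \<in> topspace X. q x \<in> q ` Y} = Y"
    using saturated[OF gY YX] YX by blast
  then have open_q: "open_map (subtopology X Y) (subtopology Q (q ` Y)) q"
    using open_map_restriction[OF open_map_q] by blast
  have "openin (subtopology Q (q ` Y)) (q ` U)" "openin (subtopology Q (q ` Y)) (q ` W)"
    using open_q openU openW by (auto simp: open_map_def)
  moreover have "topspace (subtopology Q (q ` Y)) \<subseteq> q ` U \<union> q ` W"
    using Y_eq by auto
  ultimately have excQ: "sing.acyc (qch (q ` Y)) (\<lambda>n. supp (fco.QUW n)) n" for n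
    using acyc_excision[of "subtopology Q (q ` Y)" "q ` U" "q ` W" n]
    by (simp add: subsub[OF image_mono[OF UY]] subsub[OF image_mono[OF WY]])
  have Y'U: "Y' \<subseteq> U"
    unfolding U_def by blast
  have "trivial_group (relative_homology_group k (subtopology X U) Y')" for k
  proof (rule punctured_retract[where I = "{..<p}" and \<Phi> = \<Psi> and n = n])
    show "inj_on (\<Psi> k) (topspace (open_disc n))" if "k \<in> {..<p}" for k
    proof (rule inj_onI)
      fix v w assume vw: "v \<in> topspace (open_disc n)" "w \<in> topspace (open_disc n)" "\<Psi> k v = \<Psi> k w"
      then have "\<Phi> v \<in> e" "\<Phi> w \<in> e"
        using D(4) by blast+
      then have "\<Phi> v = \<Phi> w"
        using gp_inj[of "\<Phi> v" "\<Phi> w" k] vw(3) that eX by (auto simp: \<Psi>_def)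
      then show "v = w"
        using inj_onD[OF D(5)] vw by blast
    qed
    show "\<Psi> k ` topspace (open_disc n) \<inter> Y' = {}" if "k \<in> {..<p}" for k
      using WY' that unfolding \<Psi>od W_def by blast
    show "\<Psi> i ` topspace (open_disc n) \<inter> \<Psi> j ` topspace (open_disc n) = {}"
      if "i \<in> {..<p}" "j \<in> {..<p}" "i \<noteq> j" for i j
      using disj that unfolding \<Psi>od by simp
    show "U = Y' \<union> (\<Union>k\<in>{..<p}. \<Psi> k ` (topspace (open_disc n) - {origin}))"
      unfolding \<Psi>od0 U_def ..
  qed (use Hausdorff_X clY' \<Psi>cont \<Psi>bd in auto)
  then have ret: "acyc (ch U) (ch Y') n" for n
    using acyc_relative_homology_all[of "subtopology X U" Y' n] by (simp add: subsub[OF Y'U])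
  \<comment> \<open>In the quotient the whole orbit becomes a single cell with characteristic map
    \<open>q \<circ> \<Phi>\<close>, so the index set is a singleton.\<close>
  have "trivial_group (relative_homology_group k (subtopology Q (q ` U)) (q ` Y'))" for k
  proof (rule punctured_retract[where I = "{0::nat}" and \<Phi> = "\<lambda>_. q \<circ> \<Phi>" and n = n])
    show "closedin Q (q ` Y')"
      using closed_map_q clY' by (simp add: closed_map_def)
    show "continuous_map (closed_disc n) Q (q \<circ> \<Phi>)"
      using continuous_map_compose[OF D(1) cont_q] .
    show "(q \<circ> \<Phi>) ` disc_boundary n \<subseteq> q ` Y'"
      using D(3) low by (auto simp: image_comp[symmetric])
    show "inj_on (q \<circ> \<Phi>) (topspace (open_disc n))"
      using comp_inj_on[OF D(5), of q] inj_q D(4) by simp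
    show "(q \<circ> \<Phi>) ` topspace (open_disc n) \<inter> q ` Y' = {}"
    proof -
      have "q ` e \<inter> q ` Y' = {}"
        using saturated[OF gY' Y'X] eX eY' by blast
      then show ?thesis
        unfolding image_comp[symmetric] D(4) .
    qed
    have "q ` ((g ^^ k) ` (e - {\<Phi> origin})) = q ` (e - {\<Phi> origin})" for k
      using q_gp eX unfolding image_image by (intro image_cong) auto
    then have "q ` U = q ` Y' \<union> (\<Union>k<p. q ` (e - {\<Phi> origin}))"
      unfolding U_def image_Un image_UN by simp
    also have "\<dots> = q ` Y' \<union> (\<Union>k\<in>{0::nat}. (q \<circ> \<Phi>) ` (topspace (open_disc n) - {origin}))"
      using p_gt_1 unfolding image_comp[symmetric] \<Phi>od0 by auto
    finally show "q ` U = q ` Y' \<union> (\<Union>k\<in>{0::nat}. (q \<circ> \<Phi>) ` (topspace (open_disc n) - {origin}))" .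
  qed (use Hausdorff_Q in auto)
  then have retQ: "sing.acyc (qch (q ` U)) (qch (q ` Y')) n" for n
    using acyc_relative_homology_all[of "subtopology Q (q ` U)" "q ` Y'" n]
    by (simp add: subsub[OF image_mono[OF Y'U]])
  have H: "acyc (ch e) (ch (e \<inter> U)) m" if "m \<ge> n + 3" for m
    using punctured_cell_bounded[OF D(2) that] unfolding eU .
  have "good Y"
    using fco.good_step[OF gY' gY FY' Y'U UY WY YX exc excQ ret retQ H good] .
  then have "admissible Y"
    unfolding admissible_def using clY gY FY' Y_def by blast
  then show ?thesis
    unfolding Y_def W_def .
qed

lemma admissible_Fix: "admissible Fix"
  unfolding admissible_def using closedin_Fix g_Fix good_Fix by blast

lemma low_Suc: "low (Suc n) = low n \<union> \<Union>(E n)"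
  by (simp add: low_def lessThan_Suc Un_commute)

lemma admissible_low: "admissible (Fix \<union> low n)"
proof (induction n)
  case 0
  then show ?case
    using admissible_Fix by (simp add: low_def)
next
  case (Suc n)
  have "finite (E n)"
    using finite_cells by (rule finite_subset[rotated]) blast
  have "admissible (Fix \<union> low n \<union> (\<Union>e\<in>F. \<Union>k<p. (g ^^ k) ` e))" if "F \<subseteq> E n" "finite F" for F
    using that(2,1)
  proof (induction F rule: finite_induct)
    case empty
    then show ?case
      using Suc by simp
  next
    case (insert e F)
    define Y where "Y = Fix \<union> low n \<union> (\<Union>e\<in>F. \<Union>k<p. (g ^^ k) ` e)"
    have Y: "admissible Y"
      using insert unfolding Y_def by blast
    have e: "e \<in> E n" and F: "F \<subseteq> E n"
      using insert.prems by auto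
    have eq: "Fix \<union> low n \<union> (\<Union>e\<in>insert e F. \<Union>k<p. (g ^^ k) ` e) = Y \<union> (\<Union>k<p. (g ^^ k) ` e)"
      unfolding Y_def by blast
    show ?case
    proof (cases "e \<subseteq> Y")
      \<comment> \<open>This happens when \<open>e\<close> is a fixed cell or a translate of a cell
        in \<open>F\<close>.\<close>
      case True
      have "(g ^^ k) x \<in> Y" if "x \<in> e" for x k
        using gp_invariant[of Y x k] Y True that by (auto simp: admissible_def)
      then have "Y \<union> (\<Union>k<p. (g ^^ k) ` e) = Y"
        by blast
      then show ?thesis
        using Y eq by simp
    next
      case False
      have "e \<inter> Y = {}"
      proof (rule ccontr)
        assume "e \<inter> Y \<noteq> {}"
        then obtain x where x: "x \<in> e" "x \<in> Y"
          by blast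
        consider "x \<in> Fix" | "x \<in> low n" | f k where "f \<in> F" "k < p" "x \<in> (g ^^ k) ` f"
          using x(2) unfolding Y_def by blast
        then show False
        proof cases
          case 1
          then have "(g ^^ 1) ` e \<inter> e \<noteq> {}"
            using x(1) by (force simp: Fix_def)
          then have "e \<subseteq> Fix"
            using cell_fixed_or_free[OF e] p_gt_1 by (metis zero_less_one)
          then show False
            using False unfolding Y_def by blast
        next
          case 2
          then show False
            using cell_low_disjoint[OF e] x(1) by blast
        next
          case 3
          then have "(g ^^ k) ` f \<in> E n"
            using g_cell F by (meson less_imp_le subsetD)
          then have "e = (g ^^ k) ` f"
            using cells_disjoint[OF e] x(1) 3(3) by blast
          then show False
            using False 3 unfolding Y_def by blast
        qed
      qed
      moreover have "low n \<subseteq> Y"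
        unfolding Y_def by blast
      ultimately show ?thesis
        using admissible_attach[OF Y e] eq by simp
    qed
  qed
  from this[OF order_refl \<open>finite (E n)\<close>]
  have "admissible (Fix \<union> low n \<union> (\<Union>e\<in>E n. \<Union>k<p. (g ^^ k) ` e))" .
  moreover have "(\<Union>e\<in>E n. \<Union>k<p. (g ^^ k) ` e) = \<Union>(E n)"
  proof
    show "(\<Union>e\<in>E n. \<Union>k<p. (g ^^ k) ` e) \<subseteq> \<Union>(E n)"
      using g_cells by blast
    show "\<Union>(E n) \<subseteq> (\<Union>e\<in>E n. \<Union>k<p. (g ^^ k) ` e)"
    proof
      fix x assume "x \<in> \<Union>(E n)"
      then obtain e where "e \<in> E n" "x \<in> (g ^^ 0) ` e"
        by auto
      then show "x \<in> (\<Union>e\<in>E n. \<Union>k<p. (g ^^ k) ` e)"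
        using p_gt_1 by (intro UN_I[of e] UN_I[of 0]) auto
    qed
  qed
  ultimately show ?case
    unfolding low_Suc by (simp add: Un_assoc)
qed

lemma good_topspace: "good (topspace X)"
proof -
  obtain dim where dim: "\<And>e. e \<in> (\<Union>n. E n) \<Longrightarrow> e \<in> E (dim e)"
    by (metis UN_E)
  define N where "N = Suc (Max (insert 0 (dim ` (\<Union>n. E n))))"
  have "dim e < N" if "e \<in> (\<Union>n. E n)" for e
    using that finite_cells unfolding N_def by (simp add: less_Suc_eq_le)
  then have "topspace X \<subseteq> low N"
    unfolding cells_cover[symmetric] low_def using dim by fastforce
  then have "Fix \<union> low N = topspace X"
    using low_subset[of N] closedin_subset[OF closedin_Fix] by blast
  then show ?thesis
    using admissible_low[of N] by (simp add: admissible_def)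
qed

theorem reduced_homology_orbit_space:
  assumes red: "\<And>n::int. trivial_group (reduced_homology_group n X)"
  shows "trivial_group (reduced_homology_group n Q)"
proof (cases "topspace X = {}")
  \<comment> \<open>By convention the empty space has trivial reduced homology in every degree. It
    is kept apart because \<open>acyc_of_reduced_homology\<close> needs a point.\<close>
  case True
  then have "topspace Q = {}"
    using q_surj by simp
  then show ?thesis
    by (intro trivial_reduced_homology_group_empty) simp
next
  case False
  have "sing.acyc (schain Q) (\<lambda>_. {0}) n" for n
    using acyclic_quotient[OF good_topspace q_surj homeomorphic_Fix acyc_of_reduced_homology[OF red False]] .
  then show ?thesis
    by (rule reduced_homology_of_acyc)
qed

end

theorem theorem4p2:
  fixes p :: nat
    and X :: "'a topology"
    and E :: "nat \<Rightarrow> 'a set set"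
    and \<phi> :: "int \<Rightarrow> 'a \<Rightarrow> 'a"
  assumes "prime p"
    and "finite_G_CW_complex (integer_mod_group p) X E \<phi>"
    and "\<And>n :: int. trivial_group (reduced_homology_group n X)"
  shows "\<forall>n :: int. trivial_group (reduced_homology_group n (orbit_space (integer_mod_group p) X \<phi>))"
proof -
  interpret prime_cw p X E \<phi>
    using assms(1,2) by unfold_locales
  show ?thesis
    using reduced_homology_orbit_space assms(3) by blast
qed

end
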